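(* For any $\delta \in (0,1/2)$ there exists $C>0$ such that the following holds. Let $G_0$ be an $n$-vertex graph with minimum degree at least $\delta n$, and let $G \sim G_0 \cup \mathbf{G}(n,C/n)$ be uniformly coloured in $[n]$. Then with high probability (as $n\to\infty$) $G$ contains a rainbow Hamilton cycle.
   Context: Graphs are finite and simple. $\mathbf{G}(n,p)$ is the binomial random graph on vertex set $[n]=\{1,\dots,n\}$: each unordered pair of distinct vertices is an edge independently with probability $p$. $G_0 \cup \mathbf{G}(n,p)$ denotes the union of the fixed graph $G_0$ with a copy of $\mathbf{G}(n,p)$ on the same vertex set (an edge present in both is a single edge). A graph is uniformly coloured in a finite set $\mathcal{C}$ if each edge gets a colour in $\mathcal{C}$ independently and uniformly at random (independently also of the random graph). A subgraph is rainbow if no two of its edges have the same colour. "With high probability" means with probability tending to $1$ as $n\to\infty$; here $\delta$ and $C$ are fixed, and $G_0=G_0(n)$ is an arbitrary graph satisfying the hypothesis for each $n$. *)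

theory Defs
  imports "HOL-Library.Ramsey" "HOL-Probability.Probability"
begin

text \<open>
  A finite simple graph on a finite vertex set \<open>V\<close> is given by its edge set, a set of
  two-element subsets of \<open>V\<close>, i.e. a subset of \<open>nsets V 2\<close>.
\<close>

definition simple_graph :: "'a set \<Rightarrow> 'a set set \<Rightarrow> bool" where
  "simple_graph V E \<longleftrightarrow> finite V \<and> E \<subseteq> nsets V 2"

definition degree :: "'a set set \<Rightarrow> 'a \<Rightarrow> nat" where
  "degree E v = card {e \<in> E. v \<in> e}"

text \<open>Only meaningful for nonempty finite \<open>V\<close>.\<close>

definition min_degree :: "'a set \<Rightarrow> 'a set set \<Rightarrow> nat" where
  "min_degree V E = Min (degree E ` V)"

definition cycle_edges :: "'a list \<Rightarrow> 'a set set" where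
  "cycle_edges vs = {{vs ! i, vs ! (Suc i mod length vs)} |i. i < length vs}"

text \<open>\<open>H\<close> is the edge set of a Hamilton cycle of the graph \<open>(V, E)\<close>.\<close>

definition hamilton_cycle :: "'a set \<Rightarrow> 'a set set \<Rightarrow> 'a set set \<Rightarrow> bool" where
  "hamilton_cycle V E H \<longleftrightarrow>
     (\<exists>vs. distinct vs \<and> set vs = V \<and> length vs \<ge> 3 \<and> H = cycle_edges vs \<and> H \<subseteq> E)"

definition rainbow :: "('a set \<Rightarrow> 'c) \<Rightarrow> 'a set set \<Rightarrow> bool" where
  "rainbow c H \<longleftrightarrow> inj_on c H"

text \<open>
  The edge set of the binomial random graph on \<open>V\<close>. A parameter \<open>p > 1\<close>, which occurs for
  \<open>p = C / n\<close> with \<open>n < C\<close>, is read as \<open>1\<close> by \<open>bernoulli_pmf\<close>.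
\<close>

definition binomial_graph :: "'a set \<Rightarrow> real \<Rightarrow> 'a set set pmf" where
  "binomial_graph V p =
     map_pmf (\<lambda>present. {e \<in> nsets V 2. present e})
       (Pi_pmf (nsets V 2) False (\<lambda>_. bernoulli_pmf p))"

text \<open>Colourings are only relevant on the edges; elsewhere they take a dummy value.\<close>

definition uniform_colouring :: "'c set \<Rightarrow> 'a set set \<Rightarrow> ('a set \<Rightarrow> 'c) pmf" where
  "uniform_colouring C E = Pi_pmf E undefined (\<lambda>_. pmf_of_set C)"

definition coloured_perturbed_graph ::
    "'a set \<Rightarrow> 'a set set \<Rightarrow> real \<Rightarrow> 'c set \<Rightarrow> ('a set set \<times> ('a set \<Rightarrow> 'c)) pmf" where
  "coloured_perturbed_graph V E0 p C =
     bind_pmf (binomial_graph V p)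
       (\<lambda>R. map_pmf (\<lambda>c. (E0 \<union> R, c)) (uniform_colouring C (E0 \<union> R)))"

end

theory Submission
  imports Defs
begin

text \<open>
  Depth-first search in the random graph yields a rainbow path on all but a small linear number of
  vertices, and since the law of the random graph is invariant under relabelling, this path sits
  uniformly at random with respect to the dense graph. So for all vertices \<open>z\<close>, \<open>f\<close> linearly many
  triples of consecutive path vertices have their outer vertices adjacent to \<open>z\<close> and their middle
  vertex adjacent to \<open>f\<close>, in the dense graph minus the random one, whose colours are still unseen.
  Inserting left over vertices between consecutive path vertices, with two fresh unused colours
  each, reduces their number to \<open>\<eta>' n\<close> for an arbitrarily small \<open>\<eta>'\<close>.

  To finish, perform \<open>\<eta> n\<close> random Posa rotations, with \<open>\<eta>'\<close> much smaller than \<open>\<eta>\<close>, and then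
  absorb the remaining vertices and close the cycle, one rotation before each new edge. All new
  edges have fresh colours, and the result is rainbow if and only if these colours form a bijection
  onto the pool of unused and released colours, whose size \<open>N\<close> equals the number of new edges. This
  has probability \<open>N! / n\<^sup>N\<close>. Two runs sharing \<open>k\<close> new edges succeed together with at most
  \<open>(e n / N)\<^sup>k\<close> times the square of this probability. As every rotation has linearly many choices,
  two independent runs share an edge so rarely that the mean of \<open>(e n / N)\<^sup>k\<close> is \<open>1 + O(\<eta> + \<eta>' / \<eta>\<^sup>2)\<close>,
  and the second moment method applies.
\<close>


text \<open>A Hamilton cycle has n edges and there are n colours, so every colour must occur exactly
  once and the last edges have to meet the remaining colours exactly.

  The order of the constants shapes the rest. C depends on \<delta> alone, whereas the error \<rho>
  of the second moment is arbitrarily small. Depth-first search at this C leaves a fixed fraction of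
  the vertices, which insertion along dense edges lowers to \<eta>', chosen after \<rho>. Closing up
  without further rotations would give a pool of order \<eta>' n, an overlap factor B of order 1 /
  \<eta>', and an unbounded contribution \<eta>' B^2. Extra rotations enlarge the pool, so that B is
  of order 1 / \<eta>. They are cheap, since a rotation can repeat an edge of another run only from
  an end vertex from which that run rotated too.

  A rotation is given by a triple and not by a path edge because the direction in which the path
  passes the triple depends on the history. Being joined to both outer vertices, the end can rotate
  in either direction, and the new end is the middle vertex in both cases.\<close>

subsection \<open>Products of probability mass functions\<close>

lemma prob_bind_pmf:
  "measure_pmf.prob (bind_pmf M f) S = measure_pmf.expectation M (\<lambda>x. measure_pmf.prob (f x) S)"
proof -
  have "ennreal (measure_pmf.prob (bind_pmf M f) S) = (\<integral>\<^sup>+x. emeasure (f x) S \<partial>M)"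
    by (simp flip: measure_pmf.emeasure_eq_measure)
  also have "\<dots> = (\<integral>\<^sup>+x. ennreal (measure_pmf.prob (f x) S) \<partial>M)"
    by (simp add: measure_pmf.emeasure_eq_measure)
  also have "\<dots> = ennreal (measure_pmf.expectation M (\<lambda>x. measure_pmf.prob (f x) S))"
    by (rule nn_integral_eq_integral) (auto intro!: measure_pmf.integrable_const_bound[where B = 1])
  finally show ?thesis
    by (simp add: integral_nonneg_AE)
qed

text \<open>Exposure in two stages: \<open>G\<close> says that the first stage went well, and the
  failure probabilities add up.\<close>

lemma prob_bind_pmf_ge:
  assumes G: "measure_pmf.prob M G \<ge> 1 - a" and "0 \<le> b"
    and S: "\<And>x. x \<in> G \<Longrightarrow> x \<in> set_pmf M \<Longrightarrow> measure_pmf.prob (f x) S \<ge> 1 - b"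
  shows "measure_pmf.prob (bind_pmf M f) S \<ge> 1 - a - b"
proof -
  have "1 - a - b \<le> measure_pmf.prob M G - b"
    using G by simp
  also have "\<dots> = measure_pmf.expectation M (\<lambda>x. indicator G x - b)"
    by (subst Bochner_Integration.integral_diff)
       (auto intro!: measure_pmf.integrable_const_bound[where B = 1])
  also have "\<dots> \<le> measure_pmf.expectation M (\<lambda>x. measure_pmf.prob (f x) S)"
  proof (rule integral_mono_AE)
    show "AE x in measure_pmf M. indicator G x - b \<le> measure_pmf.prob (f x) S"
    proof (rule AE_pmfI)
      fix x assume x: "x \<in> set_pmf M"
      show "indicator G x - b \<le> measure_pmf.prob (f x) S"
        using S[OF _ x] \<open>0 \<le> b\<close> measure_nonneg[of "measure_pmf (f x)" S]
        by (auto simp: indicator_def simp del: measure_nonneg)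
    qed
  qed (auto intro!: measure_pmf.integrable_const_bound[where B = 1] Bochner_Integration.integrable_diff)
  finally show ?thesis
    by (simp add: prob_bind_pmf)
qed

lemma prob_pair_pmf_Times:
  "measure_pmf.prob (pair_pmf M N) (A \<times> B) = measure_pmf.prob M A * measure_pmf.prob N B"
proof -
  have "measure_pmf.prob (pair_pmf M N) (A \<times> B) =
      measure_pmf.prob (pair_pmf M N) ((A \<inter> set_pmf M) \<times> (B \<inter> set_pmf N))"
    by (rule measure_prob_cong_0) (auto simp: pmf_eq_0_set_pmf)
  also have "\<dots> = measure_pmf.prob M A * measure_pmf.prob N B"
    by (subst measure_pmf_prob_product) (auto simp: measure_Int_set_pmf)
  finally show ?thesis .
qed

text \<open>Cutting the index set at \<open>B\<close> writes the product measure as a pair of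
  independent factors, one seen by \<open>P\<close> only and the other by \<open>Q\<close>
  only.\<close>

lemma prob_Pi_pmf_indep:
  assumes "finite A"
    and P: "\<And>f g. (\<forall>x\<in>B. f x = g x) \<Longrightarrow> P f = P g"
    and Q: "\<And>f g. (\<forall>x\<in>A - B. f x = g x) \<Longrightarrow> Q f = Q g"
    and "B \<subseteq> A"
  shows "measure_pmf.prob (Pi_pmf A d p) {f. P f \<and> Q f} =
    measure_pmf.prob (Pi_pmf A d p) {f. P f} * measure_pmf.prob (Pi_pmf A d p) {f. Q f}"
proof -
  let ?M = "pair_pmf (Pi_pmf B d p) (Pi_pmf (A - B) d p)"
  have A: "Pi_pmf A d p = map_pmf (\<lambda>(f, g) x. if x \<in> B then f x else g x) ?M"
    using Pi_pmf_union[of B "A - B" d p] assms by (auto simp: Un_absorb1 finite_subset)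
  have eP: "P (\<lambda>x. if x \<in> B then f x else g x) = P f" for f g
    by (rule P) auto
  have eQ: "Q (\<lambda>x. if x \<in> B then f x else g x) = Q g" for f g
    by (rule Q) auto
  have "measure_pmf.prob (Pi_pmf A d p) {f. P f \<and> Q f} = measure_pmf.prob ?M ({f. P f} \<times> {g. Q g})"
    unfolding A by (auto simp: eP eQ intro!: arg_cong[where f = "measure_pmf.prob ?M"])
  moreover have "measure_pmf.prob (Pi_pmf A d p) {f. P f} = measure_pmf.prob ?M ({f. P f} \<times> UNIV)"
    unfolding A by (auto simp: eP eQ intro!: arg_cong[where f = "measure_pmf.prob ?M"])
  moreover have "measure_pmf.prob (Pi_pmf A d p) {f. Q f} = measure_pmf.prob ?M (UNIV \<times> {f. Q f})"
    unfolding A by (auto simp: eP eQ intro!: arg_cong[where f = "measure_pmf.prob ?M"])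
  ultimately show ?thesis
    by (simp add: prob_pair_pmf_Times)
qed

lemma prob_Pi_pmf_blocks:
  fixes Q :: "'t \<Rightarrow> ('a \<Rightarrow> 'b) \<Rightarrow> bool"
  assumes "finite A" "finite T" "disjoint_family_on B T" "\<And>t. t \<in> T \<Longrightarrow> B t \<subseteq> A"
    and Q: "\<And>t f g. t \<in> T \<Longrightarrow> (\<forall>x\<in>B t. f x = g x) \<Longrightarrow> Q t f = Q t g"
  shows "measure_pmf.prob (Pi_pmf A d p) {f. \<forall>t\<in>T. Q t f} =
    (\<Prod>t\<in>T. measure_pmf.prob (Pi_pmf A d p) {f. Q t f})"
  using assms(2-)
proof (induction T rule: finite_induct)
  case (insert t T)
  have "measure_pmf.prob (Pi_pmf A d p) {f. Q t f \<and> (\<forall>t\<in>T. Q t f)} =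
    measure_pmf.prob (Pi_pmf A d p) {f. Q t f} * measure_pmf.prob (Pi_pmf A d p) {f. \<forall>t\<in>T. Q t f}"
  proof (rule prob_Pi_pmf_indep[where B = "B t"])
    fix f g :: "'a \<Rightarrow> 'b" assume fg: "\<forall>x\<in>A - B t. f x = g x"
    have "Q s f = Q s g" if "s \<in> T" for s
    proof (rule insert.prems(3))
      have "B s \<subseteq> A - B t"
        using insert.prems(1) insert.prems(2)[of s] insert.hyps that
        by (auto simp: disjoint_family_on_def)
      then show "\<forall>x\<in>B s. f x = g x" using fg by auto
    qed (use that in auto)
    then show "(\<forall>t\<in>T. Q t f) = (\<forall>t\<in>T. Q t g)" by auto
  qed (use insert.prems assms(1) in auto)
  moreover have "measure_pmf.prob (Pi_pmf A d p) {f. \<forall>t\<in>T. Q t f} =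
      (\<Prod>t\<in>T. measure_pmf.prob (Pi_pmf A d p) {f. Q t f})"
    using insert.prems
    by (intro insert.IH) (auto simp: disjoint_family_on_def)
  ultimately show ?case
    using insert.hyps by simp
qed simp

text \<open>\<open>X c\<close> below is the conditional probability, given the colouring
  \<open>c\<close>, that a run drawn from \<open>\<mu>\<close> succeeds. Its mean is
  \<open>p\<close> and its second moment at most \<open>p\<^sup>2 * (1 + \<rho>)\<close>, so
  Chebyshev's inequality bounds the probability of \<open>X = 0\<close>. Weighting by
  \<open>\<mu>\<close> instead of counting runs admits sequential choices whose outcomes are not
  equally likely.\<close>

lemma second_moment_pmf:
  fixes M :: "'c pmf" and \<mu> :: "'w pmf" and G :: "'w \<Rightarrow> 'c set"
  assumes fin: "finite (set_pmf \<mu>)" and "p > 0"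
    and first: "\<And>w. w \<in> set_pmf \<mu> \<Longrightarrow> measure_pmf.prob M (G w) = p"
    and second: "\<And>v w. v \<in> set_pmf \<mu> \<Longrightarrow> w \<in> set_pmf \<mu> \<Longrightarrow>
      measure_pmf.prob M (G v \<inter> G w) \<le> p\<^sup>2 * r v w"
    and overlap: "\<And>v. v \<in> set_pmf \<mu> \<Longrightarrow> measure_pmf.expectation \<mu> (r v) \<le> 1 + \<rho>"
  shows "measure_pmf.prob M (\<Union>w\<in>set_pmf \<mu>. G w) \<ge> 1 - \<rho>"
proof -
  let ?W = "set_pmf \<mu>"
  define X where "X c = (\<Sum>w\<in>?W. pmf \<mu> w * indicator (G w) c)" for c :: 'c
  have sum1: "(\<Sum>w\<in>?W. pmf \<mu> w) = 1"
    using fin by (simp add: sum_pmf_eq_1)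
  have X0: "X c \<ge> 0" for c by (auto simp: X_def intro!: sum_nonneg)
  have intG: "integrable (measure_pmf M) (\<lambda>c. indicator A c :: real)" for A
    by (auto intro!: measure_pmf.integrable_const_bound[where B = 1])
  have intX: "integrable (measure_pmf M) X"
    unfolding X_def by (intro Bochner_Integration.integrable_sum integrable_mult_right intG)
  have EX: "measure_pmf.expectation M X = p"
    unfolding X_def
    by (subst Bochner_Integration.integral_sum)
       (auto simp: intG first sum1 simp flip: sum_distrib_right)
  have X2: "(X c)\<^sup>2 = (\<Sum>v\<in>?W. \<Sum>w\<in>?W. pmf \<mu> v * pmf \<mu> w * indicator (G v \<inter> G w) c)" for c
    unfolding X_def power2_eq_square sum_product
    by (intro sum.cong refl) (auto simp: indicator_def)
  have intX2: "integrable (measure_pmf M) (\<lambda>c. (X c)\<^sup>2)"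
    unfolding X2 by (intro Bochner_Integration.integrable_sum integrable_mult_right intG)
  have "measure_pmf.expectation M (\<lambda>c. (X c)\<^sup>2) =
      (\<Sum>v\<in>?W. \<Sum>w\<in>?W. pmf \<mu> v * pmf \<mu> w * measure_pmf.prob M (G v \<inter> G w))"
    unfolding X2
    by (subst Bochner_Integration.integral_sum, (intro Bochner_Integration.integrable_sum integrable_mult_right intG),
        subst Bochner_Integration.integral_sum) (auto simp: intG)
  also have "\<dots> \<le> (\<Sum>v\<in>?W. \<Sum>w\<in>?W. pmf \<mu> v * pmf \<mu> w * (p\<^sup>2 * r v w))"
    by (intro sum_mono mult_left_mono second) auto
  also have "\<dots> = p\<^sup>2 * (\<Sum>v\<in>?W. pmf \<mu> v * measure_pmf.expectation \<mu> (r v))"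
    using fin by (subst integral_measure_pmf_real[of ?W])
      (auto simp: sum_distrib_left mult_ac)
  also have "\<dots> \<le> p\<^sup>2 * (\<Sum>v\<in>?W. pmf \<mu> v * (1 + \<rho>))"
    by (intro mult_left_mono sum_mono overlap) auto
  also have "\<dots> = p\<^sup>2 * (1 + \<rho>)"
    by (simp add: sum1 flip: sum_distrib_right)
  finally have EX2: "measure_pmf.expectation M (\<lambda>c. (X c)\<^sup>2) \<le> p\<^sup>2 * (1 + \<rho>)" .
  \<comment> \<open>On \<open>X = 0\<close> the square of \<open>X - p\<close> equals
    \<open>p\<^sup>2\<close>.\<close>
  have "p\<^sup>2 * measure_pmf.prob M {c. X c = 0} = measure_pmf.expectation M (\<lambda>c. p\<^sup>2 * indicator {c. X c = 0} c)"
    by simp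
  also have "\<dots> \<le> measure_pmf.expectation M (\<lambda>c. (X c)\<^sup>2 - 2 * p * X c + p\<^sup>2)"
  proof (rule integral_mono)
    fix c
    have "(X c)\<^sup>2 - 2 * p * X c + p\<^sup>2 = (X c - p)\<^sup>2"
      by (simp add: power2_eq_square algebra_simps)
    then show "p\<^sup>2 * indicator {c. X c = 0} c \<le> (X c)\<^sup>2 - 2 * p * X c + p\<^sup>2"
      by (auto simp: indicator_def)
  qed (use intX intX2 intG in auto)
  also have "\<dots> = measure_pmf.expectation M (\<lambda>c. (X c)\<^sup>2) - 2 * p * p + p\<^sup>2"
    using intX intX2 by (simp add: EX)
  also have "\<dots> \<le> p\<^sup>2 * \<rho>"
    using EX2 by (simp add: power2_eq_square algebra_simps)
  finally have "measure_pmf.prob M {c. X c = 0} \<le> \<rho>"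
    using \<open>p > 0\<close> by simp
  moreover have "measure_pmf.prob M {c. X c = 0} = 1 - measure_pmf.prob M {c. X c \<noteq> 0}"
    using measure_pmf.prob_compl[of "{c. X c \<noteq> 0}" M] by (simp add: Compl_eq_Diff_UNIV[symmetric] Collect_neg_eq[symmetric])
  moreover have "measure_pmf.prob M {c. X c \<noteq> 0} \<le> measure_pmf.prob M (\<Union>w\<in>?W. G w)"
  proof (rule measure_pmf.finite_measure_mono)
    show "{c. X c \<noteq> 0} \<subseteq> (\<Union>w\<in>?W. G w)"
    proof safe
      fix c assume "X c \<noteq> 0"
      then obtain w where "w \<in> ?W" "pmf \<mu> w * indicator (G w) c \<noteq> 0"
        unfolding X_def by (meson sum.neutral)
      then show "c \<in> (\<Union>w\<in>?W. G w)" by (auto simp: indicator_def split: if_splits)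
    qed
  qed auto
  ultimately show ?thesis by linarith
qed

subsection \<open>Bijective colourings of edge sets\<close>

lemma PiE_dflt_undefined: "PiE_dflt A undefined B = PiE A B"
  by (auto simp: PiE_dflt_def PiE_def extensional_def Pi_def)

lemma card_injections_eq_fact:
  assumes "finite E" "finite Q" "card E = card Q"
  shows "card {f \<in> E \<rightarrow>\<^sub>E Q. inj_on f E} = fact (card Q)"
  using card_inj_on_subset_funcset[of E Q E] assms
  by (simp add: fact_prod_rev)

lemma prob_uniform_colouring:
  assumes "finite A" "E \<subseteq> A" "finite C" "C \<noteq> {}"
    and P: "\<And>f g. (\<forall>x\<in>E. f x = g x) \<Longrightarrow> P f = P g"
  shows "measure_pmf.prob (uniform_colouring C A) {c. P c} =
    card {c \<in> E \<rightarrow>\<^sub>E C. P c} / real (card C) ^ card E"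
proof -
  have "finite E" using assms by (meson finite_subset)
  have "measure_pmf.prob (uniform_colouring C E) {c. P c} =
      measure_pmf.prob (uniform_colouring C A) ((\<lambda>f x. if x \<in> E then f x else undefined) -` {c. P c})"
    unfolding uniform_colouring_def using assms by (subst Pi_pmf_subset[of A E]) auto
  also have "(\<lambda>f x. if x \<in> E then f x else undefined) -` {c. P c} = {c. P c}"
    using P[of "\<lambda>x. if x \<in> E then _ x else undefined"] by auto
  finally have "measure_pmf.prob (uniform_colouring C A) {c. P c} =
    measure_pmf.prob (pmf_of_set (E \<rightarrow>\<^sub>E C)) {c. P c}"
    using assms \<open>finite E\<close> unfolding uniform_colouring_def
    by (simp add: Pi_pmf_of_set PiE_dflt_undefined)
  also have "\<dots> = card {c \<in> E \<rightarrow>\<^sub>E C. P c} / real (card C) ^ card E"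
    using \<open>finite E\<close> assms
    by (subst measure_pmf_of_set) (auto simp: PiE_eq_empty_iff finite_PiE card_funcsetE Int_def)
  finally show ?thesis .
qed

lemma prob_colours_bij:
  assumes "finite A" "E \<subseteq> A" "finite C" "C \<noteq> {}" "Q \<subseteq> C" "card E = N" "card Q = N"
  shows "measure_pmf.prob (uniform_colouring C A) {c. bij_betw c E Q} = fact N / real (card C) ^ N"
proof -
  have fin: "finite E" "finite Q" using assms by (meson finite_subset)+
  have "measure_pmf.prob (uniform_colouring C A) {c. bij_betw c E Q} =
      card {c \<in> E \<rightarrow>\<^sub>E C. bij_betw c E Q} / real (card C) ^ card E"
    using assms by (intro prob_uniform_colouring bij_betw_cong) auto
  also have "{c \<in> E \<rightarrow>\<^sub>E C. bij_betw c E Q} = {c \<in> E \<rightarrow>\<^sub>E Q. inj_on c E}"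
  proof (intro equalityI subsetI)
    fix c assume "c \<in> {c \<in> E \<rightarrow>\<^sub>E Q. inj_on c E}"
    then have c: "c \<in> E \<rightarrow>\<^sub>E Q" "inj_on c E" by auto
    then have "c ` E = Q"
      using fin assms by (intro card_subset_eq) (auto simp: card_image)
    then show "c \<in> {c \<in> E \<rightarrow>\<^sub>E C. bij_betw c E Q}"
      using c assms by (auto simp: bij_betw_def PiE_def Pi_def)
  qed (auto simp: bij_betw_def PiE_def Pi_def)
  finally show ?thesis
    using fin assms by (simp add: card_injections_eq_fact)
qed

text \<open>Colour \<open>E\<close> first, in one of \<open>N!\<close> ways. The colours of
  \<open>E \<inter> E'\<close> are then fixed, and the other edges of \<open>E'\<close> must biject
  onto the rest of \<open>Q'\<close>, in \<open>(N - k)!\<close> ways for \<open>k\<close> common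
  edges.\<close>

lemma prob_colours_bij_bij_le:
  assumes "finite A" "E \<subseteq> A" "E' \<subseteq> A" "finite C" "C \<noteq> {}" "Q \<subseteq> C" "Q' \<subseteq> C"
    and N: "card E = N" "card Q = N" "card E' = N" "card Q' = N"
  shows "measure_pmf.prob (uniform_colouring C A) {c. bij_betw c E Q \<and> bij_betw c E' Q'}
    \<le> fact N * fact (N - card (E \<inter> E')) / real (card C) ^ (2 * N - card (E \<inter> E'))"
proof -
  have fin: "finite E" "finite Q" "finite E'" "finite Q'" using assms by (meson finite_subset)+
  define k where "k = card (E \<inter> E')"
  define G where "G = {g \<in> E \<rightarrow>\<^sub>E Q. inj_on g E \<and> g ` (E \<inter> E') \<subseteq> Q'}"
  define H where "H g = {h \<in> (E' - E) \<rightarrow>\<^sub>E (Q' - g ` (E \<inter> E')). inj_on h (E' - E)}" for g :: "'a set \<Rightarrow> 'b"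
  let ?S = "{c \<in> (E \<union> E') \<rightarrow>\<^sub>E C. bij_betw c E Q \<and> bij_betw c E' Q'}"
  have k: "card (E' - E) = N - k"
    using fin N by (simp add: k_def card_Diff_subset_Int Int_commute)
  have k_le: "k \<le> N"
    using fin N by (auto simp: k_def intro: card_mono)
  have cardU: "card (E \<union> E') = 2 * N - k"
    using card_Un_Int[OF fin(1,3)] N k_le by (simp add: k_def)
  have finG: "finite {g \<in> E \<rightarrow>\<^sub>E Q. inj_on g E}"
    using fin by (auto intro!: finite_PiE)
  have finG': "finite G"
    by (rule finite_subset[OF _ finG], unfold G_def) blast
  have finH: "finite (H g)" for g
    unfolding H_def by (rule finite_subset[where B = "(E' - E) \<rightarrow>\<^sub>E (Q' - g ` (E \<inter> E'))"])
      (use fin in \<open>auto intro!: finite_PiE\<close>)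
  have cardH: "card (H g) = fact (N - k)" if "g \<in> G" for g
  proof -
    have "card (g ` (E \<inter> E')) = k"
      using that unfolding k_def G_def by (intro card_image) (auto intro: inj_on_subset)
    then have "card (Q' - g ` (E \<inter> E')) = N - k"
      using that fin N by (subst card_Diff_subset) (auto simp: G_def)
    then show ?thesis
      using fin k unfolding H_def by (subst card_injections_eq_fact) auto
  qed
  have "card ?S \<le> card (Sigma G H)"
  proof (rule card_inj_on_le[where f = "\<lambda>c. (restrict c E, restrict c (E' - E))"])
    show "inj_on (\<lambda>c. (restrict c E, restrict c (E' - E))) ?S"
    proof (rule inj_onI)
      fix c d assume c: "c \<in> ?S" and d: "d \<in> ?S"
        and eq: "(restrict c E, restrict c (E' - E)) = (restrict d E, restrict d (E' - E))"
      show "c = d"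
      proof
        fix x
        show "c x = d x"
        proof (cases "x \<in> E \<union> E'")
          case True
          then show ?thesis using eq by (metis DiffI Pair_inject UnE restrict_apply')
        next
          case False
          then show ?thesis using c d by (auto simp: PiE_def extensional_def)
        qed
      qed
    qed
    show "(\<lambda>c. (restrict c E, restrict c (E' - E))) ` ?S \<subseteq> Sigma G H"
    proof safe
      fix c assume c: "bij_betw c E Q" "bij_betw c E' Q'"
      show "restrict c E \<in> G"
        using c unfolding G_def by (auto simp: bij_betw_def inj_on_def)
      have "c x \<notin> c ` (E \<inter> E')" if "x \<in> E' - E" for x
        using c that by (auto simp: bij_betw_def inj_on_def)
      then show "restrict c (E' - E) \<in> H (restrict c E)"
        using c unfolding H_def by (auto simp: bij_betw_def inj_on_def)
    qed
    show "finite (Sigma G H)"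
      using finG' finH by (rule finite_SigmaI)
  qed
  also have "\<dots> = (\<Sum>g\<in>G. card (H g))"
    using finG' finH by (intro card_SigmaI) blast+
  also have "\<dots> = (\<Sum>g\<in>G. fact (N - k))"
    using cardH by (intro sum.cong) blast+
  also have "\<dots> = card G * fact (N - k)" by simp
  finally have S: "card ?S \<le> card G * fact (N - k)" .
  have "card G \<le> card {g \<in> E \<rightarrow>\<^sub>E Q. inj_on g E}"
    using finG by (intro card_mono) (auto simp: G_def)
  also have "\<dots> = fact N"
    using fin N by (simp add: card_injections_eq_fact)
  finally have "card G * fact (N - k) \<le> fact N * fact (N - k)" by (rule mult_right_mono) simp
  with S have "card ?S \<le> fact N * fact (N - k)" by (rule order_trans)
  then have "real (card ?S) \<le> real (fact N * fact (N - k))" by (rule of_nat_mono)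
  then have S: "real (card ?S) \<le> fact N * fact (N - k)"
    by (simp only: of_nat_mult of_nat_fact)
  have "measure_pmf.prob (uniform_colouring C A) {c. bij_betw c E Q \<and> bij_betw c E' Q'} =
      card ?S / real (card C) ^ card (E \<union> E')"
  proof (rule prob_uniform_colouring)
    fix f g :: "'a set \<Rightarrow> 'b" assume "\<forall>x\<in>E \<union> E'. f x = g x"
    then have "bij_betw f E Q = bij_betw g E Q" "bij_betw f E' Q' = bij_betw g E' Q'"
      by (auto intro!: bij_betw_cong)
    then show "(bij_betw f E Q \<and> bij_betw f E' Q') = (bij_betw g E Q \<and> bij_betw g E' Q')" by simp
  qed (use assms in auto)
  also have "\<dots> \<le> fact N * fact (N - k) / real (card C) ^ (2 * N - k)"
    unfolding cardU by (intro divide_right_mono S) auto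
  finally show ?thesis by (simp add: k_def)
qed

text \<open>Takes the place of Stirling's formula. The induction runs over \<open>k\<close> with
  \<open>j = N - k\<close> fixed, and the step uses \<open>(1 + 1 / M) ^ k \<le> exp 1\<close> for
  \<open>M = j + k \<ge> k\<close>.\<close>

lemma power_mult_fact_le:
  assumes "k \<le> N"
  shows "real N ^ k * fact (N - k) \<le> exp (real k) * fact N"
proof -
  define j where "j = N - k"
  have "real (j + k) ^ k * fact j \<le> exp (real k) * fact (j + k)"
  proof (induction k)
    case (Suc k)
    show ?case
    proof (cases "j + k = 0")
      case False
      define M where "M = real (j + k)"
      have M: "M > 0" using False unfolding M_def by linarith
      have "(1 + 1 / M) ^ k \<le> exp (1 / M) ^ k"
        using M by (intro power_mono) (auto simp: exp_ge_add_one_self)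
      also have "\<dots> = exp (real k / M)"
        by (simp flip: exp_of_nat_mult)
      also have "\<dots> \<le> exp 1"
        using M by (auto simp: M_def divide_simps)
      finally have e: "(1 + 1 / M) ^ k \<le> exp 1" .
      have "(M + 1) ^ k = M ^ k * (1 + 1 / M) ^ k"
        using M by (simp add: field_simps flip: power_mult_distrib)
      then have "(M + 1) ^ Suc k * fact j = (M + 1) * (1 + 1 / M) ^ k * (M ^ k * fact j)"
        by simp
      also have "\<dots> \<le> (M + 1) * exp 1 * (exp (real k) * fact (j + k))"
      proof (rule mult_mono)
        show "(M + 1) * (1 + 1 / M) ^ k \<le> (M + 1) * exp 1"
          by (rule mult_left_mono[OF e]) (use M in linarith)
        show "M ^ k * fact j \<le> exp (real k) * fact (j + k)"
          using Suc.IH by (simp only: M_def)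
        show "0 \<le> (M + 1) * exp 1" by (rule mult_nonneg_nonneg) (use M in linarith, rule exp_ge_zero)
        show "0 \<le> M ^ k * (fact j :: real)" by (rule mult_nonneg_nonneg) (rule zero_le_power, use M in linarith, rule fact_ge_zero)
      qed
      also have "\<dots> = exp (real (Suc k)) * fact (j + Suc k)"
        by (simp add: M_def exp_add algebra_simps)
      finally show ?thesis by (simp add: M_def algebra_simps)
    qed auto
  qed auto
  then show ?thesis using assms by (simp add: j_def)
qed

text \<open>Brings the bound for a pair of runs into the form that \<open>second_moment_pmf\<close>
  expects: \<open>k\<close> shared edges cost a factor \<open>B ^ k\<close>. Only a lower bound on
  \<open>B\<close> is imposed, as \<open>N\<close> will vary with the number of vertices left
  over.\<close>

lemma fact_ratio_le:
  assumes "k \<le> N" "N > 0" "n > 0" "B \<ge> exp 1 * real n / real N"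
  shows "fact N * fact (N - k) / real n ^ (2 * N - k) \<le> (fact N / real n ^ N)\<^sup>2 * B ^ k"
proof -
  have "real N ^ k * fact (N - k) * real n ^ k \<le> exp (real k) * fact N * real n ^ k"
    using power_mult_fact_le[OF assms(1)] by (intro mult_right_mono) auto
  then have "fact (N - k) * real n ^ k \<le> fact N * (exp 1 * real n / real N) ^ k"
    using assms(2)
    by (simp add: field_simps power_mult_distrib power_divide exp_of_nat_mult[of k 1, simplified])
  also have "\<dots> \<le> fact N * B ^ k"
    using assms by (intro mult_left_mono power_mono) auto
  finally have *: "fact (N - k) * real n ^ k \<le> fact N * B ^ k" .
  have "real n ^ (2 * N) = real n ^ (2 * N - k) * real n ^ k"
    using assms(1) by (simp flip: power_add)
  then have "fact N * fact (N - k) / real n ^ (2 * N - k) = fact N * (fact (N - k) * real n ^ k) / real n ^ (2 * N)"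
    using assms(3) by simp
  also have "\<dots> \<le> fact N * (fact N * B ^ k) / real n ^ (2 * N)"
    using * by (intro divide_right_mono mult_left_mono) auto
  also have "\<dots> = (fact N / real n ^ N)\<^sup>2 * B ^ k"
    by (simp add: power2_eq_square power_mult mult.commute flip: power_add)
  finally show ?thesis .
qed

subsection \<open>Paths and rotations\<close>

fun path_edges :: "'a list \<Rightarrow> 'a set set" where
  "path_edges (x # y # xs) = insert {x, y} (path_edges (y # xs))"
| "path_edges _ = {}"

lemma path_edges_append: "path_edges (xs @ x # ys) = path_edges (xs @ [x]) \<union> path_edges (x # ys)"
  by (induction xs rule: path_edges.induct) auto

lemma path_edges_snoc:
  "w \<noteq> [] \<Longrightarrow> path_edges (w @ [f]) = insert {last w, f} (path_edges w)"
  by (induction w rule: path_edges.induct) auto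

lemma path_edges_rev [simp]: "path_edges (rev xs) = path_edges xs"
proof (induction xs)
  case (Cons x xs)
  then show ?case
    by (cases xs) (auto simp: path_edges_append[of _ _ "[_]"] path_edges_snoc insert_commute)
qed simp

lemma path_edges_iff:
  "e \<in> path_edges w \<longleftrightarrow> (\<exists>xs x y ys. w = xs @ x # y # ys \<and> e = {x, y})"
proof
  show "e \<in> path_edges w \<Longrightarrow> \<exists>xs x y ys. w = xs @ x # y # ys \<and> e = {x, y}"
  proof (induction w rule: path_edges.induct)
    case (1 x y xs)
    show ?case
    proof (cases "e = {x, y}")
      case True
      then show ?thesis by (metis append_Nil)
    next
      case False
      then obtain us u v vs where "y # xs = us @ u # v # vs" "e = {u, v}"
        using 1 by auto
      then have "x # y # xs = (x # us) @ u # v # vs" "e = {u, v}" by auto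
      then show ?thesis by blast
    qed
  qed auto
qed (auto simp: path_edges_append[of _ _ "_ # _"])

lemma path_edges_subset: "e \<in> path_edges w \<Longrightarrow> e \<subseteq> set w"
  by (auto simp: path_edges_iff)

lemma path_edges_nsets: "distinct w \<Longrightarrow> path_edges w \<subseteq> nsets (set w) 2"
  by (auto simp: path_edges_iff nsets_def)

lemma finite_path_edges [simp]: "finite (path_edges w)"
  by (induction w rule: path_edges.induct) auto

lemma card_path_edges: "distinct w \<Longrightarrow> card (path_edges w) = length w - 1"
proof (induction w rule: path_edges.induct)
  case (1 x y xs)
  have "{x, y} \<notin> path_edges (y # xs)"
    using 1 path_edges_subset[of "{x, y}" "y # xs"] by auto
  then show ?case using 1 by simp
qed auto

text \<open>Closing a cycle thus becomes one more appending step, with the head of the path as the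
  appended vertex.\<close>

lemma cycle_edges_eq_path_edges:
  assumes "w \<noteq> []"
  shows "cycle_edges w = path_edges (w @ [hd w])"
proof -
  let ?v = "w @ [hd w]"
  have "cycle_edges w = {{?v ! i, ?v ! Suc i} |i. i < length w}"
  proof -
    have *: "w ! (Suc i mod length w) = ?v ! Suc i" if "i < length w" for i
      using that assms by (cases "Suc i = length w") (auto simp: nth_append hd_conv_nth)
    have "w ! i = ?v ! i" if "i < length w" for i
      using that by (simp add: nth_append)
    with * show ?thesis unfolding cycle_edges_def by (intro Collect_cong) metis
  qed
  also have "\<dots> = path_edges ?v"
  proof (intro equalityI subsetI)
    fix e assume "e \<in> {{?v ! i, ?v ! Suc i} |i. i < length w}"
    then obtain i where i: "i < length w" "e = {?v ! i, ?v ! Suc i}" by auto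
    then have "?v = take i ?v @ ?v ! i # ?v ! Suc i # drop (Suc (Suc i)) ?v"
      by (metis Cons_nth_drop_Suc Suc_less_eq append_take_drop_id length_append_singleton less_SucI)
    with i show "e \<in> path_edges ?v" unfolding path_edges_iff by blast
  next
    fix e assume "e \<in> path_edges ?v"
    then obtain xs x y ys where v: "?v = xs @ x # y # ys" "e = {x, y}"
      unfolding path_edges_iff by blast
    have "length ?v = length xs + 2 + length ys" by (subst v) simp
    then have "length xs < length w" by simp
    moreover have "?v ! length xs = x" "?v ! Suc (length xs) = y"
      unfolding v by (auto simp: nth_append)
    ultimately show "e \<in> {{?v ! i, ?v ! Suc i} |i. i < length w}" using v by blast
  qed
  finally show ?thesis .
qed

lemma rotation:
  assumes "distinct w" "w = xs @ x # y # ys"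
  defines "w' \<equiv> xs @ x # rev (y # ys)"
  shows "distinct w'" "set w' = set w" "hd w' = hd w" "last w' = y" "length w' = length w"
    "path_edges w' = insert {last w, x} (path_edges w - {{x, y}})"
proof -
  have "hd (rev (y # ys)) = last w" by (simp add: assms hd_rev)
  then obtain zs where zs: "rev (y # ys) = last w # zs" by (metis list.collapse rev_is_Nil_conv list.simps(3))
  have "path_edges w' = path_edges (xs @ [x]) \<union> path_edges (x # last w # zs)"
    unfolding w'_def zs by (rule path_edges_append)
  also have "\<dots> = path_edges (xs @ [x]) \<union> insert {last w, x} (path_edges (y # ys))"
    using zs by (metis insert_commute path_edges.simps(1) path_edges_rev)
  finally have w': "path_edges w' = path_edges (xs @ [x]) \<union> insert {last w, x} (path_edges (y # ys))" .
  have w: "path_edges w = path_edges (xs @ [x]) \<union> insert {x, y} (path_edges (y # ys))"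
    unfolding assms(2) by (subst path_edges_append) simp
  have "{x, y} \<notin> path_edges (xs @ [x])" "{x, y} \<notin> path_edges (y # ys)"
    using assms(1,2) path_edges_subset[of "{x, y}" "xs @ [x]"] path_edges_subset[of "{x, y}" "y # ys"]
    by auto
  then show "path_edges w' = insert {last w, x} (path_edges w - {{x, y}})"
    unfolding w w' by auto
qed (use assms in \<open>auto simp: hd_append\<close>)

text \<open>Earlier rotations may have reversed the stretch through \<open>a\<close>,
  \<open>b\<close>, \<open>c\<close>, so only its edges are known. As \<open>b\<close> has both as
  neighbours on the path, one of them precedes it.\<close>

lemma path_predecessor:
  assumes "distinct w" "{a, b} \<in> path_edges w" "{b, c} \<in> path_edges w" "a \<noteq> c"
  shows "\<exists>xs x ys. x \<in> {a, c} \<and> w = xs @ x # b # ys"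
proof -
  obtain xs x y ys where 1: "w = xs @ x # y # ys" "{a, b} = {x, y}"
    using assms(2) unfolding path_edges_iff by blast
  obtain xs' x' y' ys' where 2: "w = xs' @ x' # y' # ys'" "{b, c} = {x', y'}"
    using assms(3) unfolding path_edges_iff by blast
  show ?thesis
  proof (cases "y = b \<or> y' = b")
    case True
    then show ?thesis
    proof
      assume "y = b"
      then have "x = a" using 1(2) by (auto simp: doubleton_eq_iff)
      then show ?thesis using 1(1) \<open>y = b\<close> by blast
    next
      assume "y' = b"
      then have "x' = c" using 2(2) by (auto simp: doubleton_eq_iff)
      then show ?thesis using 2(1) \<open>y' = b\<close> by blast
    qed
  next
    case False
    then have "x = b" "y = a" "x' = b" "y' = c" using 1 2 by (auto simp: doubleton_eq_iff)
    then have "xs @ b # a # ys = xs' @ b # c # ys'" using 1 2 by simp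
    moreover have "b \<notin> set xs" "b \<notin> set (a # ys)"
      using assms(1) 1 \<open>x = b\<close> \<open>y = a\<close> by auto
    ultimately have "a # ys = c # ys'" by (subst (asm) append_Cons_eq_iff) simp_all
    then show ?thesis using assms(4) by simp
  qed
qed

subsection \<open>The random rotation walk\<close>

text \<open>The effect of one random step of the walk: among at least \<open>K\<close> equally
  likely choices, exceptional sets raise the average only by their size over \<open>K\<close>. The
  left side has the shape produced by \<open>pmf_expectation_bind_pmf_of_set\<close>.\<close>

lemma average_le:
  assumes "finite S" "real K \<le> real (card S)" "0 < K" "0 \<le> \<alpha>" "0 \<le> \<beta>" "0 \<le> r"
    and "finite A" "card A \<le> na" "finite X" "card X \<le> nx"
    and f: "\<And>i. i \<in> S \<Longrightarrow> f i \<le> r * (1 + \<alpha> * indicator A i + \<beta> * indicator X i)"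
  shows "(\<Sum>i\<in>S. f i /\<^sub>R real (card S)) \<le> r * (1 + \<alpha> * real na / K + \<beta> * real nx / K)"
proof -
  have S: "real (card S) > 0" using assms by linarith
  have ind: "(\<Sum>i\<in>S. indicator Y i) \<le> real k" if "finite Y" "card Y \<le> k" for Y :: "'a set" and k
  proof -
    have "(\<Sum>i\<in>S. indicator Y i) = real (card (S \<inter> Y))"
      using \<open>finite S\<close> by (simp add: indicator_def sum.If_cases)
    moreover have "card (S \<inter> Y) \<le> card Y" using that by (intro card_mono) auto
    ultimately show ?thesis using that by linarith
  qed
  have "(\<Sum>i\<in>S. f i) \<le> (\<Sum>i\<in>S. r * (1 + \<alpha> * indicator A i + \<beta> * indicator X i))"
    by (rule sum_mono) (rule f)
  also have "\<dots> = r * (real (card S) + \<alpha> * (\<Sum>i\<in>S. indicator A i) + \<beta> * (\<Sum>i\<in>S. indicator X i))"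
    by (simp add: sum.distrib sum_distrib_left flip: sum_distrib_left)
  also have "\<dots> \<le> r * (real (card S) + \<alpha> * real na + \<beta> * real nx)"
    using assms by (intro mult_left_mono add_mono ind order_refl) auto
  finally have "(\<Sum>i\<in>S. f i) / real (card S) \<le> r * (real (card S) + \<alpha> * real na + \<beta> * real nx) / real (card S)"
    by (rule divide_right_mono) simp
  moreover have "(\<Sum>i\<in>S. f i /\<^sub>R real (card S)) = (\<Sum>i\<in>S. f i) / real (card S)"
    by (simp add: divide_inverse mult.commute sum_distrib_right)
  ultimately have "(\<Sum>i\<in>S. f i /\<^sub>R real (card S)) \<le> r * (real (card S) + \<alpha> * real na + \<beta> * real nx) / real (card S)"
    by simp
  also have "\<dots> = r * (1 + \<alpha> * real na / card S + \<beta> * real nx / card S)"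
    using S by (simp add: field_simps)
  also have "\<dots> \<le> r * (1 + \<alpha> * real na / K + \<beta> * real nx / K)"
    using assms S by (intro mult_left_mono add_mono divide_left_mono order_refl) auto
  finally show ?thesis .
qed

text \<open>
  A state of the rotation process: the current path, the indices of the triples already rotated at,
  the edges added to and removed from the original path \<open>q\<close>, and the former end vertices from
  which a rotation added an edge. In a step, \<open>None\<close> asks for a rotation only and \<open>Some f\<close> for a
  rotation followed by appending \<open>f\<close>. The last step has \<open>f = hd q\<close>, after which \<open>seq\<close> is a closed walk.
\<close>

datatype 'v walk = Walk (seq: "'v list") (used: "nat set") (added: "'v set set")
  (removed: "'v set set") (sources: "'v set")

text \<open>\<open>us\<close> lists the vertices missing from \<open>q\<close>, and \<open>D\<close>
  consists of edges with unseen colours. Every step uses up one triple, so the bound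
  \<open>K + F\<close> leaves \<open>K\<close> choices as long as at most \<open>F\<close> steps
  were made. The head and the last vertex of \<open>q\<close> avoid the triples because the one is
  the final target and the other the first source.\<close>

locale rotation_walk =
  fixes V :: "'v set" and q us :: "'v list" and a b c :: "nat \<Rightarrow> 'v" and m F K :: nat
    and D :: "'v set set"
  assumes q_nonempty: "q \<noteq> []"
    and q_us: "distinct (q @ us)" "set q \<union> set us = V"
    and triple_edges: "\<And>i. i < m \<Longrightarrow> {a i, b i} \<in> path_edges q"
      "\<And>i. i < m \<Longrightarrow> {b i, c i} \<in> path_edges q"
    and b_inj: "inj_on b {..<m}"
    and a_neq_c: "\<And>i. i < m \<Longrightarrow> a i \<noteq> c i"
    and outers_disjoint: "\<And>i j. i < m \<Longrightarrow> j < m \<Longrightarrow> i \<noteq> j \<Longrightarrow> {a i, c i} \<inter> {a j, c j} = {}"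
    and middle_not_outer: "\<And>i j. i < m \<Longrightarrow> j < m \<Longrightarrow> b i \<notin> {a j, c j}"
    and hd_q: "\<And>i. i < m \<Longrightarrow> hd q \<notin> {a i, b i, c i}"
    and last_q: "\<And>i. i < m \<Longrightarrow> last q \<notin> {a i, b i, c i}" "hd q \<noteq> last q"
    and D_nsets: "D \<subseteq> nsets V 2"
    and count: "\<And>z f. z \<in> V \<Longrightarrow> f \<in> V \<Longrightarrow>
      K + F \<le> card {i. i < m \<and> {z, a i} \<in> D \<and> {z, c i} \<in> D \<and> {b i, f} \<in> D}"
    and K_pos: "0 < K"
begin

definition outers :: "'v set" where
  "outers = (\<Union>i<m. {a i, c i})"

definition targets :: "'v set" where
  "targets = insert (hd q) (set us)"

text \<open>Which of \<open>a i\<close> and \<open>c i\<close> precedes \<open>b i\<close> depends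
  on the earlier rotations. Existence of the decomposition is settled in
  \<open>step_cases\<close>.\<close>

definition rotate_at :: "nat \<Rightarrow> 'v list \<Rightarrow> 'v \<times> 'v list" where
  "rotate_at i w = (SOME (x, w'). x \<in> {a i, c i} \<and>
     (\<exists>xs ys. w = xs @ x # b i # ys \<and> w' = xs @ x # rev (b i # ys)))"

definition step :: "'v option \<Rightarrow> nat \<Rightarrow> 'v walk \<Rightarrow> 'v walk" where
  "step d i s = (let z = last (seq s); (x, w) = rotate_at i (seq s) in
     Walk (case d of None \<Rightarrow> w | Some f \<Rightarrow> w @ [f]) (insert i (used s))
       ((case d of None \<Rightarrow> {} | Some f \<Rightarrow> {{b i, f}}) \<union> insert {z, x} (added s))
       (insert {x, b i} (removed s)) (insert z (sources s)))"

text \<open>Edges to both outer vertices are demanded although a rotation adds only one, since the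
  orientation decides which one.\<close>

definition choices :: "'v option \<Rightarrow> 'v walk \<Rightarrow> nat set" where
  "choices d s = {i. i < m \<and> i \<notin> used s \<and> {last (seq s), a i} \<in> D \<and> {last (seq s), c i} \<in> D \<and>
     (\<forall>f. d = Some f \<longrightarrow> {b i, f} \<in> D)}"

text \<open>The demands form a fixed list, so a run is determined by its triples. The uniform law
  requires nonempty \<open>choices\<close>, which \<open>card_choices\<close> supplies.\<close>

primrec run :: "'v option list \<Rightarrow> 'v walk \<Rightarrow> 'v walk pmf" where
  "run [] s = return_pmf s"
| "run (d # ds) s = bind_pmf (pmf_of_set (choices d s)) (\<lambda>i. run ds (step d i s))"

text \<open>Kept apart from \<open>edge_inv\<close> because the closing step, which appends the head
  again, destroys it. The end vertex is never a former source, so no vertex is rotated from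
  twice.\<close>

definition path_inv :: "'v set \<Rightarrow> 'v walk \<Rightarrow> bool" where
  "path_inv T s \<longleftrightarrow> distinct (seq s) \<and> set (seq s) = set q \<union> T \<and> seq s \<noteq> [] \<and> hd (seq s) = hd q \<and>
     last (seq s) \<notin> sources s \<and> last (seq s) \<in> insert (last q) (b ` used s \<union> T)"

text \<open>The last two clauses control the overlap with another run: added edges join a vertex
  outside \<open>outers\<close> to the outer vertices of at most one triple, and a target to at most
  one middle vertex. Hence at most one choice repeats an edge of either kind. The cardinalities of
  \<open>added\<close> and \<open>removed\<close> give the number of new edges and of released
  colours.\<close>

definition edge_inv :: "'v set \<Rightarrow> 'v walk \<Rightarrow> bool" where
  "edge_inv T s \<longleftrightarrow> T \<subseteq> targets \<and> used s \<subseteq> {..<m} \<and> finite (added s) \<and> added s \<subseteq> D \<and>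
     path_edges (seq s) = (path_edges q - removed s) \<union> added s \<and>
     sources s \<subseteq> insert (last q) (b ` used s \<union> T) \<and>
     (\<forall>e\<in>added s. (\<exists>z i x. e = {z, x} \<and> i \<in> used s \<and> x \<in> {a i, c i} \<and> z \<in> sources s) \<or>
                    (\<exists>i f. e = {b i, f} \<and> i \<in> used s \<and> f \<in> T)) \<and>
     removed s \<subseteq> {{x, b i} |x i. i \<in> used s \<and> x \<in> {a i, c i}} \<and>
     card (removed s) = card (used s) \<and> card (added s) = card (used s) + card T \<and>
     card (sources s) \<le> card (used s) \<and>
     (\<forall>y i j x x'. y \<notin> outers \<longrightarrow> i < m \<longrightarrow> j < m \<longrightarrow> x \<in> {a i, c i} \<longrightarrow> x' \<in> {a j, c j} \<longrightarrow>
        {y, x} \<in> added s \<longrightarrow> {y, x'} \<in> added s \<longrightarrow> i = j) \<and>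
     (\<forall>f\<in>targets. \<forall>i<m. \<forall>j<m. {b i, f} \<in> added s \<longrightarrow> {b j, f} \<in> added s \<longrightarrow> i = j)"

lemma triple_in_q: "i < m \<Longrightarrow> a i \<in> set q" "i < m \<Longrightarrow> b i \<in> set q" "i < m \<Longrightarrow> c i \<in> set q"
  using triple_edges path_edges_subset by blast+

lemma q_distinct: "distinct q" "distinct us" "set q \<inter> set us = {}"
  using q_us by auto

lemma hd_q_in: "hd q \<in> set q" and last_q_in: "last q \<in> set q"
  using q_nonempty by auto

lemma targets_not_triple: "f \<in> targets \<Longrightarrow> i < m \<Longrightarrow> f \<notin> {a i, b i, c i}"
  using triple_in_q[of i] hd_q[of i] q_distinct(3) unfolding targets_def by auto

lemma targets_neq_last: "f \<in> targets \<Longrightarrow> f \<noteq> last q"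
  using last_q(2) last_q_in q_distinct(3) unfolding targets_def by auto

lemma middle_not_outers: "i < m \<Longrightarrow> b i \<notin> outers"
  using middle_not_outer by (auto simp: outers_def)

lemma last_q_not_outers: "last q \<notin> outers"
  using last_q(1) by (fastforce simp: outers_def)

lemma targets_not_outers: "f \<in> targets \<Longrightarrow> f \<notin> outers"
  using targets_not_triple by (fastforce simp: outers_def)

lemma outer_unique:
  assumes "i < m" "j < m" "x \<in> {a i, c i}" "x \<in> {a j, c j}"
  shows "i = j"
  using outers_disjoint[OF assms(1,2)] assms(3,4) by blast

lemma edge_invD:
  assumes "edge_inv T s"
  shows "T \<subseteq> targets" "used s \<subseteq> {..<m}" "finite (added s)" "added s \<subseteq> D"
     "path_edges (seq s) = (path_edges q - removed s) \<union> added s"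
     "sources s \<subseteq> insert (last q) (b ` used s \<union> T)"
     "\<forall>e\<in>added s. (\<exists>z i x. e = {z, x} \<and> i \<in> used s \<and> x \<in> {a i, c i} \<and> z \<in> sources s) \<or>
                    (\<exists>i f. e = {b i, f} \<and> i \<in> used s \<and> f \<in> T)"
     "removed s \<subseteq> {{x, b i} |x i. i \<in> used s \<and> x \<in> {a i, c i}}"
     "card (removed s) = card (used s)" "card (added s) = card (used s) + card T"
     "card (sources s) \<le> card (used s)"
     "\<forall>y i j x x'. y \<notin> outers \<longrightarrow> i < m \<longrightarrow> j < m \<longrightarrow> x \<in> {a i, c i} \<longrightarrow> x' \<in> {a j, c j} \<longrightarrow>
        {y, x} \<in> added s \<longrightarrow> {y, x'} \<in> added s \<longrightarrow> i = j"
     "\<forall>f\<in>targets. \<forall>i<m. \<forall>j<m. {b i, f} \<in> added s \<longrightarrow> {b j, f} \<in> added s \<longrightarrow> i = j"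
  using assms[unfolded edge_inv_def] by - (elim conjE, assumption)+

lemma step_cases:
  assumes P: "path_inv T s" and E: "edge_inv T s" and i: "i \<in> choices d s"
  obtains x w where "x \<in> {a i, c i}" "distinct w" "set w = set (seq s)" "hd w = hd q" "last w = b i" "w \<noteq> []"
    "path_edges w = insert {last (seq s), x} (path_edges (seq s) - {{x, b i}})"
    "step d i s = Walk (case d of None \<Rightarrow> w | Some f \<Rightarrow> w @ [f]) (insert i (used s))
       ((case d of None \<Rightarrow> {} | Some f \<Rightarrow> {{b i, f}}) \<union> insert {last (seq s), x} (added s))
       (insert {x, b i} (removed s)) (insert (last (seq s)) (sources s))"
    "{last (seq s), x} \<in> D"
proof -
  have im: "i < m" "i \<notin> used s" using i by (auto simp: choices_def)
  have rem: "{x, b i} \<notin> removed s" for x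
  proof
    assume "{x, b i} \<in> removed s"
    then obtain j y where j: "j \<in> used s" "y \<in> {a j, c j}" "{x, b i} = {y, b j}"
      using edge_invD(8)[OF E] by blast
    then have "j < m" using edge_invD(2)[OF E] by auto
    then have "b i = b j"
      using j im middle_not_outer[of i j] by (auto simp: doubleton_eq_iff)
    then show False using b_inj im j \<open>j < m\<close> by (auto dest: inj_onD)
  qed
  have "{a i, b i} \<in> path_edges (seq s)" "{b i, c i} \<in> path_edges (seq s)"
    using triple_edges[OF im(1)] rem[of "a i"] rem[of "c i"] edge_invD(5)[OF E]
    by (auto simp: insert_commute)
  then have "\<exists>xs x ys. x \<in> {a i, c i} \<and> seq s = xs @ x # b i # ys"
    using P a_neq_c[OF im(1)] unfolding path_inv_def by (intro path_predecessor) auto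
  then have ex: "\<exists>p. case p of (x, w') \<Rightarrow> x \<in> {a i, c i} \<and>
     (\<exists>xs ys. seq s = xs @ x # b i # ys \<and> w' = xs @ x # rev (b i # ys))" by auto
  obtain x w where xw: "rotate_at i (seq s) = (x, w)" by (cases "rotate_at i (seq s)")
  from someI_ex[OF ex] xw have x: "x \<in> {a i, c i}"
    and "\<exists>xs ys. seq s = xs @ x # b i # ys \<and> w = xs @ x # rev (b i # ys)"
    unfolding rotate_at_def by auto
  then obtain xs ys where xs: "seq s = xs @ x # b i # ys" "w = xs @ x # rev (b i # ys)" by blast
  have "distinct (seq s)" using P by (simp add: path_inv_def)
  note rot = rotation[OF this xs(1), folded xs(2)]
  show ?thesis
  proof (rule that[OF x rot(1,2)])
    show "hd w = hd q" using rot(3) P by (simp add: path_inv_def)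
    show "w \<noteq> []" using xs by simp
    show "{last (seq s), x} \<in> D" using i x by (auto simp: choices_def)
  qed (use rot xw in \<open>simp_all add: step_def Let_def\<close>)
qed

lemma step_invs:
  assumes P: "path_inv T s" and E: "edge_inv T s" and i: "i \<in> choices d s"
    and d: "\<And>f. d = Some f \<Longrightarrow> f \<in> targets - T"
  shows "edge_inv (T \<union> set_option d) (step d i s)"
    and "(\<And>f. d = Some f \<Longrightarrow> f \<noteq> hd q) \<Longrightarrow> path_inv (T \<union> set_option d) (step d i s)"
    and "d = Some f \<Longrightarrow> \<exists>w. seq (step d i s) = w @ [f] \<and> distinct w \<and> set w = set q \<union> T \<and> hd w = hd q"
    and "used (step d i s) = insert i (used s)" "i \<notin> used s"
proof -
  have im: "i < m" "i \<notin> used s" using i by (auto simp: choices_def)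
  then show "i \<notin> used s" by simp
  obtain x w where xw: "x \<in> {a i, c i}" "distinct w" "set w = set (seq s)" "hd w = hd q" "last w = b i" "w \<noteq> []"
    "path_edges w = insert {last (seq s), x} (path_edges (seq s) - {{x, b i}})"
    and st: "step d i s = Walk (case d of None \<Rightarrow> w | Some f \<Rightarrow> w @ [f]) (insert i (used s))
       ((case d of None \<Rightarrow> {} | Some f \<Rightarrow> {{b i, f}}) \<union> insert {last (seq s), x} (added s))
       (insert {x, b i} (removed s)) (insert (last (seq s)) (sources s))"
    and xD: "{last (seq s), x} \<in> D"
    by (rule step_cases[OF P E i])
  define z where "z = last (seq s)"
  note st = st[folded z_def] and xw = xw[folded z_def] and xD = xD[folded z_def]
  show "used (step d i s) = insert i (used s)" by (simp add: st)
  note T = edge_invD(1)[OF E] and usedm = edge_invD(2)[OF E] and fin = edge_invD(3)[OF E]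
    and AD = edge_invD(4)[OF E] and pe = edge_invD(5)[OF E] and srcs = edge_invD(6)[OF E]
    and A = edge_invD(7)[OF E, rule_format] and R = edge_invD(8)[OF E]
    and cards = edge_invD(9-11)[OF E] and N1 = edge_invD(12)[OF E, rule_format]
    and N2 = edge_invD(13)[OF E, rule_format]
  have finT: "finite T" using T by (rule finite_subset) (simp add: targets_def)
  have finU: "finite (used s)" using usedm by (rule finite_subset) simp
  have "removed s \<subseteq> Pow (set q)"
  proof
    fix e assume "e \<in> removed s"
    then obtain y j where "e = {y, b j}" "j \<in> used s" "y \<in> {a j, c j}" using R by blast
    then show "e \<in> Pow (set q)" using usedm triple_in_q[of j] by auto
  qed
  then have finR: "finite (removed s)" by (rule finite_subset) simp
  have finS: "finite (sources s)" using srcs by (rule finite_subset) (use finU finT in simp)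
  have b_out: "b j \<notin> outers" if "j \<in> used s" for j
    using that usedm middle_not_outers by auto
  have src_out: "y \<notin> outers" if "y \<in> insert (last q) (b ` used s \<union> T)" for y
    using that b_out last_q_not_outers targets_not_outers T by auto
  have z_src: "z \<notin> sources s" and z_in: "z \<in> insert (last q) (b ` used s \<union> T)"
    using P by (simp_all add: path_inv_def z_def)
  have z_out: "z \<notin> outers" using src_out z_in by blast
  have x_out: "x \<in> outers" using xw(1) im by (auto simp: outers_def)
  have outer_used: "j \<in> used s \<Longrightarrow> y \<in> {a j, c j} \<Longrightarrow> y \<noteq> x" for j y
    using outer_unique[of j i y] xw(1) im usedm by auto
  \<comment> \<open>Earlier added edges meet \<open>outers\<close> only in used triples, since
    sources, middle vertices and targets lie outside \<open>outers\<close>.\<close>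
  have new_x: "x \<notin> e" if "e \<in> added s" for e
    using A[OF that]
  proof (elim disjE exE conjE)
    fix z' j x' assume "e = {z', x'}" "j \<in> used s" "x' \<in> {a j, c j}" "z' \<in> sources s"
    then show ?thesis using outer_used[of j x'] src_out[of z'] srcs x_out by auto
  next
    fix j f assume "e = {b j, f}" "j \<in> used s" "f \<in> T"
    then show ?thesis using b_out[of j] src_out[of f] x_out by auto
  qed
  have new_f: "f \<notin> e" if "e \<in> added s" and f: "f \<in> targets - T" for e f
  proof -
    have f1: "f \<notin> insert (last q) (b ` used s \<union> T)" "f \<notin> outers"
      using f targets_neq_last targets_not_triple usedm targets_not_outers by fastforce+
    from A[OF that(1)] show ?thesis
    proof (elim disjE exE conjE)
      fix z' j x' assume e: "e = {z', x'}" "j \<in> used s" "x' \<in> {a j, c j}" "z' \<in> sources s"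
      then have "x' \<in> outers" using usedm by (auto simp: outers_def)
      then show ?thesis using e f1 srcs by auto
    next
      fix j f' assume "e = {b j, f'}" "j \<in> used s" "f' \<in> T"
      then show ?thesis using f1 by auto
    qed
  qed
  have rem_new: "{x, b i} \<notin> removed s"
  proof
    assume "{x, b i} \<in> removed s"
    then obtain j y where j: "j \<in> used s" "y \<in> {a j, c j}" "{x, b i} = {y, b j}"
      using R by blast
    then show False
      using outer_used[of j y] b_out[of j] x_out by (auto simp: doubleton_eq_iff)
  qed
  have pe_w: "path_edges w = (path_edges q - insert {x, b i} (removed s)) \<union> insert {z, x} (added s)"
    unfolding xw(7) pe using new_x by auto
  have fD: "{b i, f} \<in> D" if "d = Some f" for f
    using i that by (simp add: choices_def)
  have f_neq: "{b i, f} \<noteq> {z, x}" if "d = Some f" for f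
    using x_out middle_not_outers[OF im(1)] targets_not_outers d[OF that] by (auto simp: doubleton_eq_iff)
  have f_new: "{b i, f} \<notin> added s" if "d = Some f" for f
    using new_f[OF _ d[OF that]] by blast
  have x_new: "{z, x} \<notin> added s" using new_x by blast
  have T': "T \<union> set_option d \<subseteq> targets" using T d by (cases d) auto
  have cT: "card (T \<union> set_option d) = card T + card (set_option d)"
    using d finT by (cases d) auto
  have cA: "card (added (step d i s)) = card (insert i (used s)) + card (T \<union> set_option d)"
  proof (cases d)
    case None
    show ?thesis using x_new fin finU im cards cT unfolding st by (simp add: None)
  next
    case (Some f)
    then have "{b i, f} \<notin> insert {z, x} (added s)" using f_neq[OF Some] f_new[OF Some] by blast
    then have "card (insert {b i, f} (insert {z, x} (added s))) = Suc (Suc (card (added s)))"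
      using card_insert_disjoint[OF fin x_new] card_insert_disjoint[of "insert {z, x} (added s)" "{b i, f}"] fin
      by (metis finite_insert)
    then have "card (added (step d i s)) = Suc (Suc (card (added s)))"
      unfolding st by (simp only: Some option.case walk.sel Un_insert_left Un_empty_left)
    then show ?thesis using finU im cards cT Some by simp
  qed
  let ?s = "step d i s"
  have newE: "e \<in> added ?s \<Longrightarrow> e \<in> added s \<or> e = {z, x} \<or> (\<exists>f. d = Some f \<and> e = {b i, f})" for e
    unfolding st by (cases d) auto
  have A': "(\<exists>z' j x'. e = {z', x'} \<and> j \<in> used ?s \<and> x' \<in> {a j, c j} \<and> z' \<in> sources ?s) \<or>
                    (\<exists>j f. e = {b j, f} \<and> j \<in> used ?s \<and> f \<in> T \<union> set_option d)" if "e \<in> added ?s" for e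
    using newE[OF that]
  proof (elim disjE)
    assume "e \<in> added s"
    from A[OF this] show ?thesis by (auto simp: st)
  next
    assume "e = {z, x}"
    then show ?thesis using xw(1) by (intro disjI1 exI[of _ z] exI[of _ i] exI[of _ x]) (simp add: st)
  next
    assume "\<exists>f. d = Some f \<and> e = {b i, f}"
    then show ?thesis by (auto simp: st)
  qed
  have split: "{y, x1} \<in> added s \<or> (y = z \<and> x1 = x \<and> j = i)"
    if "{y, x1} \<in> added ?s" "y \<notin> outers" "j < m" "x1 \<in> {a j, c j}" for y x1 j
  proof -
    have x1: "x1 \<in> outers" using that by (auto simp: outers_def)
    from newE[OF that(1)] show ?thesis
    proof (elim disjE)
      assume "{y, x1} = {z, x}"
      then have "y = z \<and> x1 = x" using that(2) x_out by (auto simp: doubleton_eq_iff)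
      then show ?thesis using outer_unique[OF that(3) im(1) that(4)] xw(1) by auto
    next
      assume "\<exists>f. d = Some f \<and> {y, x1} = {b i, f}"
      then show ?thesis
        using x1 middle_not_outers[OF im(1)] d targets_not_outers by (auto simp: doubleton_eq_iff)
    qed simp
  qed
  \<comment> \<open>An added edge from \<open>z\<close> to an outer vertex would make
    \<open>z\<close> a former source.\<close>
  have z_new: False if "{z, x1} \<in> added s" "j < m" "x1 \<in> {a j, c j}" for x1 j
    using A[OF that(1)]
  proof (elim disjE exE conjE)
    fix z' j' x' assume e: "{z, x1} = {z', x'}" "j' \<in> used s" "x' \<in> {a j', c j'}" "z' \<in> sources s"
    then have "x' \<in> outers" using usedm by (auto simp: outers_def)
    then have "z = z'" using e z_out by (auto simp: doubleton_eq_iff)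
    then show False using e z_src by simp
  next
    fix j' f' assume "{z, x1} = {b j', f'}" "j' \<in> used s" "f' \<in> T"
    moreover have "x1 \<in> outers" using that by (auto simp: outers_def)
    ultimately show False using b_out[of j'] src_out[of f'] by (auto simp: doubleton_eq_iff)
  qed
  have N1': "j = k" if "y \<notin> outers" "j < m" "k < m" "x1 \<in> {a j, c j}" "x2 \<in> {a k, c k}"
    "{y, x1} \<in> added ?s" "{y, x2} \<in> added ?s" for y j k x1 x2
    using split[OF that(6,1,2,4)] split[OF that(7,1,3,5)] N1[OF that(1-5)]
      z_new[of x1, OF _ that(2,4)] z_new[of x2, OF _ that(3,5)] by blast
  have split2: "({b j, f} \<in> added s \<and> d \<noteq> Some f) \<or> (j = i \<and> d = Some f)"
    if "{b j, f} \<in> added ?s" "f \<in> targets" "j < m" for j f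
    using newE[OF that(1)]
  proof (elim disjE)
    assume "{b j, f} \<in> added s"
    then show ?thesis using new_f d by blast
  next
    assume "{b j, f} = {z, x}"
    then show ?thesis using x_out middle_not_outers[OF that(3)] targets_not_outers[OF that(2)]
      by (auto simp: doubleton_eq_iff)
  next
    assume "\<exists>f'. d = Some f' \<and> {b j, f} = {b i, f'}"
    then obtain f' where f': "d = Some f'" "{b j, f} = {b i, f'}" by blast
    then have "b j = b i \<and> f = f'"
      using targets_not_triple[OF that(2) im(1)] by (auto simp: doubleton_eq_iff)
    then show ?thesis using f' b_inj im that(3) by (auto dest: inj_onD)
  qed
  have N2': "j = k" if "f \<in> targets" "j < m" "k < m" "{b j, f} \<in> added ?s" "{b k, f} \<in> added ?s" for f j k
    using split2[OF that(4,1,2)] split2[OF that(5,1,3)] N2[OF that(1-3)] by blast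
  have pe': "path_edges (seq ?s) = (path_edges q - removed ?s) \<union> added ?s"
    using pe_w xw(5,6) unfolding st by (cases d) (auto simp: path_edges_snoc)
  have srcs': "sources ?s \<subseteq> insert (last q) (b ` used ?s \<union> (T \<union> set_option d))"
    using srcs z_in by (auto simp: st)
  have R': "removed ?s \<subseteq> {{x, b i} |x i. i \<in> used ?s \<and> x \<in> {a i, c i}}"
  proof -
    have u: "used ?s = insert i (used s)" "removed ?s = insert {x, b i} (removed s)" by (simp_all add: st)
    have "{{x, b i} |x i. i \<in> used s \<and> x \<in> {a i, c i}} \<subseteq> {{x, b i} |x i. i \<in> used ?s \<and> x \<in> {a i, c i}}"
      unfolding u by blast
    moreover have "{x, b i} \<in> {{x, b i} |x i. i \<in> used ?s \<and> x \<in> {a i, c i}}"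
      using xw(1) unfolding u by blast
    ultimately show ?thesis using R unfolding u(2) by (meson insert_subsetI order_trans)
  qed
  have cR: "card (removed ?s) = card (used ?s)"
    using rem_new finR finU im cards by (simp add: st)
  have cS: "card (sources ?s) \<le> card (used ?s)"
    using finS finU im cards z_src by (simp add: st)
  show "edge_inv (T \<union> set_option d) ?s"
    unfolding edge_inv_def
  proof (intro conjI ballI allI impI)
    show "used ?s \<subseteq> {..<m}" using usedm im by (simp add: st)
    show "finite (added ?s)" using fin unfolding st by (cases d) auto
    show "added ?s \<subseteq> D" using AD xD fD unfolding st by (cases d) auto
    show "card (added ?s) = card (used ?s) + card (T \<union> set_option d)" using cA by (simp add: st)
  qed (fact T' pe' srcs' A' R' cR cS N1' N2')+
  show "\<exists>w. seq ?s = w @ [f] \<and> distinct w \<and> set w = set q \<union> T \<and> hd w = hd q" if "d = Some f"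
  proof (intro exI[of _ w] conjI)
    show "seq ?s = w @ [f]" using that unfolding st by simp
    show "set w = set q \<union> T" using P xw(3) unfolding path_inv_def by simp
  qed (fact xw)+
  show "path_inv (T \<union> set_option d) ?s" if "\<And>f. d = Some f \<Longrightarrow> f \<noteq> hd q"
  proof -
    have bi: "b i \<notin> sources s" "b i \<noteq> z"
    proof -
      have "b i \<notin> insert (last q) (b ` used s \<union> T)"
        using im last_q(1)[of i] T targets_not_triple[of "b i" i] b_inj usedm by (auto dest: inj_onD)
      then show "b i \<notin> sources s" "b i \<noteq> z" using srcs z_in by auto
    qed
    show ?thesis
    proof (cases d)
      case None
      then show ?thesis using P xw bi unfolding path_inv_def st by simp
    next
      case (Some f)
      have f: "f \<in> targets" "f \<notin> T" "f \<noteq> hd q" using d that Some by auto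
      then have "f \<notin> set q" using q_distinct(3) by (auto simp: targets_def)
      moreover have "f \<notin> insert (last q) (b ` used s \<union> T)"
        using f targets_neq_last targets_not_triple usedm by fastforce
      ultimately show ?thesis
        using P xw bi Some f srcs z_in unfolding path_inv_def st
        by auto
    qed
  qed
qed

definition start :: "'v walk" where
  "start = Walk q {} {} {} {}"

lemma start_invs: "path_inv {} start" "edge_inv {} start"
  using q_distinct q_nonempty by (auto simp: path_inv_def edge_inv_def start_def)

lemma choices_bounded: "choices d s \<subseteq> {..<m}"
  by (auto simp: choices_def)

lemma card_choices:
  assumes P: "path_inv T s" and E: "edge_inv T s" and "card (used s) \<le> F"
    and d: "\<And>f. d = Some f \<Longrightarrow> f \<in> V"
  shows "K \<le> card (choices d s)"
proof -
  define z where "z = last (seq s)"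
  have "z \<in> set (seq s)" using P unfolding path_inv_def z_def by (intro last_in_set) blast
  moreover have "set (seq s) = set q \<union> T" using P unfolding path_inv_def by blast
  ultimately have z: "z \<in> V"
    using edge_invD(1)[OF E] q_us hd_q_in by (auto simp: targets_def)
  \<comment> \<open>\<open>count\<close> speaks of two vertices. When nothing is to be appended,
    \<open>z\<close> fills the second place.\<close>
  define f where "f = (case d of None \<Rightarrow> z | Some f \<Rightarrow> f)"
  have "f \<in> V" using z d by (auto simp: f_def split: option.splits)
  let ?C = "{i. i < m \<and> {z, a i} \<in> D \<and> {z, c i} \<in> D \<and> {b i, f} \<in> D}"
  have "?C - used s \<subseteq> choices d s"
    by (auto simp: choices_def z_def f_def)
  moreover have fin: "finite (choices d s)"
    by (rule finite_subset[OF choices_bounded]) simp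
  ultimately have "card (?C - used s) \<le> card (choices d s)" by (rule card_mono[rotated])
  moreover have "card ?C - card (used s) \<le> card (?C - used s)"
    using edge_invD(2)[OF E] by (intro diff_card_le_card_Diff) (auto intro: finite_subset)
  ultimately show ?thesis
    using count[OF z \<open>f \<in> V\<close>] assms(3) by linarith
qed

lemma set_pmf_of_choices:
  assumes "path_inv T s" "edge_inv T s" "card (used s) \<le> F" "\<And>f. d = Some f \<Longrightarrow> f \<in> V"
  shows "set_pmf (pmf_of_set (choices d s)) = choices d s" "finite (choices d s)" "choices d s \<noteq> {}"
proof -
  show fin: "finite (choices d s)"
    by (rule finite_subset[OF choices_bounded]) simp
  show "choices d s \<noteq> {}"
    using card_choices[OF assms(1-3), of d] assms(4) K_pos by auto
  with fin show "set_pmf (pmf_of_set (choices d s)) = choices d s" by simp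
qed

definition final :: "'v walk \<Rightarrow> bool" where
  "final s \<longleftrightarrow> edge_inv targets s \<and>
     (\<exists>w. seq s = w @ [hd q] \<and> distinct w \<and> set w = V \<and> hd w = hd q)"

lemma targets_in_V: "targets \<subseteq> V"
  using q_us hd_q_in by (auto simp: targets_def)

lemma card_used_step:
  assumes "edge_inv T s" "i \<in> choices d s" "path_inv T s" "\<And>f. d = Some f \<Longrightarrow> f \<in> targets - T"
  shows "card (used (step d i s)) = Suc (card (used s))"
proof -
  have "finite (used s)" using edge_invD(2)[OF assms(1)] by (rule finite_subset) simp
  then show ?thesis using step_invs(4,5)[OF assms(3,1,2,4)] by simp
qed

lemma set_run_extensions:
  assumes "path_inv T s" "edge_inv T s" "distinct gs" "set gs = set us - T" "hd q \<notin> T"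
    "card (used s) + length gs < F"
  shows "finite (set_pmf (run (map Some gs @ [Some (hd q)]) s)) \<and>
    (\<forall>s'\<in>set_pmf (run (map Some gs @ [Some (hd q)]) s). final s' \<and> card (used s') = card (used s) + length gs + 1)"
  using assms
proof (induction gs arbitrary: T s)
  case Nil
  have hq: "hd q \<in> targets - T" using Nil by (simp add: targets_def)
  have T: "T = set us"
    using edge_invD(1)[OF Nil(2)] Nil by (auto simp: targets_def)
  have ch: "set_pmf (pmf_of_set (choices (Some (hd q)) s)) = choices (Some (hd q)) s"
    "finite (choices (Some (hd q)) s)"
    using set_pmf_of_choices[OF Nil(1,2), of "Some (hd q)"] Nil targets_in_V hq by auto
  have "final (step (Some (hd q)) i s) \<and> card (used (step (Some (hd q)) i s)) = card (used s) + 1"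
    if i: "i \<in> choices (Some (hd q)) s" for i
  proof
    have d: "\<And>f. Some (hd q) = Some f \<Longrightarrow> f \<in> targets - T" using hq by auto
    show "final (step (Some (hd q)) i s)"
      using step_invs(1)[OF Nil(1,2) i d] step_invs(3)[OF Nil(1,2) i d refl] T q_us
      by (simp add: final_def targets_def insert_commute Un_commute)
    show "card (used (step (Some (hd q)) i s)) = card (used s) + 1"
      using card_used_step[OF Nil(2) i Nil(1) d] by simp
  qed
  with ch show ?case by (auto simp: map_pmf_def[symmetric])
next
  case (Cons g gs)
  have g: "g \<in> targets - T" "g \<noteq> hd q" "g \<in> V"
    using Cons.prems q_distinct hd_q_in q_us by (auto simp: targets_def)
  then have d: "\<And>f. Some g = Some f \<Longrightarrow> f \<in> targets - T" "\<And>f. Some g = Some f \<Longrightarrow> f \<in> V"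
     "\<And>f. Some g = Some f \<Longrightarrow> f \<noteq> hd q" by auto
  have ch: "set_pmf (pmf_of_set (choices (Some g) s)) = choices (Some g) s" "finite (choices (Some g) s)"
    using set_pmf_of_choices[OF Cons.prems(1,2), of "Some g"] Cons.prems d by auto
  have IH: "finite (set_pmf (run (map Some gs @ [Some (hd q)]) (step (Some g) i s))) \<and>
    (\<forall>s'\<in>set_pmf (run (map Some gs @ [Some (hd q)]) (step (Some g) i s)). final s' \<and>
       card (used s') = card (used (step (Some g) i s)) + length gs + 1)"
    if i: "i \<in> choices (Some g) s" for i
  proof (rule Cons.IH)
    show "path_inv (insert g T) (step (Some g) i s)"
      using step_invs(2)[OF Cons.prems(1,2) i d(1,3)] by simp
    show "edge_inv (insert g T) (step (Some g) i s)"
      using step_invs(1)[OF Cons.prems(1,2) i d(1)] by simp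
    show "card (used (step (Some g) i s)) + length gs < F"
      using card_used_step[OF Cons.prems(2) i Cons.prems(1) d(1)] Cons.prems by simp
  qed (use Cons.prems g in auto)
  show ?case
    using ch IH card_used_step[OF Cons.prems(2) _ Cons.prems(1) d(1)] by auto
qed

lemma set_run:
  assumes "path_inv {} s" "edge_inv {} s" "card (used s) + l + length us < F"
  shows "finite (set_pmf (run (replicate l None @ map Some us @ [Some (hd q)]) s)) \<and>
    (\<forall>s'\<in>set_pmf (run (replicate l None @ map Some us @ [Some (hd q)]) s). final s' \<and>
       card (used s') = card (used s) + l + length us + 1)"
  using assms
proof (induction l arbitrary: s)
  case 0
  then show ?case
    using set_run_extensions[of "{}" s us] q_distinct by simp
next
  case (Suc l)
  have ch: "set_pmf (pmf_of_set (choices None s)) = choices None s" "finite (choices None s)"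
    using set_pmf_of_choices[OF Suc.prems(1,2), of None] Suc.prems by auto
  have cu: "card (used (step None i s)) = Suc (card (used s))" if "i \<in> choices None s" for i
    using card_used_step[OF Suc.prems(2) that Suc.prems(1)] by simp
  have IH: "finite (set_pmf (run (replicate l None @ map Some us @ [Some (hd q)]) (step None i s))) \<and>
    (\<forall>s'\<in>set_pmf (run (replicate l None @ map Some us @ [Some (hd q)]) (step None i s)). final s' \<and>
       card (used s') = card (used (step None i s)) + l + length us + 1)"
    if i: "i \<in> choices None s" for i
  proof (rule Suc.IH)
    show "path_inv {} (step None i s)" "edge_inv {} (step None i s)"
      using step_invs(1,2)[OF Suc.prems(1,2) i] by simp_all
    show "card (used (step None i s)) + l + length us < F"
      using cu[OF i] Suc.prems by simp
  qed
  show ?case using ch IH cu by auto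
qed

lemma finite_run:
  assumes "path_inv {} s" "edge_inv {} s" "card (used s) + l + length us < F"
  shows "finite (set_pmf (run (replicate l None @ map Some us @ [Some (hd q)]) s))"
  using set_run[OF assms] by blast

text \<open>Edges appended towards targets avoid \<open>outers\<close> at both ends, so an added
  edge with one outer end stems from a rotation, and its other end is the source of that
  rotation.\<close>

lemma edge_outer_cases:
  assumes E: "edge_inv T s" and "{z, x} \<in> added s" "j < m" "x \<in> {a j, c j}" "z \<notin> outers"
  shows "z \<in> sources s"
proof -
  have x: "x \<in> outers" using assms by (auto simp: outers_def)
  have out: "y \<notin> outers" if "y \<in> insert (last q) (b ` used s \<union> T)" for y
    using that edge_invD(1,2)[OF E] middle_not_outers last_q_not_outers targets_not_outers by auto
  from edge_invD(7)[OF E] assms(2) show ?thesis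
  proof (elim ballE disjE exE conjE)
    fix z' j' x' assume e: "{z, x} = {z', x'}" "j' \<in> used s" "x' \<in> {a j', c j'}" "z' \<in> sources s"
    then have "x' \<in> outers" using edge_invD(2)[OF E] by (auto simp: outers_def)
    then show ?thesis using e assms(5) by (auto simp: doubleton_eq_iff)
  next
    fix j' f' assume "{z, x} = {b j', f'}" "j' \<in> used s" "f' \<in> T"
    then show ?thesis using x out[of "b j'"] out[of f'] by (auto simp: doubleton_eq_iff)
  qed auto
qed

section \<open>Overlap of a random run with a fixed run\<close>

context
  fixes t :: "'v walk" and B :: real
  assumes t: "edge_inv targets t" "card (used t) \<le> F" and B: "1 \<le> B"
begin

definition overlap :: "'v walk \<Rightarrow> nat" where
  "overlap s = card (added s \<inter> added t)"

text \<open>Indices at which a rotation from \<open>z\<close> can repeat an edge of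
  \<open>t\<close>. Both outer vertices count, as the orientation is left open.\<close>

definition hits :: "'v \<Rightarrow> nat set" where
  "hits z = {i. i < m \<and> (\<exists>x\<in>{a i, c i}. {z, x} \<in> added t)}"

definition target_hits :: "'v \<Rightarrow> nat set" where
  "target_hits f = {i. i < m \<and> {b i, f} \<in> added t}"

text \<open>A rotation at \<open>i\<close> makes \<open>b i\<close> the end of the path in either
  orientation. So these are the choices after which the next rotation can repeat an edge of
  \<open>t\<close>.\<close>

definition flagged :: "nat set" where
  "flagged = {i. i < m \<and> b i \<in> sources t}"

lemma finite_hits: "finite (hits z)" "finite (target_hits f)" "finite flagged"
  by (simp_all add: hits_def target_hits_def flagged_def)

lemma card_hits: "z \<notin> outers \<Longrightarrow> card (hits z) \<le> 1"
  using edge_invD(12)[OF t(1)] card_le_Suc0_iff_eq[OF finite_hits(1), of z]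
  unfolding hits_def by fastforce

lemma hits_empty: "z \<notin> outers \<Longrightarrow> z \<notin> sources t \<Longrightarrow> hits z = {}"
  using edge_outer_cases[OF t(1)] unfolding hits_def by blast

lemma card_target_hits: "f \<in> targets \<Longrightarrow> card (target_hits f) \<le> 1"
  using edge_invD(13)[OF t(1)] card_le_Suc0_iff_eq[OF finite_hits(2), of f]
  unfolding target_hits_def by fastforce

lemma card_flagged: "card flagged \<le> F"
proof -
  have "finite (sources t)"
  proof (rule finite_subset[OF edge_invD(6)[OF t(1)]])
    have "finite (used t)" using edge_invD(2)[OF t(1)] by (rule finite_subset) simp
    then show "finite (insert (last q) (b ` used t \<union> targets))" by (simp add: targets_def)
  qed
  then have "card flagged \<le> card (sources t)"
    using b_inj by (intro card_inj_on_le[of b]) (auto simp: flagged_def inj_on_def)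
  then show ?thesis using edge_invD(11)[OF t(1)] t(2) by linarith
qed

lemma last_not_outer:
  assumes "path_inv T s" "edge_inv T s"
  shows "last (seq s) \<notin> outers"
proof -
  have "y \<notin> outers" if "y \<in> insert (last q) (b ` used s \<union> T)" for y
    using that edge_invD(1,2)[OF assms(2)] middle_not_outers last_q_not_outers targets_not_outers by auto
  moreover have "last (seq s) \<in> insert (last q) (b ` used s \<union> T)"
    using assms(1) by (simp add: path_inv_def)
  ultimately show ?thesis by blast
qed

lemma overlap_step:
  assumes P: "path_inv T s" and E: "edge_inv T s" and i: "i \<in> choices d s"
  shows "B ^ overlap (step d i s) \<le> B ^ overlap s * B ^ (if i \<in> hits (last (seq s)) then 1 else 0)
    * B ^ (case d of None \<Rightarrow> 0 | Some f \<Rightarrow> if i \<in> target_hits f then 1 else 0)"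
    and "d = None \<Longrightarrow> last (seq (step d i s)) = b i"
proof -
  have im: "i < m" using i by (auto simp: choices_def)
  obtain x w where x: "x \<in> {a i, c i}" and w: "last w = b i" 
    and st: "step d i s = Walk (case d of None \<Rightarrow> w | Some f \<Rightarrow> w @ [f]) (insert i (used s))
       ((case d of None \<Rightarrow> {} | Some f \<Rightarrow> {{b i, f}}) \<union> insert {last (seq s), x} (added s))
       (insert {x, b i} (removed s)) (insert (last (seq s)) (sources s))"
    by (rule step_cases[OF P E i])
  show "d = None \<Longrightarrow> last (seq (step d i s)) = b i" using w unfolding st by simp
  define z where "z = last (seq s)"
  define e1 where "e1 = {{z, x}} \<inter> added t"
  define e2 where "e2 = (case d of None \<Rightarrow> {} | Some f \<Rightarrow> {{b i, f}}) \<inter> added t"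
  have "added (step d i s) \<inter> added t = added s \<inter> added t \<union> e1 \<union> e2"
    unfolding st e1_def e2_def z_def by auto
  then have "overlap (step d i s) = card (added s \<inter> added t \<union> e1 \<union> e2)"
    by (simp only: overlap_def)
  also have "\<dots> \<le> overlap s + card e1 + card e2"
    unfolding overlap_def using card_Un_le[of "added s \<inter> added t \<union> e1" e2]
      card_Un_le[of "added s \<inter> added t" e1] by linarith
  finally have le: "overlap (step d i s) \<le> overlap s + card e1 + card e2" .
  have single: "card ({e} \<inter> A) \<le> 1" for e :: "'v set" and A
    using card_mono[of "{e}" "{e} \<inter> A"] by simp
  have "card e1 \<le> (if i \<in> hits z then 1 else 0)"
    using x im single[of "{z, x}" "added t"] by (cases "{z, x} \<in> added t") (auto simp: e1_def hits_def)
  moreover have "card e2 \<le> (case d of None \<Rightarrow> 0 | Some f \<Rightarrow> if i \<in> target_hits f then 1 else 0)"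
    using im single[of "{b i, _}" "added t"] by (auto simp: e2_def target_hits_def split: option.splits)
  ultimately have "overlap (step d i s) \<le> overlap s + (if i \<in> hits z then 1 else 0) +
     (case d of None \<Rightarrow> 0 | Some f \<Rightarrow> if i \<in> target_hits f then 1 else 0)"
    using le by linarith
  then have "B ^ overlap (step d i s) \<le> B ^ (overlap s + (if i \<in> hits z then 1 else 0) +
     (case d of None \<Rightarrow> 0 | Some f \<Rightarrow> if i \<in> target_hits f then 1 else 0))"
    using B by (rule power_increasing)
  then show "B ^ overlap (step d i s) \<le> B ^ overlap s * B ^ (if i \<in> hits (last (seq s)) then 1 else 0)
    * B ^ (case d of None \<Rightarrow> 0 | Some f \<Rightarrow> if i \<in> target_hits f then 1 else 0)"
    by (simp add: power_add z_def)
qed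

text \<open>At most one choice repeats an edge of \<open>t\<close> by its rotation and at most one
  by its appended edge, each with a factor of at most \<open>B\<^sup>2\<close> among at least
  \<open>K\<close> choices. The end vertex is not tracked here: this crude bound suffices, as such
  steps are few.\<close>

lemma expectation_extension_step:
  assumes P: "path_inv T s" and E: "edge_inv T s" and f: "f \<in> targets - T"
    and "card (used s) \<le> F" and "0 \<le> r"
    and fin: "\<And>i. i \<in> choices (Some f) s \<Longrightarrow> finite (set_pmf (run ds (step (Some f) i s)))"
    and IH: "\<And>i. i \<in> choices (Some f) s \<Longrightarrow>
      measure_pmf.expectation (run ds (step (Some f) i s)) (\<lambda>s'. B ^ overlap s')
        \<le> B ^ overlap (step (Some f) i s) * r"
  shows "measure_pmf.expectation (run (Some f # ds) s) (\<lambda>s'. B ^ overlap s')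
    \<le> B ^ overlap s * ((1 + 2 * B\<^sup>2 / K) * r)"
proof -
  let ?C = "choices (Some f) s" and ?z = "last (seq s)"
  have d: "\<And>g. Some f = Some g \<Longrightarrow> g \<in> V" using f targets_in_V by auto
  note C = set_pmf_of_choices[OF P E assms(4) d]
  have "measure_pmf.expectation (run (Some f # ds) s) (\<lambda>s'. B ^ overlap s') =
      (\<Sum>i\<in>?C. measure_pmf.expectation (run ds (step (Some f) i s)) (\<lambda>s'. B ^ overlap s') /\<^sub>R real (card ?C))"
    unfolding run.simps using C fin by (intro pmf_expectation_bind_pmf_of_set) auto
  also have "\<dots> \<le> (B ^ overlap s * r) * (1 + B\<^sup>2 * real 1 / K + B\<^sup>2 * real 1 / K)"
  proof (rule average_le[OF C(2)])
    show "real K \<le> real (card ?C)" using card_choices[OF P E assms(4), of "Some f"] d by simp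
    show "card (hits ?z) \<le> 1" by (rule card_hits[OF last_not_outer[OF P E]])
    show "card (target_hits f) \<le> 1" using f by (intro card_target_hits) simp
    fix i assume i: "i \<in> ?C"
    \<comment> \<open>If just one of the two edges is repeated, the factor is \<open>B\<close>,
      which is absorbed into \<open>1 + B\<^sup>2\<close>.\<close>
    have "B * 1 \<le> B * B" using B by (intro mult_left_mono) auto
    then have BB: "B \<le> 1 + B * B" by simp
    have "B ^ (if i \<in> hits ?z then 1 else 0) * B ^ (if i \<in> target_hits f then 1 else 0)
        \<le> 1 + B\<^sup>2 * indicator (hits ?z) i + B\<^sup>2 * indicator (target_hits f) i"
      using BB B by (auto simp: indicator_def power2_eq_square)
    moreover have "B ^ overlap (step (Some f) i s) \<le> B ^ overlap s *
        (B ^ (if i \<in> hits ?z then 1 else 0) * B ^ (if i \<in> target_hits f then 1 else 0))"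
      using overlap_step(1)[OF P E i] by (simp add: mult.assoc)
    ultimately have "B ^ overlap (step (Some f) i s) \<le> B ^ overlap s *
        (1 + B\<^sup>2 * indicator (hits ?z) i + B\<^sup>2 * indicator (target_hits f) i)"
      using B by (meson mult_left_mono order_trans zero_le_power zero_le_one)
    then have "B ^ overlap (step (Some f) i s) * r \<le> B ^ overlap s *
        (1 + B\<^sup>2 * indicator (hits ?z) i + B\<^sup>2 * indicator (target_hits f) i) * r"
      using \<open>0 \<le> r\<close> by (rule mult_right_mono)
    with IH[OF i] show "measure_pmf.expectation (run ds (step (Some f) i s)) (\<lambda>s'. B ^ overlap s')
      \<le> B ^ overlap s * r * (1 + B\<^sup>2 * indicator (hits ?z) i + B\<^sup>2 * indicator (target_hits f) i)"
      by (simp add: mult_ac)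
  qed (use K_pos B \<open>0 \<le> r\<close> in \<open>auto simp: finite_hits\<close>)
  finally show ?thesis by (simp add: mult_ac add.commute)
qed

lemma expectation_extensions:
  assumes "path_inv T s" "edge_inv T s" "distinct gs" "set gs = set us - T" "hd q \<notin> T"
    "card (used s) + length gs < F"
  shows "measure_pmf.expectation (run (map Some gs @ [Some (hd q)]) s) (\<lambda>s'. B ^ overlap s')
    \<le> B ^ overlap s * (1 + 2 * B\<^sup>2 / K) ^ (length gs + 1)"
  using assms
proof (induction gs arbitrary: T s)
  case Nil
  have "measure_pmf.expectation (run (Some (hd q) # []) s) (\<lambda>s'. B ^ overlap s')
    \<le> B ^ overlap s * ((1 + 2 * B\<^sup>2 / K) * 1)"
    using Nil by (intro expectation_extension_step[of T]) (auto simp: targets_def)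
  then show ?case by simp
next
  case (Cons g gs)
  have g: "g \<in> targets - T" "g \<noteq> hd q" "g \<in> V"
    using Cons.prems q_distinct hd_q_in q_us by (auto simp: targets_def)
  then have d: "\<And>f. Some g = Some f \<Longrightarrow> f \<in> targets - T" "\<And>f. Some g = Some f \<Longrightarrow> f \<noteq> hd q" by auto
  have next_inv: "path_inv (insert g T) (step (Some g) i s)" "edge_inv (insert g T) (step (Some g) i s)"
    "card (used (step (Some g) i s)) + length gs < F" if i: "i \<in> choices (Some g) s" for i
    using step_invs(1)[OF Cons.prems(1,2) i d(1)] step_invs(2)[OF Cons.prems(1,2) i d]
      card_used_step[OF Cons.prems(2) i Cons.prems(1) d(1)] Cons.prems by simp_all
  have gs: "distinct gs" "set gs = set us - insert g T" "hd q \<notin> insert g T"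
    using Cons.prems g by auto
  have "measure_pmf.expectation (run (Some g # map Some gs @ [Some (hd q)]) s) (\<lambda>s'. B ^ overlap s')
    \<le> B ^ overlap s * ((1 + 2 * B\<^sup>2 / K) * (1 + 2 * B\<^sup>2 / K) ^ (length gs + 1))"
  proof (rule expectation_extension_step[OF Cons.prems(1,2) g(1)])
    fix i assume i: "i \<in> choices (Some g) s"
    show "finite (set_pmf (run (map Some gs @ [Some (hd q)]) (step (Some g) i s)))"
      using set_run_extensions[OF next_inv(1,2)[OF i] gs next_inv(3)[OF i]] by blast
    show "measure_pmf.expectation (run (map Some gs @ [Some (hd q)]) (step (Some g) i s)) (\<lambda>s'. B ^ overlap s')
      \<le> B ^ overlap (step (Some g) i s) * (1 + 2 * B\<^sup>2 / K) ^ (length gs + 1)"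
      by (rule Cons.IH[OF next_inv(1,2)[OF i] gs next_inv(3)[OF i]])
  qed (use Cons.prems B in auto)
  then show ?case by simp
qed

text \<open>
  A rotation can only add an edge of the run \<open>t\<close> if the current end vertex is a source of \<open>t\<close>.
  The factor \<open>1 + \<theta>\<close> charges for this situation when it is entered, which happens with
  probability at most \<open>F / K\<close>.
\<close>

lemma expectation_overlap:
  fixes \<theta> :: real
  assumes "path_inv {} s" "edge_inv {} s" "card (used s) + l + length us < F"
    and \<theta>: "0 \<le> \<theta>" "B * (1 + \<theta>) / K \<le> \<theta>"
  shows "measure_pmf.expectation (run (replicate l None @ map Some us @ [Some (hd q)]) s) (\<lambda>s'. B ^ overlap s')
    \<le> B ^ overlap s * ((1 + 2 * B\<^sup>2 / K) ^ (length us + 1) * (1 + \<theta> * F / K) ^ l *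
        (1 + \<theta> * (if last (seq s) \<in> sources t then 1 else 0)))"
  using assms(1-3)
proof (induction l arbitrary: s)
  case 0
  have "measure_pmf.expectation (run (map Some us @ [Some (hd q)]) s) (\<lambda>s'. B ^ overlap s')
    \<le> B ^ overlap s * (1 + 2 * B\<^sup>2 / K) ^ (length us + 1)"
    using 0 q_distinct by (intro expectation_extensions[of "{}"]) auto
  also have "\<dots> \<le> B ^ overlap s * (1 + 2 * B\<^sup>2 / K) ^ (length us + 1) *
      (1 + \<theta> * (if last (seq s) \<in> sources t then 1 else 0))"
  proof -
    have "0 \<le> B ^ overlap s * (1 + 2 * B\<^sup>2 / K) ^ (length us + 1)"
      using B by (intro mult_nonneg_nonneg zero_le_power) auto
    then have "B ^ overlap s * (1 + 2 * B\<^sup>2 / K) ^ (length us + 1) * 1 \<le> B ^ overlap s * (1 + 2 * B\<^sup>2 / K) ^ (length us + 1) *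
      (1 + \<theta> * (if last (seq s) \<in> sources t then 1 else 0))"
      using \<theta>(1) by (intro mult_left_mono) auto
    then show ?thesis by simp
  qed
  finally show ?case by (simp add: mult.assoc)
next
  case (Suc l)
  let ?C = "choices None s" and ?z = "last (seq s)"
  let ?ds = "replicate l None @ map Some us @ [Some (hd q)]"
  let ?R = "(1 + 2 * B\<^sup>2 / K) ^ (length us + 1) * (1 + \<theta> * F / K) ^ l"
  define fl :: real where "fl = (if ?z \<in> sources t then 1 else 0)"
  have R: "0 \<le> ?R" using B \<theta> by auto
  have C: "set_pmf (pmf_of_set ?C) = ?C" "finite ?C" "?C \<noteq> {}"
    using set_pmf_of_choices[OF Suc.prems(1,2), of None] Suc.prems by auto
  have next_inv: "path_inv {} (step None i s)" "edge_inv {} (step None i s)"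
    "card (used (step None i s)) + l + length us < F" if i: "i \<in> ?C" for i
    using step_invs(1,2)[OF Suc.prems(1,2) i] card_used_step[OF Suc.prems(2) i Suc.prems(1)] Suc.prems
    by simp_all
  have hits: "hits ?z \<noteq> {} \<Longrightarrow> fl = 1"
    using hits_empty[OF last_not_outer[OF Suc.prems(1,2)]] by (auto simp: fl_def)
  have fl01: "fl = 0 \<or> fl = 1" by (auto simp: fl_def)
  have "measure_pmf.expectation (run (None # ?ds) s) (\<lambda>s'. B ^ overlap s') =
      (\<Sum>i\<in>?C. measure_pmf.expectation (run ?ds (step None i s)) (\<lambda>s'. B ^ overlap s') /\<^sub>R real (card ?C))"
    unfolding run.simps using C finite_run[OF next_inv] by (intro pmf_expectation_bind_pmf_of_set) auto
  also have "\<dots> \<le> (B ^ overlap s * ?R) * (1 + \<theta> * real F / K + fl * (B * (1 + \<theta>)) * real 1 / K)"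
  proof (rule average_le[OF C(2)])
    show "real K \<le> real (card ?C)" using card_choices[OF Suc.prems(1,2), of None] Suc.prems by simp
    show "card (hits ?z) \<le> 1" by (rule card_hits[OF last_not_outer[OF Suc.prems(1,2)]])
    show "card flagged \<le> F" by (rule card_flagged)
    fix i assume i: "i \<in> ?C"
    then have im: "i < m" by (simp add: choices_def)
    have flag: "(if last (seq (step None i s)) \<in> sources t then 1 else 0) = (indicator flagged i :: real)"
      using overlap_step(2)[OF Suc.prems(1,2) i refl] im by (simp add: flagged_def indicator_def)
    have ov: "B ^ overlap (step None i s) \<le> B ^ overlap s * B ^ (if i \<in> hits ?z then 1 else 0)"
      using overlap_step(1)[OF Suc.prems(1,2) i] by simp
    have fac: "B ^ (if i \<in> hits ?z then 1 else 0) * (1 + \<theta> * indicator flagged i)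
        \<le> 1 + \<theta> * indicator flagged i + fl * (B * (1 + \<theta>)) * indicator (hits ?z) i"
    proof (cases "i \<in> hits ?z")
      case True
      then have "fl = 1" using hits by blast
      moreover have "0 \<le> B * \<theta>" using B \<theta>(1) by simp
      ultimately show ?thesis using True B \<theta>(1) by (simp add: indicator_def algebra_simps)
    qed (simp add: indicator_def)
    have "measure_pmf.expectation (run ?ds (step None i s)) (\<lambda>s'. B ^ overlap s')
      \<le> B ^ overlap (step None i s) * (?R * (1 + \<theta> * indicator flagged i))"
      using Suc.IH[OF next_inv[OF i]] unfolding flag .
    also have "\<dots> \<le> B ^ overlap s * B ^ (if i \<in> hits ?z then 1 else 0) * (?R * (1 + \<theta> * indicator flagged i))"
      using R \<theta>(1) by (intro mult_right_mono[OF ov] mult_nonneg_nonneg) auto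
    also have "\<dots> = B ^ overlap s * ?R * (B ^ (if i \<in> hits ?z then 1 else 0) * (1 + \<theta> * indicator flagged i))"
      by (simp only: mult_ac)
    also have "\<dots> \<le> B ^ overlap s * ?R * (1 + \<theta> * indicator flagged i + fl * (B * (1 + \<theta>)) * indicator (hits ?z) i)"
      by (rule mult_left_mono[OF fac mult_nonneg_nonneg[OF _ R]]) (use B in simp)
    finally show "measure_pmf.expectation (run ?ds (step None i s)) (\<lambda>s'. B ^ overlap s')
      \<le> B ^ overlap s * ?R * (1 + \<theta> * indicator flagged i + fl * (B * (1 + \<theta>)) * indicator (hits ?z) i)" .
  qed (use K_pos B \<theta> R fl01 in \<open>auto simp: finite_hits\<close>)
  also have "\<dots> \<le> (B ^ overlap s * ?R) * ((1 + \<theta> * real F / K) * (1 + \<theta> * fl))"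
  proof (rule mult_left_mono)
    \<comment> \<open>The condition on \<open>\<theta>\<close> says that the charge on entering a
      source of \<open>t\<close> pays for the one choice that repeats an edge, even if that choice
      leads to a source again.\<close>
    have "fl * (B * (1 + \<theta>) / K) \<le> fl * \<theta>"
      using \<theta>(2) fl01 by (intro mult_left_mono) auto
    moreover have "0 \<le> \<theta> * real F / K * (\<theta> * fl)" using \<theta> fl01 by auto
    ultimately show "1 + \<theta> * real F / K + fl * (B * (1 + \<theta>)) * real 1 / K \<le> (1 + \<theta> * real F / K) * (1 + \<theta> * fl)"
      by (simp add: algebra_simps add_divide_distrib)
  qed (rule mult_nonneg_nonneg[OF _ R], use B in simp)
  finally show ?case
    by (simp add: fl_def mult_ac)
qed

end

end

subsection \<open>Second moment of the rotation walk\<close>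

context rotation_walk begin

lemma removed_subset:
  assumes "edge_inv T s"
  shows "removed s \<subseteq> path_edges q"
proof
  fix e assume "e \<in> removed s"
  then obtain x i where "e = {x, b i}" "i \<in> used s" "x \<in> {a i, c i}"
    using edge_invD(8)[OF assms] by blast
  then show "e \<in> path_edges q"
    using edge_invD(2)[OF assms] triple_edges[of i] by (auto simp: insert_commute)
qed

text \<open>The kept path edges have distinct colours outside the pool, so the closed walk is
  rainbow once the added edges biject onto the pool. Disjointness of \<open>D\<close> from the path
  makes their colours independent of \<open>c0\<close>.\<close>

theorem prob_rainbow_hamilton_cycle:
  fixes c0 :: "'v set \<Rightarrow> 'c" and B \<theta> \<rho> :: real
  assumes "finite V" "finite Col" "card Col = card V"
    and c0: "inj_on c0 (path_edges q)" "c0 ` path_edges q \<subseteq> Col" and disj: "path_edges q \<inter> D = {}"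
    and F: "F = l + length us + 1" and N: "N = l + 2 * (length us + 1)"
    and B: "1 \<le> B" "exp 1 * real (card V) / real N \<le> B"
    and \<theta>: "0 \<le> \<theta>" "B * (1 + \<theta>) / K \<le> \<theta>"
    and \<rho>: "(1 + 2 * B\<^sup>2 / K) ^ (length us + 1) * (1 + \<theta> * F / K) ^ l * (1 + \<theta>) \<le> 1 + \<rho>"
  shows "measure_pmf.prob (uniform_colouring Col D)
    {c. \<exists>w. distinct w \<and> set w = V \<and> cycle_edges w \<subseteq> path_edges q \<union> D \<and>
      inj_on (\<lambda>e. if e \<in> D then c e else c0 e) (cycle_edges w)} \<ge> 1 - \<rho>"
    (is "measure_pmf.prob ?M ?E \<ge> _")
proof -
  define \<mu> where "\<mu> = run (replicate l None @ map Some us @ [Some (hd q)]) start"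
  define Q where "Q s = (Col - c0 ` path_edges q) \<union> c0 ` removed s" for s
  define G where "G s = {c. bij_betw c (added s) (Q s)}" for s
  let ?n = "card V"
  have V: "V \<noteq> {}" using hd_q_in q_us by auto
  then have n: "?n > 0" using \<open>finite V\<close> by (simp add: card_gt_0_iff)
  have finD: "finite D" using D_nsets by (rule finite_subset) (use \<open>finite V\<close> in \<open>simp add: finite_imp_finite_nsets\<close>)
  have used_start: "card (used start) + l + length us < F" by (simp add: start_def F)
  have fin: "finite (set_pmf \<mu>)" and supp: "\<And>s. s \<in> set_pmf \<mu> \<Longrightarrow> final s \<and> card (used s) = F"
    using set_run[OF start_invs used_start] unfolding \<mu>_def F by (auto simp: start_def)
  have E: "edge_inv targets s" if "s \<in> set_pmf \<mu>" for s
    using supp[OF that] by (simp add: final_def)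
  have card_targets: "card targets = length us + 1"
    using q_distinct hd_q_in by (simp add: targets_def distinct_card disjoint_iff)
  have cA: "card (added s) = N" if "s \<in> set_pmf \<mu>" for s
    using edge_invD(10)[OF E[OF that]] supp[OF that] card_targets by (simp add: F N)
  have AD: "added s \<subseteq> D" if "s \<in> set_pmf \<mu>" for s
    using edge_invD(4)[OF E[OF that]] .
  have QC: "Q s \<subseteq> Col" if "s \<in> set_pmf \<mu>" for s
    using removed_subset[OF E[OF that]] c0 by (auto simp: Q_def)
  have cQ: "card (Q s) = N" if s: "s \<in> set_pmf \<mu>" for s
  proof -
    have rem: "removed s \<subseteq> path_edges q" by (rule removed_subset[OF E[OF s]])
    have "card (c0 ` removed s) = F"
      using card_image[OF inj_on_subset[OF c0(1) rem]] edge_invD(9)[OF E[OF s]] supp[OF s] by simp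
    moreover have "card (Col - c0 ` path_edges q) = ?n - (length q - 1)"
      using c0 \<open>finite Col\<close> \<open>card Col = card V\<close> card_image[OF c0(1)] card_path_edges[OF q_distinct(1)]
      by (subst card_Diff_subset) auto
    moreover have "?n = length q + length us"
      using q_us by (metis distinct_card length_append set_append)
    moreover have "card (Q s) = card (Col - c0 ` path_edges q) + card (c0 ` removed s)"
      unfolding Q_def using rem \<open>finite Col\<close> finite_subset[OF rem] by (intro card_Un_disjoint) auto
    moreover have "length q > 0" using q_nonempty by simp
    ultimately show ?thesis by (simp add: F N)
  qed
  have Col: "Col \<noteq> {}" using n assms(3) by auto
  have N0: "N > 0" by (simp add: N)
  have "measure_pmf.prob ?M (\<Union>s\<in>set_pmf \<mu>. G s) \<ge> 1 - \<rho>"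
  proof (rule second_moment_pmf[OF fin, where p = "fact N / real ?n ^ N" and
        r = "\<lambda>t s. B ^ overlap t s"])
    show "0 < fact N / real ?n ^ N" using n by simp
  next
    fix s assume s: "s \<in> set_pmf \<mu>"
    show "measure_pmf.prob ?M (G s) = fact N / real ?n ^ N"
      using prob_colours_bij[OF finD AD[OF s] \<open>finite Col\<close> Col QC[OF s] cA[OF s] cQ[OF s]] assms(3)
      by (simp add: G_def)
  next
    fix v w assume v: "v \<in> set_pmf \<mu>" and w: "w \<in> set_pmf \<mu>"
    define k where "k = card (added v \<inter> added w)"
    have k: "k \<le> N" using cA[OF v] edge_invD(3)[OF E[OF v]] by (auto simp: k_def intro: card_mono)
    have "measure_pmf.prob ?M (G v \<inter> G w) =
      measure_pmf.prob ?M {c. bij_betw c (added v) (Q v) \<and> bij_betw c (added w) (Q w)}"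
      by (rule arg_cong[where f = "measure_pmf.prob ?M"]) (auto simp: G_def)
    also have "\<dots> \<le> fact N * fact (N - k) / real ?n ^ (2 * N - k)"
      using prob_colours_bij_bij_le[OF finD AD[OF v] AD[OF w] \<open>finite Col\<close> Col QC[OF v] QC[OF w]
          cA[OF v] cQ[OF v] cA[OF w] cQ[OF w]] assms(3)
      by (simp add: k_def)
    also have "\<dots> \<le> (fact N / real ?n ^ N)\<^sup>2 * B ^ k"
      by (rule fact_ratio_le[OF k N0 n B(2)])
    also have "k = overlap v w"
      using E[OF v] supp[OF v] B by (simp add: overlap_def k_def Int_commute)
    finally show "measure_pmf.prob ?M (G v \<inter> G w) \<le> (fact N / real ?n ^ N)\<^sup>2 * B ^ overlap v w" .
  next
    fix t assume t: "t \<in> set_pmf \<mu>"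
    have tt: "edge_inv targets t" "card (used t) \<le> F" using E[OF t] supp[OF t] by simp_all
    have "measure_pmf.expectation \<mu> (\<lambda>s. B ^ overlap t s) \<le> B ^ overlap t start *
      ((1 + 2 * B\<^sup>2 / K) ^ (length us + 1) * (1 + \<theta> * F / K) ^ l *
        (1 + \<theta> * (if last (seq start) \<in> sources t then 1 else 0)))"
      unfolding \<mu>_def by (rule expectation_overlap[OF tt B(1) start_invs used_start \<theta>])
    also have "\<dots> = (1 + 2 * B\<^sup>2 / K) ^ (length us + 1) * (1 + \<theta> * F / K) ^ l *
        (1 + \<theta> * (if last (seq start) \<in> sources t then 1 else 0))"
      using overlap_def[OF tt B(1), of start] by (simp add: start_def)
    also have "\<dots> \<le> (1 + 2 * B\<^sup>2 / K) ^ (length us + 1) * (1 + \<theta> * F / K) ^ l * (1 + \<theta>)"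
      using B \<theta> by (intro mult_left_mono mult_nonneg_nonneg zero_le_power) auto
    finally show "measure_pmf.expectation \<mu> (\<lambda>s. B ^ overlap t s) \<le> 1 + \<rho>"
      using \<rho> by linarith
  qed
  also have "measure_pmf.prob ?M (\<Union>s\<in>set_pmf \<mu>. G s) \<le> measure_pmf.prob ?M ?E"
  proof (rule measure_pmf.finite_measure_mono)
    show "(\<Union>s\<in>set_pmf \<mu>. G s) \<subseteq> ?E"
    proof
      fix c assume "c \<in> (\<Union>s\<in>set_pmf \<mu>. G s)"
      then obtain s where s: "s \<in> set_pmf \<mu>" and bij: "bij_betw c (added s) (Q s)"
        by (auto simp: G_def)
      obtain w where w: "seq s = w @ [hd q]" "distinct w" "set w = V" "hd w = hd q"
        using supp[OF s] by (auto simp: final_def)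
      have "w \<noteq> []" using w(3) V by auto
      then have ce: "cycle_edges w = (path_edges q - removed s) \<union> added s"
        using cycle_edges_eq_path_edges[of w] w edge_invD(5)[OF E[OF s]] by simp
      have rem: "removed s \<subseteq> path_edges q" by (rule removed_subset[OF E[OF s]])
      let ?c = "\<lambda>e. if e \<in> D then c e else c0 e"
      have 1: "?c e = c0 e" if "e \<in> path_edges q - removed s" for e using that disj by auto
      have 2: "?c e = c e" if "e \<in> added s" for e using that AD[OF s] by auto
      have "inj_on ?c (path_edges q - removed s)"
        using c0(1) 1 by (simp add: inj_on_def)
      moreover have "inj_on ?c (added s)"
        using bij 2 by (simp add: inj_on_def bij_betw_def)
      moreover have "?c ` (path_edges q - removed s) \<inter> ?c ` added s = {}"
      proof -
        have "?c ` added s = Q s" using bij 2 by (auto simp: bij_betw_def)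
        moreover have "?c ` (path_edges q - removed s) = c0 ` (path_edges q - removed s)"
          using 1 by (intro image_cong) auto
        moreover have "c0 ` (path_edges q - removed s) \<inter> Q s = {}"
          using c0(1) rem by (auto simp: Q_def inj_on_def)
        ultimately show ?thesis by simp
      qed
      ultimately have "inj_on ?c (cycle_edges w)"
        unfolding ce by (auto simp: inj_on_Un)
      moreover have "cycle_edges w \<subseteq> path_edges q \<union> D"
        unfolding ce using AD[OF s] by auto
      ultimately show "c \<in> ?E" using w by blast
    qed
  qed simp
  finally show ?thesis .
qed

end

subsection \<open>Rainbow depth-first search\<close>

text \<open>The colour set \<open>Z\<close> is quantified because the colours still free in the
  search depend on the colouring itself.\<close>

definition robustly_joined :: "'v set \<Rightarrow> 'c set \<Rightarrow> nat \<Rightarrow> 'v set set \<Rightarrow> ('v set \<Rightarrow> 'c) \<Rightarrow> bool" where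
  "robustly_joined V Col k R c \<longleftrightarrow> (\<forall>X Y Z. X \<subseteq> V \<longrightarrow> Y \<subseteq> V \<longrightarrow> X \<inter> Y = {} \<longrightarrow> Z \<subseteq> Col \<longrightarrow>
     k \<le> card X \<longrightarrow> k \<le> card Y \<longrightarrow> k \<le> card Z \<longrightarrow> (\<exists>x\<in>X. \<exists>y\<in>Y. {x, y} \<in> R \<and> c {x, y} \<in> Z))"

text \<open>\<open>S\<close> is the stack with its top first, \<open>T\<close> the abandoned
  vertices, \<open>U\<close> the unvisited ones. \<open>Z\<close> collects all colours ever used,
  including those on edges that have left the stack: if colours were returned on backtracking, the
  last clause would fail. Each colour enters \<open>Z\<close> with a pushed vertex, which gives the
  bound on \<open>card Z\<close>.\<close>

definition dfs_inv :: "'v set \<Rightarrow> 'c set \<Rightarrow> 'v set set \<Rightarrow> ('v set \<Rightarrow> 'c) \<Rightarrow> 'v list \<Rightarrow> 'v set \<Rightarrow> 'v set \<Rightarrow> 'c set \<Rightarrow> bool" where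
  "dfs_inv V Col R c S T U Z \<longleftrightarrow> distinct S \<and> set S \<union> T \<union> U = V \<and> set S \<inter> T = {} \<and> set S \<inter> U = {} \<and> T \<inter> U = {} \<and>
     path_edges S \<subseteq> R \<and> inj_on c (path_edges S) \<and> c ` path_edges S \<subseteq> Z \<and> Z \<subseteq> Col \<and>
     card Z \<le> length S + card T \<and> (\<forall>x\<in>T. \<forall>y\<in>U. {x, y} \<in> R \<longrightarrow> c {x, y} \<notin> Col - Z)"

text \<open>Whether a vertex is pushed or popped, the difference of \<open>card U\<close> and
  \<open>card T\<close> drops by exactly one, so at some moment the two are equal.\<close>

lemma dfs_step:
  assumes "finite V" "finite Col" "dfs_inv V Col R c S T U Z" "U \<noteq> {}"
  obtains S' T' U' Z' where "dfs_inv V Col R c S' T' U' Z'"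
    "int (card U') - int (card T') = int (card U) - int (card T) - 1"
proof -
  note inv = assms(3)[unfolded dfs_inv_def]
  have fin: "finite T" "finite U" "finite Z"
    using inv assms(1,2) by (auto intro: finite_subset)
  show ?thesis
  proof (cases S)
    case Nil
    obtain y where y: "y \<in> U" using assms(4) by blast
    have "dfs_inv V Col R c [y] T (U - {y}) Z"
      using inv y Nil unfolding dfs_inv_def by auto
    moreover have "int (card (U - {y})) - int (card T) = int (card U) - int (card T) - 1"
      using y fin card_Diff_singleton[of y U] card_gt_0_iff[of U] by auto
    ultimately show ?thesis by (rule that)
  next
    case (Cons s S0)
    show ?thesis
    proof (cases "\<exists>y\<in>U. {s, y} \<in> R \<and> c {s, y} \<in> Col - Z")
      case True
      then obtain y where y: "y \<in> U" "{y, s} \<in> R" "c {y, s} \<in> Col - Z"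
        by (auto simp: insert_commute)
      have "inj_on c (insert {y, s} (path_edges S))"
        using inv y by auto
      then have "dfs_inv V Col R c (y # S) T (U - {y}) (insert (c {y, s}) Z)"
        using inv y Cons fin unfolding dfs_inv_def by (auto simp: card_insert_if)
      moreover have "int (card (U - {y})) - int (card T) = int (card U) - int (card T) - 1"
        using y fin card_Diff_singleton[of y U] card_gt_0_iff[of U] by auto
      ultimately show ?thesis by (rule that)
    next
      case False
      have "path_edges S0 \<subseteq> path_edges S" unfolding Cons by (cases S0) auto
      then have S0: "path_edges S0 \<subseteq> R" "inj_on c (path_edges S0)" "c ` path_edges S0 \<subseteq> Z"
        using inv by (blast intro: inj_on_subset)+
      have "s \<notin> T" "s \<notin> U" using inv Cons by auto
      then have "dfs_inv V Col R c S0 (insert s T) U Z"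
        using inv S0 False Cons fin unfolding dfs_inv_def by (auto simp: insert_commute)
      moreover have "int (card U) - int (card (insert s T)) = int (card U) - int (card T) - 1"
        using fin \<open>s \<notin> T\<close> by simp
      ultimately show ?thesis by (rule that)
    qed
  qed
qed

text \<open>Stop when \<open>card U = card T\<close>, so that the path misses
  \<open>2 * card T\<close> vertices. By the bound on \<open>Z\<close>, at least
  \<open>card V - length S - card T = card T\<close> colours are free. Hence
  \<open>k \<le> card T\<close> would make \<open>T\<close>, \<open>U\<close> and
  \<open>Col - Z\<close> contradict \<open>robustly_joined\<close>.\<close>

lemma rainbow_path_exists:
  assumes "finite V" "finite Col" "card V \<le> card Col" and J: "robustly_joined V Col k R c"
  shows "\<exists>p. distinct p \<and> set p \<subseteq> V \<and> path_edges p \<subseteq> R \<and> inj_on c (path_edges p) \<and>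
    c ` path_edges p \<subseteq> Col \<and> card V \<le> length p + 2 * k"
proof -
  have "j \<le> card V \<Longrightarrow> \<exists>S T U Z. dfs_inv V Col R c S T U Z \<and> int (card U) - int (card T) = int (card V) - int j" for j
  proof (induction j)
    case 0
    have "dfs_inv V Col R c [] {} V {}" by (auto simp: dfs_inv_def)
    then show ?case by (intro exI[of _ "[]"] exI[of _ "{}"] exI[of _ V] exI[of _ "{}"]) simp
  next
    case (Suc j)
    then obtain S T U Z where *: "dfs_inv V Col R c S T U Z" "int (card U) - int (card T) = int (card V) - int j"
      by auto
    then have "U \<noteq> {}" using Suc.prems by auto
    from dfs_step[OF assms(1,2) *(1) this] *(2) show ?case
      by (metis (no_types, lifting) diff_diff_eq of_nat_Suc add.commute)
  qed
  from this[of "card V"] obtain S T U Z where inv: "dfs_inv V Col R c S T U Z" and "card U = card T"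
    by auto
  note inv = inv[unfolded dfs_inv_def]
  have fin: "finite T" "finite U" "finite Z"
    using inv assms(1,2) by (auto intro: finite_subset)
  have "card (set S \<union> T \<union> U) = card (set S) + card T + card U"
    using inv fin by (subst card_Un_disjoint, auto)+
  then have V: "card V = length S + 2 * card T"
    using inv \<open>card U = card T\<close> by (simp add: distinct_card)
  have "card T < k"
  proof (rule ccontr)
    assume "\<not> card T < k"
    moreover have "card (Col - Z) = card Col - card Z" using inv fin by (intro card_Diff_subset) auto
    then have "card T \<le> card (Col - Z)"
      using V inv assms(3) by linarith
    ultimately obtain x y where "x \<in> T" "y \<in> U" "{x, y} \<in> R" "c {x, y} \<in> Col - Z"
      using J[unfolded robustly_joined_def, rule_format, of T U "Col - Z"] inv \<open>card U = card T\<close> by auto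
    then show False using inv by auto
  qed
  then show ?thesis using inv V by (intro exI[of _ S]) auto
qed

subsection \<open>Random enumerations\<close>

lemma sum_permutations_of_set:
  assumes "finite A" "A \<noteq> {}"
  shows "(\<Sum>ys\<in>permutations_of_set A. f ys) = (\<Sum>x\<in>A. \<Sum>ys\<in>permutations_of_set (A - {x}). f (x # ys))"
proof -
  have "(\<Sum>ys\<in>permutations_of_set A. f ys) =
    (\<Sum>x\<in>A. \<Sum>ys\<in>(#) x ` permutations_of_set (A - {x}). f ys)"
    unfolding permutations_of_set_nonempty[OF assms(2)] using assms(1)
    by (subst sum.UNION_disjoint) auto
  also have "\<dots> = (\<Sum>x\<in>A. \<Sum>ys\<in>permutations_of_set (A - {x}). f (x # ys))"
    by (rule sum.cong[OF refl]) (simp add: sum.reindex)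
  finally show ?thesis .
qed

text \<open>\<open>X\<close> and \<open>Y\<close> stand for the neighbourhoods of \<open>z\<close>
  and \<open>f\<close> in the dense graph, and \<open>ys\<close> for a stretch of the path cut into
  blocks of three.\<close>

definition triple_count :: "'v set \<Rightarrow> 'v set \<Rightarrow> nat \<Rightarrow> 'v list \<Rightarrow> nat" where
  "triple_count X Y m ys = (\<Sum>i<m. of_bool (ys ! (3 * i) \<in> X \<and> ys ! (3 * i + 1) \<in> Y \<and> ys ! (3 * i + 2) \<in> X))"

lemma triple_count_Cons:
  "triple_count X Y (Suc m) (x # y # z # ys) = of_bool (x \<in> X \<and> y \<in> Y \<and> z \<in> X) + triple_count X Y m ys"
  unfolding triple_count_def by (subst sum.lessThan_Suc_shift) (simp add: algebra_simps)

text \<open>Of at most \<open>n ^ 3\<close> ordered draws without replacement at least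
  \<open>g ^ 3\<close> are counted, and a counted draw has weight 1/2. The summand 2 in the
  hypotheses covers the entries already drawn in the same block.\<close>

lemma triple_sum_le:
  fixes g n :: nat
  assumes "finite A" "card A \<le> n" "g + 2 \<le> card (X \<inter> A)" "g + 2 \<le> card (Y \<inter> A)" "0 < n"
  shows "(\<Sum>x\<in>A. \<Sum>y\<in>A - {x}. \<Sum>z\<in>A - {x} - {y}. (1/2) ^ of_bool (x \<in> X \<and> y \<in> Y \<and> z \<in> X))
    \<le> real (card A * (card A - 1) * (card A - 2)) * (1 - real g ^ 3 / (2 * real n ^ 3))"
proof -
  let ?N = "card A"
  have w: "(1/2) ^ of_bool (x \<in> X \<and> y \<in> Y \<and> z \<in> X) = 1 - (1/2::real) * (indicator X x * (indicator Y y * indicator X z))" for x y z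
    by (auto simp: indicator_def)
  have c: "real g \<le> card (B \<inter> A - F)" if "g + 2 \<le> card (B \<inter> A)" "card F \<le> 2" "finite F" for B F
    using that diff_card_le_card_Diff[of F "B \<inter> A"] by simp
  have ind: "(\<Sum>z\<in>A - F. indicator B z) = real (card (B \<inter> A - F))" for B F
  proof -
    have "(\<Sum>z\<in>A - F. indicator B z) = real (card ((A - F) \<inter> B))"
      using assms(1) by (simp add: indicator_def sum.If_cases)
    also have "(A - F) \<inter> B = B \<inter> A - F" by auto
    finally show ?thesis .
  qed
  have "real g ^ 3 \<le> (\<Sum>x\<in>A. indicator X x * (\<Sum>y\<in>A - {x}. indicator Y y * (\<Sum>z\<in>A - {x} - {y}. indicator X z)))"
  proof -
    have 1: "real g \<le> (\<Sum>z\<in>A - {x} - {y}. indicator X z)" for x y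
    proof -
      have "card {x, y} \<le> 2" by (simp add: card_insert_if)
      then have "real g \<le> card (X \<inter> A - {x, y})" by (intro c assms(3)) auto
      also have "\<dots> = (\<Sum>z\<in>A - {x, y}. indicator X z)" by (rule ind[symmetric])
      also have "A - {x, y} = A - {x} - {y}" by auto
      finally show ?thesis .
    qed
    have 2: "real g * real g \<le> (\<Sum>y\<in>A - {x}. indicator Y y * (\<Sum>z\<in>A - {x} - {y}. indicator X z))" for x
    proof -
      have "real g * real g \<le> real (card (Y \<inter> A - {x})) * real g"
        by (intro mult_right_mono c assms(4)) auto
      also have "\<dots> = (\<Sum>y\<in>A - {x}. indicator Y y * real g)"
        by (simp add: ind flip: sum_distrib_right)
      also have "\<dots> \<le> (\<Sum>y\<in>A - {x}. indicator Y y * (\<Sum>z\<in>A - {x} - {y}. indicator X z))"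
        by (intro sum_mono mult_left_mono 1) auto
      finally show ?thesis .
    qed
    have "real g ^ 3 \<le> real (card (X \<inter> A - {})) * (real g * real g)"
      unfolding power3_eq_cube mult.assoc by (intro mult_right_mono c assms(3)) auto
    also have "\<dots> = (\<Sum>x\<in>A. indicator X x * (real g * real g))"
      by (simp only: ind[of X "{}", unfolded Diff_empty] Diff_empty sum_distrib_right[symmetric])
    also have "\<dots> \<le> (\<Sum>x\<in>A. indicator X x * (\<Sum>y\<in>A - {x}. indicator Y y * (\<Sum>z\<in>A - {x} - {y}. indicator X z)))"
      by (intro sum_mono mult_left_mono 2) auto
    finally show ?thesis .
  qed
  also have "\<dots> = (\<Sum>x\<in>A. \<Sum>y\<in>A - {x}. \<Sum>z\<in>A - {x} - {y}. indicator X x * (indicator Y y * indicator X z))"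
    by (simp add: sum_distrib_left)
  finally have low: "real g ^ 3 \<le> \<dots>" .
  have N2: "?N \<ge> 2" using assms(3) card_mono[of A "X \<inter> A"] assms(1) by simp
  have ones: "(\<Sum>x\<in>A. \<Sum>y\<in>A - {x}. \<Sum>z\<in>A - {x} - {y}. (1::real)) = real (?N * (?N - 1) * (?N - 2))"
    using assms(1) by (simp add: card_Diff_singleton numeral_2_eq_2)
  have "real (?N * (?N - 1) * (?N - 2)) \<le> real (n * n * n)"
    using assms(2) by (intro of_nat_mono mult_mono) auto
  then have n3: "real (?N * (?N - 1) * (?N - 2)) \<le> real n ^ 3" by (simp add: power3_eq_cube)
  have "real (?N * (?N - 1) * (?N - 2)) * (real g ^ 3 / (2 * real n ^ 3)) \<le> real n ^ 3 * (real g ^ 3 / (2 * real n ^ 3))"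
    by (intro mult_right_mono n3) auto
  also have "\<dots> = real g ^ 3 / 2" using assms(5) by simp
  finally have "real (?N * (?N - 1) * (?N - 2)) * (real g ^ 3 / (2 * real n ^ 3)) \<le> real g ^ 3 / 2" .
  moreover have "(\<Sum>x\<in>A. \<Sum>y\<in>A - {x}. \<Sum>z\<in>A - {x} - {y}. (1/2) ^ of_bool (x \<in> X \<and> y \<in> Y \<and> z \<in> X)) =
    real (?N * (?N - 1) * (?N - 2)) - 1/2 * (\<Sum>x\<in>A. \<Sum>y\<in>A - {x}. \<Sum>z\<in>A - {x} - {y}. indicator X x * (indicator Y y * indicator X z))"
    unfolding w sum_subtractf ones by (simp only: sum_distrib_left)
  ultimately show ?thesis using low by (simp add: algebra_simps)
qed

text \<open>An exponential moment takes care of the dependence between the blocks: expose one block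
  at a time and apply \<open>triple_sum_le\<close> to what is left of \<open>A\<close>. The reserve
  \<open>3 * m\<close> covers the entries drawn for earlier blocks.\<close>

lemma sum_triple_count_le:
  fixes g n :: nat
  assumes "finite A" "card A \<le> n" "g + 2 + 3 * m \<le> card (X \<inter> A)" "g + 2 + 3 * m \<le> card (Y \<inter> A)" "0 < n" "g \<le> n"
  shows "(\<Sum>ys\<in>permutations_of_set A. (1/2) ^ triple_count X Y m ys)
    \<le> fact (card A) * (1 - real g ^ 3 / (2 * real n ^ 3)) ^ m"
  using assms
proof (induction m arbitrary: A)
  case 0
  then show ?case by (simp add: triple_count_def)
next
  case (Suc m)
  let ?\<rho> = "1 - real g ^ 3 / (2 * real n ^ 3)" and ?N = "card A"
  have "real g ^ 3 \<le> real n ^ 3" using Suc.prems by (intro power_mono) auto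
  also have "\<dots> \<le> 2 * real n ^ 3" by simp
  finally have \<rho>: "?\<rho> \<ge> 0" using Suc.prems by (simp add: field_simps)
  have N: "?N \<ge> 3" using Suc.prems card_mono[of A "X \<inter> A"] by simp
  then have A: "A \<noteq> {}" by auto
  have A1: "A - {x} \<noteq> {}" if "x \<in> A" for x
    using N that card_Diff_singleton[OF that] by (metis card.empty diff_is_0_eq numeral_le_one_iff semiring_norm(70) order_trans)
  have A2: "A - {x} - {y} \<noteq> {}" if "x \<in> A" "y \<in> A - {x}" for x y
  proof -
    have "card (A - {x} - {y}) = ?N - 2" using that Suc.prems by simp
    then have "card (A - {x} - {y}) \<noteq> 0" using N by simp
    then show ?thesis by (metis card.empty)
  qed
  have "(\<Sum>ys\<in>permutations_of_set A. (1/2::real) ^ triple_count X Y (Suc m) ys) =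
      (\<Sum>x\<in>A. \<Sum>ys\<in>permutations_of_set (A - {x}). (1/2) ^ triple_count X Y (Suc m) (x # ys))"
    using Suc.prems(1) A by (rule sum_permutations_of_set)
  also have "\<dots> = (\<Sum>x\<in>A. \<Sum>y\<in>A - {x}. \<Sum>ys\<in>permutations_of_set (A - {x} - {y}).
      (1/2) ^ triple_count X Y (Suc m) (x # y # ys))"
        by (intro sum.cong[OF refl] sum_permutations_of_set[OF _ A1]) (use Suc.prems(1) in simp_all)
  also have "\<dots> = (\<Sum>x\<in>A. \<Sum>y\<in>A - {x}. \<Sum>z\<in>A - {x} - {y}. \<Sum>ys\<in>permutations_of_set (A - {x} - {y} - {z}).
      (1/2) ^ triple_count X Y (Suc m) (x # y # z # ys))"
    by (rule sum.cong[OF refl], rule sum.cong[OF refl], rule sum_permutations_of_set[OF _ A2])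
      (use Suc.prems(1) in simp_all)
  also have "\<dots> = (\<Sum>x\<in>A. \<Sum>y\<in>A - {x}. \<Sum>z\<in>A - {x} - {y}. (1/2) ^ of_bool (x \<in> X \<and> y \<in> Y \<and> z \<in> X) *
     (\<Sum>ys\<in>permutations_of_set (A - {x} - {y} - {z}). (1/2) ^ triple_count X Y m ys))"
    by (simp only: triple_count_Cons power_add sum_distrib_left)
  also have "\<dots> \<le> (\<Sum>x\<in>A. \<Sum>y\<in>A - {x}. \<Sum>z\<in>A - {x} - {y}. (1/2) ^ of_bool (x \<in> X \<and> y \<in> Y \<and> z \<in> X) *
     (fact (?N - 3) * ?\<rho> ^ m))"
  proof (intro sum_mono mult_left_mono)
    fix x y z assume xyz: "x \<in> A" "y \<in> A - {x}" "z \<in> A - {x} - {y}"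
    let ?A = "A - {x} - {y} - {z}"
    have cA: "card ?A = ?N - 3" using xyz Suc.prems(1) by simp
    have "g + 2 + 3 * m \<le> card (B \<inter> ?A)" if "g + 2 + 3 * Suc m \<le> card (B \<inter> A)" for B
    proof -
      have "B \<inter> ?A = B \<inter> A - {x, y, z}" by auto
      moreover have "card {x, y, z} \<le> 3" by (simp add: card_insert_if)
      ultimately show ?thesis using that diff_card_le_card_Diff[of "{x, y, z}" "B \<inter> A"] by simp
    qed
    then have "(\<Sum>ys\<in>permutations_of_set ?A. (1/2) ^ triple_count X Y m ys) \<le> fact (card ?A) * ?\<rho> ^ m"
      using Suc.prems cA by (intro Suc.IH) auto
    then show "(\<Sum>ys\<in>permutations_of_set ?A. (1/2) ^ triple_count X Y m ys) \<le> fact (?N - 3) * ?\<rho> ^ m"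
      unfolding cA .
  qed auto
  also have "\<dots> = (\<Sum>x\<in>A. \<Sum>y\<in>A - {x}. \<Sum>z\<in>A - {x} - {y}. (1/2) ^ of_bool (x \<in> X \<and> y \<in> Y \<and> z \<in> X)) *
     (fact (?N - 3) * ?\<rho> ^ m)"
    by (simp only: sum_distrib_right)
  also have "\<dots> \<le> (real (?N * (?N - 1) * (?N - 2)) * ?\<rho>) * (fact (?N - 3) * ?\<rho> ^ m)"
    using Suc.prems \<rho> by (intro mult_right_mono triple_sum_le) auto
  also have "\<dots> = fact ?N * ?\<rho> ^ Suc m"
  proof -
    obtain k where k: "?N = k + 3" using N by (metis le_add_diff_inverse2)
    have "(fact (k + 3) :: real) = real ((k + 3) * (k + 2) * (k + 1)) * fact k"
      by (simp add: numeral_3_eq_3 algebra_simps)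
    then show ?thesis unfolding k by simp
  qed
  finally show ?case .
qed

lemma bij_betw_permutations_of_set:
  assumes "full \<in> permutations_of_set V" "finite V"
  shows "bij_betw (\<lambda>\<sigma>. map \<sigma> full) {\<sigma>. \<sigma> permutes V} (permutations_of_set V)"
proof -
  have full: "set full = V" "distinct full" using assms by (auto dest: permutations_of_setD)
  have "inj_on (\<lambda>\<sigma>. map \<sigma> full) {\<sigma>. \<sigma> permutes V}"
  proof (rule inj_onI)
    fix \<sigma> \<tau> assume st: "\<sigma> \<in> {\<sigma>. \<sigma> permutes V}" "\<tau> \<in> {\<sigma>. \<sigma> permutes V}" "map \<sigma> full = map \<tau> full"
    then have "\<sigma> x = \<tau> x" for x
      using full by (cases "x \<in> V") (auto simp: permutes_not_in)
    then show "\<sigma> = \<tau>" by auto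
  qed
  moreover have "(\<lambda>\<sigma>. map \<sigma> full) ` {\<sigma>. \<sigma> permutes V} \<subseteq> permutations_of_set V"
    using full by (auto simp: permutations_of_set_def permutes_image distinct_map intro: inj_on_subset permutes_inj_on)
  ultimately show ?thesis
    using assms(2) unfolding bij_betw_def
    by (intro conjI card_subset_eq) (auto simp: card_image card_permutations)
qed

text \<open>Markov's inequality: if the count is below \<open>k\<close>, then
  \<open>2 ^ k * (1/2) ^ triple_count\<close> is at least 1.\<close>

lemma card_few_triples_le:
  fixes g n :: nat
  assumes "finite V" "card V = n" "g + 2 + 3 * m \<le> card (X \<inter> V)" "g + 2 + 3 * m \<le> card (Y \<inter> V)" "0 < n"
    and xs: "distinct xs" "set xs \<subseteq> V" "length xs = 3 * m"
  shows "real (card {\<sigma>. \<sigma> permutes V \<and> triple_count X Y m (map \<sigma> xs) < k})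
    \<le> fact n * 2 ^ k * (1 - real g ^ 3 / (2 * real n ^ 3)) ^ m"
proof -
  obtain zs where zs: "set zs = V - set xs" "distinct zs"
    using finite_distinct_list[of "V - set xs"] assms(1) by auto
  \<comment> \<open>Extending \<open>xs\<close> to an enumeration of \<open>V\<close> makes
    \<open>\<sigma>\<close> recoverable from the list \<open>map \<sigma> full\<close>, which turns
    sums over permutations into sums over lists.\<close>
  define full where "full = xs @ zs"
  have full: "full \<in> permutations_of_set V"
    using zs xs by (auto simp: full_def permutations_of_set_def)
  let ?P = "{\<sigma>. \<sigma> permutes V}"
  have tc: "triple_count X Y m (map \<sigma> xs) = triple_count X Y m (map \<sigma> full)" for \<sigma>
    unfolding triple_count_def full_def using xs(3) by (intro sum.cong refl) (auto simp: nth_append)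
  have fin: "finite ?P" using assms(1) by (rule finite_permutations)
  have "card (X \<inter> V) \<le> n" using assms(1,2) by (metis card_mono inf_le2)
  then have gn: "g \<le> n" using assms(3) by simp
  have "real (card {\<sigma>. \<sigma> permutes V \<and> triple_count X Y m (map \<sigma> xs) < k}) =
    (\<Sum>\<sigma>\<in>?P. of_bool (triple_count X Y m (map \<sigma> xs) < k))"
    using sum.inter_filter[OF fin, of "\<lambda>_. 1::real" "\<lambda>\<sigma>. triple_count X Y m (map \<sigma> xs) < k"]
    by (simp add: of_bool_def)
  also have "\<dots> \<le> (\<Sum>\<sigma>\<in>?P. 2 ^ k * (1/2) ^ triple_count X Y m (map \<sigma> full))"
  proof (rule sum_mono)
    fix \<sigma>
    show "of_bool (triple_count X Y m (map \<sigma> xs) < k) \<le> (2::real) ^ k * (1/2) ^ triple_count X Y m (map \<sigma> full)"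
    proof (cases "triple_count X Y m (map \<sigma> xs) < k")
      case True
      then have "(2::real) ^ triple_count X Y m (map \<sigma> full) \<le> 2 ^ k"
        unfolding tc by (intro power_increasing) auto
      then show ?thesis using True by (simp add: power_one_over field_simps)
    qed simp
  qed
  also have "\<dots> = 2 ^ k * (\<Sum>ys\<in>permutations_of_set V. (1/2) ^ triple_count X Y m ys)"
    using sum.reindex_bij_betw[OF bij_betw_permutations_of_set[OF full assms(1)], of "\<lambda>ys. (1/2::real) ^ triple_count X Y m ys"]
    by (simp flip: sum_distrib_left)
  also have "\<dots> \<le> 2 ^ k * (fact (card V) * (1 - real g ^ 3 / (2 * real n ^ 3)) ^ m)"
    using assms gn by (intro mult_left_mono sum_triple_count_le) auto
  finally show ?thesis using assms(2) by (simp add: mult_ac)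
qed

subsection \<open>The random graph\<close>

text \<open>Presence and colour of a pair in a single variable, with \<open>None\<close> for an
  absent edge. The coloured random graph becomes a product of identical factors over all pairs, from
  which independence and invariance under relabelling can be read off.\<close>

definition edge_colour_pmf :: "real \<Rightarrow> 'c set \<Rightarrow> 'c option pmf" where
  "edge_colour_pmf p Col = bind_pmf (bernoulli_pmf p)
     (\<lambda>b. if b then map_pmf Some (pmf_of_set Col) else return_pmf None)"

definition present_edges :: "'v set \<Rightarrow> ('v set \<Rightarrow> 'c option) \<Rightarrow> 'v set set" where
  "present_edges V g = {e \<in> nsets V 2. g e \<noteq> None}"

definition edge_colour :: "('v set \<Rightarrow> 'c option) \<Rightarrow> 'v set \<Rightarrow> 'c" where
  "edge_colour g e = (case g e of None \<Rightarrow> undefined | Some x \<Rightarrow> x)"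

lemma coloured_perturbed_graph_empty:
  assumes "finite V"
  shows "coloured_perturbed_graph V {} p Col =
    map_pmf (\<lambda>g. (present_edges V g, edge_colour g)) (Pi_pmf (nsets V 2) None (\<lambda>_. edge_colour_pmf p Col))"
proof -
  let ?S = "nsets V 2" and ?u = "pmf_of_set Col"
  have fin: "finite ?S" using assms by (rule finite_imp_finite_nsets)
  have inner: "map_pmf (\<lambda>g. (present_edges V g, edge_colour g))
       (Pi_pmf ?S None (\<lambda>x. if b x then map_pmf Some ?u else return_pmf None)) =
     map_pmf (\<lambda>c. ({e \<in> ?S. b e}, c)) (Pi_pmf {e \<in> ?S. b e} undefined (\<lambda>_. ?u))" for b
  proof -
    let ?R = "{e \<in> ?S. b e}"
    have finR: "finite ?R" using fin by simp
    have "Pi_pmf ?S None (\<lambda>x. if b x then map_pmf Some ?u else return_pmf None) =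
        Pi_pmf ?R None (\<lambda>_. map_pmf Some ?u)"
      using fin by (rule Pi_pmf_if_set)
    \<comment> \<open>\<open>Pi_pmf_map\<close> needs a default that is itself an image under
      \<open>Some\<close>, so \<open>None\<close> is exchanged for \<open>Some undefined\<close> and
      restored outside \<open>?R\<close>.\<close>
    also have "\<dots> = map_pmf (\<lambda>f x. if x \<in> ?R then f x else None)
        (Pi_pmf ?R (Some undefined) (\<lambda>_. map_pmf Some ?u))"
      using finR by (rule Pi_pmf_default_swap[symmetric])
    also have "Pi_pmf ?R (Some undefined) (\<lambda>_. map_pmf Some ?u) =
        map_pmf (\<lambda>h. Some \<circ> h) (Pi_pmf ?R undefined (\<lambda>_. ?u))"
      using finR by (intro Pi_pmf_map) auto
    finally have eq: "map_pmf (\<lambda>g. (present_edges V g, edge_colour g))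
        (Pi_pmf ?S None (\<lambda>x. if b x then map_pmf Some ?u else return_pmf None)) =
      map_pmf (\<lambda>c. (present_edges V (\<lambda>x. if x \<in> ?R then Some (c x) else None),
          edge_colour (\<lambda>x. if x \<in> ?R then Some (c x) else None))) (Pi_pmf ?R undefined (\<lambda>_. ?u))"
      by (simp only: map_pmf_comp comp_def)
    show ?thesis
      unfolding eq
    proof (rule map_pmf_cong[OF refl])
      fix c assume c: "c \<in> set_pmf (Pi_pmf ?R undefined (\<lambda>_. ?u))"
      have "c e = undefined" if "e \<notin> ?R" for e
        using set_Pi_pmf_subset[OF finR, of undefined "\<lambda>_. ?u"] c that by blast
      then have "edge_colour (\<lambda>x. if x \<in> ?R then Some (c x) else None) = c"
        unfolding edge_colour_def fun_eq_iff by simp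
      moreover have "present_edges V (\<lambda>x. if x \<in> ?R then Some (c x) else None) = ?R"
        unfolding present_edges_def by auto
      ultimately show "(present_edges V (\<lambda>x. if x \<in> ?R then Some (c x) else None),
          edge_colour (\<lambda>x. if x \<in> ?R then Some (c x) else None)) = (?R, c)"
        by simp
    qed
  qed
  have "Pi_pmf ?S None (\<lambda>_. edge_colour_pmf p Col) =
    bind_pmf (Pi_pmf ?S False (\<lambda>_. bernoulli_pmf p))
      (\<lambda>b. Pi_pmf ?S None (\<lambda>x. if b x then map_pmf Some ?u else return_pmf None))"
    unfolding edge_colour_pmf_def by (rule Pi_pmf_bind[OF fin])
  then show ?thesis
    by (simp add: coloured_perturbed_graph_def binomial_graph_def uniform_colouring_def
        map_bind_pmf bind_map_pmf inner)
qed

lemma prob_edge_colour: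
  assumes "0 \<le> p" "p \<le> 1" "finite Col" "Col \<noteq> {}" "Z \<subseteq> Col"
  shows "measure_pmf.prob (edge_colour_pmf p Col) (Some ` Z) = p * card Z / card Col"
proof -
  have T: "measure_pmf.prob (map_pmf Some (pmf_of_set Col)) (Some ` Z) = card Z / card Col"
    using assms by (simp add: measure_pmf_of_set inj_vimage_image_eq Int_absorb1)
  have N: "measure_pmf.prob (return_pmf None) (Some ` Z) = 0"
    by (simp add: image_iff)
  show ?thesis
    unfolding edge_colour_pmf_def prob_bind_pmf using assms(1,2)
    by (simp add: T N del: measure_map_pmf measure_return_pmf)
qed

text \<open>\<open>\<sigma>\<close> acts as a bijection on the pairs, and the coordinates are
  identically distributed.\<close>

lemma prob_Pi_pmf_relabel:
  assumes "finite V" "\<sigma> permutes V"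
  shows "measure_pmf.prob (Pi_pmf (nsets V 2) d (\<lambda>_. \<xi>)) {g. P (\<lambda>e. g (\<sigma> ` e))} =
    measure_pmf.prob (Pi_pmf (nsets V 2) d (\<lambda>_. \<xi>)) {g. P g}"
proof -
  let ?S = "nsets V 2"
  have fin: "finite ?S" using assms by (simp add: finite_imp_finite_nsets)
  have card: "card (\<tau> ` e) = card e" if "\<tau> permutes V" for \<tau> e
    using permutes_inj[OF that] by (intro card_image) (auto intro: inj_on_subset)
  have mem: "\<sigma> ` e \<in> ?S \<longleftrightarrow> e \<in> ?S" for e
  proof -
    have "\<sigma> ` e \<subseteq> V \<longleftrightarrow> e \<subseteq> V" using permutes_in_image[OF assms(2)] by blast
    moreover have "finite (\<sigma> ` e) \<longleftrightarrow> finite e"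
      using permutes_inj[OF assms(2)] by (intro finite_image_iff) (auto intro: inj_on_subset)
    ultimately show ?thesis using card[OF assms(2), of e] by (simp add: nsets_def)
  qed
  have "bij_betw ((`) \<sigma>) ?S ?S"
  proof (rule bij_betwI[where g = "(`) (inv \<sigma>)"])
    show "(`) \<sigma> \<in> ?S \<rightarrow> ?S" using mem by auto
    show inv: "\<sigma> ` inv \<sigma> ` e = e" for e
      using permutes_inverses(1)[OF assms(2)] by (simp add: image_image)
    show "(`) (inv \<sigma>) \<in> ?S \<rightarrow> ?S"
    proof
      fix e assume "e \<in> ?S"
      then show "inv \<sigma> ` e \<in> ?S" using mem[of "inv \<sigma> ` e"] inv[of e] by simp
    qed
    show "inv \<sigma> ` \<sigma> ` e = e" for e
      using permutes_inverses(2)[OF assms(2)] by (simp add: image_image)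
  qed
  then have "Pi_pmf ?S d (\<lambda>_. \<xi>) = map_pmf (\<lambda>g. g \<circ> (`) \<sigma>) (Pi_pmf ?S d (\<lambda>_. \<xi>))"
    using fin mem by (intro Pi_pmf_bij_betw) auto
  then have "measure_pmf.prob (Pi_pmf ?S d (\<lambda>_. \<xi>)) {g. P g} =
      measure_pmf.prob (map_pmf (\<lambda>g. g \<circ> (`) \<sigma>) (Pi_pmf ?S d (\<lambda>_. \<xi>))) {g. P g}" by simp
  then show ?thesis by (simp add: comp_def vimage_def)
qed

lemma prob_Pi_pmf_avoid:
  assumes "finite S" "E \<subseteq> S"
  shows "measure_pmf.prob (Pi_pmf S d (\<lambda>_. \<xi>)) {g. \<forall>e\<in>E. g e \<notin> B} = (1 - measure_pmf.prob \<xi> B) ^ card E"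
proof -
  have "{g. \<forall>e\<in>E. g e \<notin> B} = Pi S (\<lambda>e. if e \<in> E then - B else UNIV)"
    using assms(2) by (auto simp: Pi_def split: if_splits)
  then have "measure_pmf.prob (Pi_pmf S d (\<lambda>_. \<xi>)) {g. \<forall>e\<in>E. g e \<notin> B} =
      (\<Prod>e\<in>S. measure_pmf.prob \<xi> (if e \<in> E then - B else UNIV))"
    using assms(1) by (simp only: measure_Pi_pmf_Pi)
  also have "\<dots> = (\<Prod>e\<in>S. if e \<in> E then 1 - measure_pmf.prob \<xi> B else 1)"
    using measure_pmf.prob_compl[of B \<xi>] by (intro prod.cong refl) (auto simp: Compl_eq_Diff_UNIV)
  also have "\<dots> = (1 - measure_pmf.prob \<xi> B) ^ card E"
    using assms by (subst prod.If_cases) (auto simp: Int_absorb1)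
  finally show ?thesis .
qed

lemma one_minus_power_le_exp:
  fixes x :: real
  assumes "x \<le> 1"
  shows "(1 - x) ^ j \<le> exp (- (x * real j))"
proof -
  have "(1 - x) ^ j \<le> exp (- x) ^ j"
    using assms exp_ge_add_one_self[of "- x"] by (intro power_mono) auto
  also have "\<dots> = exp (- (x * real j))"
    by (simp add: mult.commute flip: exp_of_nat_mult)
  finally show ?thesis .
qed

lemma card_edges_between:
  assumes "finite X" "finite Y" "X \<inter> Y = {}"
  shows "card ((\<lambda>(x, y). {x, y}) ` (X \<times> Y)) = card X * card Y"
proof -
  have "inj_on (\<lambda>(x, y). {x, y}) (X \<times> Y)"
    using assms(3) by (fastforce simp: inj_on_def doubleton_eq_iff)
  then show ?thesis by (simp add: card_image card_cartesian_product)
qed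

lemma edges_between_nsets:
  assumes "X \<subseteq> V" "Y \<subseteq> V" "X \<inter> Y = {}"
  shows "(\<lambda>(x, y). {x, y}) ` (X \<times> Y) \<subseteq> nsets V 2"
  using assms by (auto simp: nsets_def card_insert_if)

text \<open>Union bound over at most \<open>8 ^ n\<close> triples of sets. For one triple, at least
  \<open>k * k\<close> independent pairs each succeed with probability at least
  \<open>p * k / n\<close>. For \<open>p = C / n\<close> and \<open>k\<close> linear in
  \<open>n\<close>, the exponent is \<open>C\<close> times a quantity linear in \<open>n\<close>,
  which beats \<open>8 ^ n\<close> for large \<open>C\<close>.\<close>

lemma prob_not_robustly_joined:
  assumes "finite V" "card V = n" "n > 0" "finite Col" "card Col = n" "0 \<le> p" "p \<le> 1"
  shows "measure_pmf.prob (Pi_pmf (nsets V 2) None (\<lambda>_. edge_colour_pmf p Col))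
      {g. \<not> robustly_joined V Col k (present_edges V g) (edge_colour g)}
    \<le> 8 ^ n * exp (- (p * real k ^ 3 / real n))"
proof -
  let ?M = "Pi_pmf (nsets V 2) None (\<lambda>_. edge_colour_pmf p Col)"
  define T where "T = {(X, Y, Z). X \<subseteq> V \<and> Y \<subseteq> V \<and> X \<inter> Y = {} \<and> Z \<subseteq> Col \<and> k \<le> card X \<and> k \<le> card Y \<and> k \<le> card Z}"
  define E where "E = (\<lambda>(X, Y, Z :: 'b set). (\<lambda>(x, y). {x, y}) ` (X \<times> Y :: ('a \<times> 'a) set))"
  define A where "A t = {g. \<forall>e\<in>E t. g e \<notin> Some ` snd (snd t)}" for t :: "'a set \<times> 'a set \<times> 'b set"
  have T: "T \<subseteq> Pow V \<times> Pow V \<times> Pow Col" by (auto simp: T_def)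
  have finP: "finite (Pow V \<times> Pow V \<times> Pow Col)" using assms by simp
  have finT: "finite T" using T finP by (rule finite_subset)
  have cT: "real (card T) \<le> 8 ^ n"
  proof -
    have "card T \<le> card (Pow V \<times> Pow V \<times> Pow Col)" by (rule card_mono[OF finP T])
    also have "\<dots> = 2 ^ n * (2 ^ n * 2 ^ n)" using assms by (simp add: card_cartesian_product card_Pow)
    also have "\<dots> = (2 * 2 * 2) ^ n" by (simp only: power_mult_distrib mult.assoc)
    finally have "real (card T) \<le> real (8 ^ n)" by (intro of_nat_mono) simp
    then show ?thesis by simp
  qed
  have Col: "Col \<noteq> {}" using assms by auto
  have sub: "{g. \<not> robustly_joined V Col k (present_edges V g) (edge_colour g)} \<subseteq> (\<Union>t\<in>T. A t)"
  proof
    fix g assume "g \<in> {g. \<not> robustly_joined V Col k (present_edges V g) (edge_colour g)}"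
    then obtain X Y Z where t: "(X, Y, Z) \<in> T"
      and no: "\<And>x y. x \<in> X \<Longrightarrow> y \<in> Y \<Longrightarrow> {x, y} \<in> present_edges V g \<Longrightarrow> edge_colour g {x, y} \<notin> Z"
      unfolding robustly_joined_def T_def by blast
    have "g e \<notin> Some ` Z" if e: "e \<in> E (X, Y, Z)" for e
    proof
      assume g: "g e \<in> Some ` Z"
      have "e \<in> nsets V 2" using e t edges_between_nsets[of X V Y] by (auto simp: E_def T_def)
      then have "e \<in> present_edges V g" "edge_colour g e \<in> Z"
        using g by (auto simp: present_edges_def edge_colour_def)
      then show False using no e by (auto simp: E_def)
    qed
    then have "g \<in> A (X, Y, Z)" by (simp add: A_def)
    then show "g \<in> (\<Union>t\<in>T. A t)" using t by blast
  qed
  have each: "measure_pmf.prob ?M (A t) \<le> exp (- (p * real k ^ 3 / real n))" if t: "t \<in> T" for t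
  proof -
    obtain X Y Z where tt: "t = (X, Y, Z)" by (cases t)
    have XYZ: "X \<subseteq> V" "Y \<subseteq> V" "X \<inter> Y = {}" "Z \<subseteq> Col" "k \<le> card X" "k \<le> card Y" "k \<le> card Z"
      using t unfolding tt T_def by auto
    have fin: "finite X" "finite Y" using XYZ(1,2) assms(1) by (meson finite_subset)+
    let ?q = "p * card Z / card Col"
    have cZ: "card Z \<le> card Col" using XYZ assms by (intro card_mono) auto
    have "?q \<le> 1 * 1"
      using cZ assms mult_mono[of p 1 "real (card Z) / real (card Col)" 1] by simp
    then have q1: "?q \<le> 1" by simp
    have "measure_pmf.prob ?M (A t) = (1 - ?q) ^ card (E t)"
      unfolding A_def using XYZ edges_between_nsets[OF XYZ(1-3)] assms Col
      by (subst prob_Pi_pmf_avoid) (auto simp: tt E_def finite_imp_finite_nsets prob_edge_colour)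
    also have "\<dots> \<le> exp (- (?q * real (card (E t))))"
      by (rule one_minus_power_le_exp[OF q1])
    also have "\<dots> \<le> exp (- (p * real k ^ 3 / real n))"
    proof -
      have cE: "card (E t) = card X * card Y"
        unfolding tt E_def using card_edges_between[OF fin XYZ(3)] by simp
      have "real (k * (k * k)) \<le> real (card Z * (card X * card Y))"
        using XYZ by (intro of_nat_mono mult_mono) auto
      then have "p * real k ^ 3 / real n \<le> p * real (card Z * (card X * card Y)) / real n"
        using assms by (intro divide_right_mono mult_left_mono) (auto simp: power3_eq_cube)
      then show ?thesis by (simp add: cE assms(5))
    qed
    finally show ?thesis .
  qed
  have "measure_pmf.prob ?M {g. \<not> robustly_joined V Col k (present_edges V g) (edge_colour g)} \<le> measure_pmf.prob ?M (\<Union>t\<in>T. A t)"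
    by (rule measure_pmf.finite_measure_mono[OF sub]) simp
  also have "\<dots> \<le> (\<Sum>t\<in>T. measure_pmf.prob ?M (A t))"
    using finT by (intro measure_pmf.finite_measure_subadditive_finite) auto
  also have "\<dots> \<le> real (card T) * exp (- (p * real k ^ 3 / real n))"
    using sum_mono[OF each] by simp
  also have "\<dots> \<le> 8 ^ n * exp (- (p * real k ^ 3 / real n))"
    by (rule mult_right_mono[OF cT]) simp
  finally show ?thesis .
qed

lemma card_incident_le:
  assumes "finite V"
  shows "card {e \<in> nsets V 2. z \<in> e} \<le> card V"
proof -
  have "{e \<in> nsets V 2. z \<in> e} \<subseteq> (\<lambda>x. {z, x}) ` V"
  proof
    fix e assume "e \<in> {e \<in> nsets V 2. z \<in> e}"
    then obtain x y where "e = {x, y}" "x \<in> V" "y \<in> V" "z \<in> e"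
      by (auto simp: nsets_2_eq)
    then show "e \<in> (\<lambda>x. {z, x}) ` V" by (auto simp: insert_commute)
  qed
  then show ?thesis using assms by (meson card_image_le card_mono finite_imageI order_trans)
qed

text \<open>Markov's inequality for \<open>2 ^ degree\<close>, which is a product of independent
  factors of mean \<open>1 + p\<close> over the at most \<open>n\<close> pairs at \<open>z\<close>.
  It limits the damage done by removing the random edges from the dense graph.\<close>

lemma prob_large_degree:
  assumes "finite V" "card V = n" "0 \<le> p" "p \<le> 1"
  shows "measure_pmf.prob (Pi_pmf (nsets V 2) None (\<lambda>_. edge_colour_pmf p Col))
      {g. \<exists>z\<in>V. k < degree (present_edges V g) z} \<le> real n * (exp (p * real n) / 2 ^ k)"
proof -
  let ?S = "nsets V 2" and ?\<xi> = "edge_colour_pmf p Col"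
  let ?M = "Pi_pmf ?S None (\<lambda>_. ?\<xi>)"
  have fin: "finite ?S" using assms by (simp add: finite_imp_finite_nsets)
  have exp\<xi>: "measure_pmf.expectation ?\<xi> (\<lambda>x. if x \<noteq> None then 2 else 1) = 1 + p"
  proof -
    have "measure_pmf.prob ?\<xi> {x. x \<noteq> None} = p"
      using assms by (simp add: edge_colour_pmf_def prob_bind_pmf vimage_def)
    moreover have "(\<lambda>x :: 'b option. if x \<noteq> None then 2 else 1 :: real) = (\<lambda>x. 1 + indicator {x. x \<noteq> None} x)"
      by (auto simp: indicator_def)
    ultimately show ?thesis
      by (simp add: Bochner_Integration.integral_add measure_pmf.integrable_const_bound[where B = 1])
  qed
  have each: "measure_pmf.prob ?M {g. k < degree (present_edges V g) z} \<le> exp (p * real n) / 2 ^ k" for z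
  proof -
    let ?E = "{e \<in> ?S. z \<in> e}"
    define h :: "'a set \<Rightarrow> 'b option \<Rightarrow> real" where "h e x = (if e \<in> ?E \<and> x \<noteq> None then 2 else 1)" for e x
    have h: "(\<Prod>e\<in>?S. h e (g e)) = 2 ^ degree (present_edges V g) z" for g
    proof -
      have "(\<Prod>e\<in>?S. h e (g e)) = 2 ^ card {e \<in> ?S. e \<in> ?E \<and> g e \<noteq> None}"
        using fin unfolding h_def by (subst prod.If_cases) (auto simp: Int_def)
      also have "{e \<in> ?S. e \<in> ?E \<and> g e \<noteq> None} = {e \<in> present_edges V g. z \<in> e}"
        by (auto simp: present_edges_def)
      finally show ?thesis by (simp add: degree_def)
    qed
    have inth: "integrable (measure_pmf \<zeta>) (h e)" for \<zeta> e
      by (intro measure_pmf.integrable_const_bound[where B = 2]) (auto simp: h_def)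
    have "2 ^ k * measure_pmf.prob ?M {g. k < degree (present_edges V g) z} =
        measure_pmf.expectation ?M (\<lambda>g. 2 ^ k * indicator {g. k < degree (present_edges V g) z} g)"
      by simp
    also have "\<dots> \<le> measure_pmf.expectation ?M (\<lambda>g. \<Prod>e\<in>?S. h e (g e))"
    proof (rule integral_mono)
      show "integrable ?M (\<lambda>g. \<Prod>e\<in>?S. h e (g e))"
        by (intro integrable_prod_Pi_pmf fin inth)
      fix g
      show "2 ^ k * indicator {g. k < degree (present_edges V g) z} g \<le> (\<Prod>e\<in>?S. h e (g e))"
        unfolding h by (auto simp: indicator_def intro: power_increasing)
    qed (auto intro!: measure_pmf.integrable_const_bound[where B = "2 ^ k"] simp: indicator_def)
    also have "\<dots> = (\<Prod>e\<in>?S. measure_pmf.expectation ?\<xi> (h e))"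
      by (intro expectation_prod_Pi_pmf fin inth) (auto simp: h_def)
    also have "\<dots> = (\<Prod>e\<in>?S. if e \<in> ?E then 1 + p else 1)"
    proof (rule prod.cong[OF refl])
      fix e
      have "h e = (if e \<in> ?E then (\<lambda>x. if x \<noteq> None then 2 else 1) else (\<lambda>_. 1))"
        by (auto simp: h_def fun_eq_iff)
      then show "measure_pmf.expectation ?\<xi> (h e) = (if e \<in> ?E then 1 + p else 1)"
        using exp\<xi> by simp
    qed
    also have "\<dots> = (1 + p) ^ card ?E"
      using fin by (subst prod.If_cases) (auto simp: Int_def intro!: arg_cong[where f = "\<lambda>S. (1 + p) ^ card S"])
    also have "\<dots> \<le> (1 + p) ^ n"
      using card_incident_le[OF assms(1), of z] assms by (intro power_increasing) auto
    also have "\<dots> \<le> exp p ^ n"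
      using assms exp_ge_add_one_self[of p] by (intro power_mono) auto
    also have "\<dots> = exp (p * real n)" by (simp add: mult.commute flip: exp_of_nat_mult)
    finally show ?thesis by (simp add: field_simps)
  qed
  have "measure_pmf.prob ?M {g. \<exists>z\<in>V. k < degree (present_edges V g) z} =
      measure_pmf.prob ?M (\<Union>z\<in>V. {g. k < degree (present_edges V g) z})"
    by (rule arg_cong[where f = "measure_pmf.prob ?M"]) auto
  also have "\<dots> \<le> (\<Sum>z\<in>V. measure_pmf.prob ?M {g. k < degree (present_edges V g) z})"
    using assms(1) by (intro measure_pmf.finite_measure_subadditive_finite) auto
  also have "\<dots> \<le> (\<Sum>z\<in>V. exp (p * real n) / 2 ^ k)" by (rule sum_mono) (rule each)
  finally show ?thesis using assms(2) by simp
qed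

lemma path_edges_map: "path_edges (map f xs) = (`) f ` path_edges xs"
  by (induction xs rule: path_edges.induct) auto

section \<open>Relabelling rainbow paths\<close>

definition rainbow_path :: "'v set \<Rightarrow> 'c set \<Rightarrow> 'v set set \<Rightarrow> ('v set \<Rightarrow> 'c) \<Rightarrow> 'v list \<Rightarrow> bool" where
  "rainbow_path V Col R c p \<longleftrightarrow> distinct p \<and> set p \<subseteq> V \<and> path_edges p \<subseteq> R \<and>
     inj_on c (path_edges p) \<and> c ` path_edges p \<subseteq> Col"

lemma rainbow_path_relabel:
  assumes \<sigma>: "\<sigma> permutes V" and p: "rainbow_path V Col (present_edges V g) (edge_colour g) p"
  defines "h \<equiv> \<lambda>e. g (inv \<sigma> ` e)"
  shows "rainbow_path V Col (present_edges V h) (edge_colour h) (map \<sigma> p)"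
proof -
  have inv: "inv \<sigma> ` \<sigma> ` e = e" for e
    using permutes_inverses(2)[OF \<sigma>] by (simp add: image_image)
  have d: "distinct (map \<sigma> p)"
    using p permutes_inj[OF \<sigma>] by (auto simp: rainbow_path_def distinct_map intro: inj_on_subset)
  have V: "set (map \<sigma> p) \<subseteq> V"
    using p permutes_in_image[OF \<sigma>] by (auto simp: rainbow_path_def)
  have "e \<in> present_edges V h" if e: "e \<in> path_edges (map \<sigma> p)" for e
  proof -
    have "e \<in> nsets V 2" using path_edges_nsets[OF d] nsets_mono[OF V] e by blast
    moreover obtain e' where "e = \<sigma> ` e'" "e' \<in> path_edges p" using e by (auto simp: path_edges_map)
    then have "h e \<noteq> None" using p inv by (auto simp: h_def rainbow_path_def present_edges_def)
    ultimately show ?thesis by (simp add: present_edges_def)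
  qed
  moreover have col: "edge_colour h (\<sigma> ` e) = edge_colour g e" for e
    by (simp add: edge_colour_def h_def inv)
  then have "inj_on (edge_colour h) (path_edges (map \<sigma> p))"
    using p by (auto simp: rainbow_path_def path_edges_map inj_on_def)
  moreover have "edge_colour h ` path_edges (map \<sigma> p) \<subseteq> Col"
    using p col by (auto simp: rainbow_path_def path_edges_map)
  ultimately show ?thesis using d V by (auto simp: rainbow_path_def)
qed

text \<open>No canonical path has to be chosen. For each \<open>g\<close> any long path
  \<open>p\<close> serves: all but a fraction \<open>\<alpha>\<close> of its copies
  \<open>map \<sigma> p\<close> satisfy \<open>Q\<close>, and each copy is a rainbow path of the
  relabelled \<open>g\<close>, which has the same law. Averaging over \<open>\<sigma>\<close> and
  then over \<open>g\<close> gives the bound.\<close>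

lemma prob_rainbow_path_relabelled:
  fixes V :: "'v set" and Q :: "'v list \<Rightarrow> bool" and \<xi> :: "'c option pmf"
  assumes "finite V" "card V = n" "0 \<le> \<alpha>"
    and Q: "\<And>p. distinct p \<Longrightarrow> set p \<subseteq> V \<Longrightarrow> L \<le> length p \<Longrightarrow>
      real (card {\<sigma>. \<sigma> permutes V \<and> \<not> Q (map \<sigma> p)}) \<le> \<alpha> * fact n"
  defines "M \<equiv> Pi_pmf (nsets V 2) None (\<lambda>_. \<xi>)"
  shows "measure_pmf.prob M {g. \<exists>p. rainbow_path V Col (present_edges V g) (edge_colour g) p \<and> L \<le> length p \<and> Q p}
    \<ge> measure_pmf.prob M {g. \<exists>p. rainbow_path V Col (present_edges V g) (edge_colour g) p \<and> L \<le> length p} - \<alpha>"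
proof -
  define G where "G g \<longleftrightarrow> (\<exists>p. rainbow_path V Col (present_edges V g) (edge_colour g) p \<and> L \<le> length p \<and> Q p)" for g
  define A where "A g \<longleftrightarrow> (\<exists>p. rainbow_path V Col (present_edges V g) (edge_colour g) p \<and> L \<le> length p)" for g
  let ?P = "{\<sigma>. \<sigma> permutes V}"
  have finP: "finite ?P" using assms(1) by (rule finite_permutations)
  have cP: "card ?P = fact n" using assms(1,2) by (simp add: card_permutations)
  have int: "integrable (measure_pmf M) (\<lambda>c. indicator B c :: real)" for B
    by (auto intro!: measure_pmf.integrable_const_bound[where B = 1])
  have inv: "measure_pmf.prob M {g. G (\<lambda>e. g (inv \<sigma> ` e))} = measure_pmf.prob M {g. G g}" if "\<sigma> \<in> ?P" for \<sigma>
    unfolding M_def using prob_Pi_pmf_relabel[OF assms(1) permutes_inv, of \<sigma>] that by simp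
  have low: "(fact n * (indicator {g. A g} g - \<alpha>) :: real) \<le> (\<Sum>\<sigma>\<in>?P. indicator {g. G (\<lambda>e. g (inv \<sigma> ` e))} g)" for g
  proof (cases "A g")
    case True
    then obtain p where p: "rainbow_path V Col (present_edges V g) (edge_colour g) p" "L \<le> length p"
      by (auto simp: A_def)
    have "G (\<lambda>e. g (inv \<sigma> ` e))" if "\<sigma> \<in> ?P" "Q (map \<sigma> p)" for \<sigma>
      unfolding G_def using rainbow_path_relabel[OF _ p(1), of \<sigma>] that p(2)
      by (intro exI[of _ "map \<sigma> p"]) auto
    then have "(\<Sum>\<sigma>\<in>?P. of_bool (Q (map \<sigma> p))) \<le> (\<Sum>\<sigma>\<in>?P. (indicator {g. G (\<lambda>e. g (inv \<sigma> ` e))} g :: real))"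
      by (intro sum_mono) (auto simp: indicator_def)
    moreover have "(\<Sum>\<sigma>\<in>?P. of_bool (Q (map \<sigma> p))) = real (card {\<sigma> \<in> ?P. Q (map \<sigma> p)})"
      using sum.inter_filter[OF finP, of "\<lambda>_. 1::real" "\<lambda>\<sigma>. Q (map \<sigma> p)"] by (simp add: of_bool_def)
    moreover have "card {\<sigma> \<in> ?P. Q (map \<sigma> p)} + card {\<sigma> \<in> ?P. \<not> Q (map \<sigma> p)} = fact n"
    proof -
      have "card ({\<sigma> \<in> ?P. Q (map \<sigma> p)} \<union> {\<sigma> \<in> ?P. \<not> Q (map \<sigma> p)}) = card {\<sigma> \<in> ?P. Q (map \<sigma> p)} + card {\<sigma> \<in> ?P. \<not> Q (map \<sigma> p)}"
        using finP by (intro card_Un_disjoint) auto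
      moreover have "{\<sigma> \<in> ?P. Q (map \<sigma> p)} \<union> {\<sigma> \<in> ?P. \<not> Q (map \<sigma> p)} = ?P" by auto
      ultimately show ?thesis using cP by simp
    qed
    then have "real (card {\<sigma> \<in> ?P. Q (map \<sigma> p)}) + real (card {\<sigma> \<in> ?P. \<not> Q (map \<sigma> p)}) = fact n"
      by (simp flip: of_nat_add)
    moreover have "real (card {\<sigma> \<in> ?P. \<not> Q (map \<sigma> p)}) \<le> \<alpha> * fact n"
      using Q[of p] p by (auto simp: rainbow_path_def)
    ultimately show ?thesis using True by (simp add: algebra_simps)
  next
    case False
    then have "(fact n * (indicator {g. A g} g - \<alpha>) :: real) \<le> 0" using \<open>0 \<le> \<alpha>\<close> by simp
    also have "0 \<le> (\<Sum>\<sigma>\<in>?P. (indicator {g. G (\<lambda>e. g (inv \<sigma> ` e))} g :: real))" by (intro sum_nonneg) simp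
    finally show ?thesis .
  qed
  have "fact n * (measure_pmf.prob M {g. A g} - \<alpha>) = measure_pmf.expectation M (\<lambda>g. fact n * (indicator {g. A g} g - \<alpha>))"
    using int by (simp add: Bochner_Integration.integral_diff)
  also have "\<dots> \<le> measure_pmf.expectation M (\<lambda>g. \<Sum>\<sigma>\<in>?P. indicator {g. G (\<lambda>e. g (inv \<sigma> ` e))} g)"
    by (rule integral_mono[OF _ _ low]) (auto intro!: int Bochner_Integration.integrable_diff)
  also have "\<dots> = (\<Sum>\<sigma>\<in>?P. measure_pmf.prob M {g. G (\<lambda>e. g (inv \<sigma> ` e))})"
    by (subst Bochner_Integration.integral_sum) (auto intro: int)
  also have "\<dots> = fact n * measure_pmf.prob M {g. G g}"
    using inv cP by simp
  finally have "measure_pmf.prob M {g. A g} - \<alpha> \<le> measure_pmf.prob M {g. G g}"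
    by simp
  then show ?thesis by (simp add: G_def A_def)
qed

section \<open>Usable triples along the path\<close>

definition triples :: "'v set set \<Rightarrow> 'v list \<Rightarrow> nat \<Rightarrow> nat \<Rightarrow> 'v \<Rightarrow> 'v \<Rightarrow> nat set" where
  "triples E p m off z f = {i. i < m \<and> {z, p ! (off + 3 * i)} \<in> E \<and> {z, p ! (off + 3 * i + 2)} \<in> E \<and>
     {p ! (off + 3 * i + 1), f} \<in> E}"

text \<open>The first \<open>3 * m\<close> positions serve the insertion of vertices and the next
  \<open>3 * m\<close> the rotations, so that the two phases can use disjoint sets of dense
  edges.\<close>

definition well_placed :: "'v set set \<Rightarrow> 'v set \<Rightarrow> nat \<Rightarrow> nat \<Rightarrow> 'v list \<Rightarrow> bool" where
  "well_placed E V m k p \<longleftrightarrow> (\<forall>z\<in>V. \<forall>f\<in>V. k \<le> card (triples E p m 0 z f) \<and> k \<le> card (triples E p m (3 * m) z f))"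

lemma finite_triples [simp]: "finite (triples E p m off z f)"
  by (simp add: triples_def)

lemma card_triples:
  assumes "off + 3 * m \<le> length p"
  shows "card (triples E p m off z f) =
    triple_count {x. {z, x} \<in> E} {x. {f, x} \<in> E} m (take (3 * m) (drop off p))"
proof -
  have "triple_count {x. {z, x} \<in> E} {x. {f, x} \<in> E} m (take (3 * m) (drop off p)) =
      (\<Sum>i<m. of_bool (i \<in> triples E p m off z f))"
    unfolding triple_count_def
    by (rule sum.cong[OF refl]) (use assms in \<open>auto simp: triples_def insert_commute add.assoc\<close>)
  also have "\<dots> = card {i \<in> {..<m}. i \<in> triples E p m off z f}"
    using sum.inter_filter[of "{..<m}" "\<lambda>_. 1::nat" "\<lambda>i. i \<in> triples E p m off z f"] by (simp add: of_bool_def)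
  also have "{i \<in> {..<m}. i \<in> triples E p m off z f} = triples E p m off z f"
    by (auto simp: triples_def)
  finally show ?thesis by simp
qed

lemma card_not_well_placed_le:
  fixes g n :: nat
  assumes "finite V" "card V = n" "0 < n"
    and deg: "\<And>z. z \<in> V \<Longrightarrow> g + 2 + 3 * m \<le> card ({x. {z, x} \<in> E} \<inter> V)"
    and p: "distinct p" "set p \<subseteq> V" "6 * m \<le> length p"
  shows "real (card {\<sigma>. \<sigma> permutes V \<and> \<not> well_placed E V m k (map \<sigma> p)})
    \<le> (2 * real n ^ 2 * 2 ^ k * (1 - real g ^ 3 / (2 * real n ^ 3)) ^ m) * fact n"
proof -
  let ?N = "\<lambda>z. {x. {z, x} \<in> E}"
  define xs where "xs off = take (3 * m) (drop off p)" for off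
  define Bad where "Bad = (\<lambda>(z, f, off). {\<sigma>. \<sigma> permutes V \<and> triple_count (?N z) (?N f) m (map \<sigma> (xs off)) < k})"
  let ?I = "V \<times> V \<times> {0, 3 * m}"
  have finP: "finite {\<sigma>. \<sigma> permutes V}" using assms(1) by (rule finite_permutations)
  have finB: "finite (Bad t)" for t
    unfolding Bad_def by (cases t) (auto intro: finite_subset[OF _ finP])
  have sub: "{\<sigma>. \<sigma> permutes V \<and> \<not> well_placed E V m k (map \<sigma> p)} \<subseteq> (\<Union>t\<in>?I. Bad t)"
  proof
    fix \<sigma> assume "\<sigma> \<in> {\<sigma>. \<sigma> permutes V \<and> \<not> well_placed E V m k (map \<sigma> p)}"
    then obtain z f off where *: "\<sigma> permutes V" "z \<in> V" "f \<in> V" "off \<in> {0, 3 * m}"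
      "card (triples E (map \<sigma> p) m off z f) < k"
      unfolding well_placed_def by (auto simp: not_le)
    then have "card (triples E (map \<sigma> p) m off z f) = triple_count (?N z) (?N f) m (map \<sigma> (xs off))"
      using p(3) by (subst card_triples) (auto simp: xs_def take_map drop_map)
    then have "\<sigma> \<in> Bad (z, f, off)" using * by (simp add: Bad_def)
    then show "\<sigma> \<in> (\<Union>t\<in>?I. Bad t)" using * by blast
  qed
  have each: "real (card (Bad t)) \<le> fact n * 2 ^ k * (1 - real g ^ 3 / (2 * real n ^ 3)) ^ m" if tI: "t \<in> ?I" for t
  proof -
    obtain z f off where t: "t = (z, f, off)" "z \<in> V" "f \<in> V" "off \<in> {0, 3 * m}" using tI by auto
    show ?thesis
      unfolding t(1) Bad_def prod.case
    proof (rule card_few_triples_le[OF assms(1,2) deg[OF t(2)] deg[OF t(3)] assms(3)])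
      show "distinct (xs off)" using p(1) by (simp add: xs_def)
      show "set (xs off) \<subseteq> V" 
        using p(2) set_take_subset[of "3 * m" "drop off p"] set_drop_subset[of off p] unfolding xs_def by blast
      show "length (xs off) = 3 * m" using p(3) t(4) by (auto simp: xs_def)
    qed
  qed
  have cI: "card ?I \<le> 2 * n ^ 2"
    using assms(1,2) by (simp add: card_cartesian_product power2_eq_square card_insert_if)
  have "card {\<sigma>. \<sigma> permutes V \<and> \<not> well_placed E V m k (map \<sigma> p)} \<le> card (\<Union>t\<in>?I. Bad t)"
    using assms(1) finB by (intro card_mono[OF _ sub]) auto
  also have "\<dots> \<le> (\<Sum>t\<in>?I. card (Bad t))" using assms(1) by (intro card_UN_le) auto
  finally have "real (card {\<sigma>. \<sigma> permutes V \<and> \<not> well_placed E V m k (map \<sigma> p)}) \<le> real (\<Sum>t\<in>?I. card (Bad t))"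
    by (rule of_nat_mono)
  also have "\<dots> = (\<Sum>t\<in>?I. real (card (Bad t)))" by (rule of_nat_sum)
  also have "\<dots> \<le> (\<Sum>t\<in>?I. fact n * 2 ^ k * (1 - real g ^ 3 / (2 * real n ^ 3)) ^ m)"
    by (rule sum_mono) (rule each)
  also have "\<dots> = real (card ?I) * (fact n * 2 ^ k * (1 - real g ^ 3 / (2 * real n ^ 3)) ^ m)" by simp
  also have "\<dots> \<le> real (2 * n ^ 2) * (fact n * 2 ^ k * (1 - real g ^ 3 / (2 * real n ^ 3)) ^ m)"
  proof (rule mult_right_mono)
    show "real (card ?I) \<le> real (2 * n ^ 2)" using cI by (rule of_nat_mono)
    obtain z where z: "z \<in> V" using assms(2,3) by fastforce
    have "card (?N z \<inter> V) \<le> n" using assms(1,2) by (metis card_mono inf_le2)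
    then have "g \<le> n" using deg[OF z] by simp
    then have "real g ^ 3 \<le> real n ^ 3" by (intro power_mono) auto
    also have "\<dots> \<le> 2 * real n ^ 3" by simp
    finally show "0 \<le> fact n * 2 ^ k * (1 - real g ^ 3 / (2 * real n ^ 3)) ^ m"
      using assms(3) by (intro mult_nonneg_nonneg zero_le_power) (simp_all add: field_simps)
  qed
  finally show ?thesis by (simp add: mult_ac)
qed

lemma card_hit_indices_le:
  assumes "finite R" "distinct p" "\<And>i. i < m \<Longrightarrow> h i < length p" "inj_on h {..<m}" "degree R z \<le> d"
  shows "card {i. i < m \<and> {z, p ! h i} \<in> R} \<le> d"
proof -
  have "card {i. i < m \<and> {z, p ! h i} \<in> R} \<le> card {e \<in> R. z \<in> e}"
  proof (rule card_inj_on_le[where f = "\<lambda>i. {z, p ! h i}"])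
    show "inj_on (\<lambda>i. {z, p ! h i}) {i. i < m \<and> {z, p ! h i} \<in> R}"
    proof (rule inj_onI)
      fix i j assume "i \<in> {i. i < m \<and> {z, p ! h i} \<in> R}" "j \<in> {i. i < m \<and> {z, p ! h i} \<in> R}"
        "{z, p ! h i} = {z, p ! h j}"
      then have ij: "i < m" "j < m" and "p ! h i = p ! h j" by (auto simp: doubleton_eq_iff)
      then have "h i = h j" using assms(2) assms(3)[OF ij(1)] assms(3)[OF ij(2)] by (simp add: nth_eq_iff_index_eq)
      then show "i = j" using assms(4) ij by (auto dest: inj_onD)
    qed
  qed (use assms(1) in auto)
  then show ?thesis using assms(5) by (simp add: degree_def)
qed

text \<open>Dense edges that are also random have their colours exposed and must be given up. They
  spoil at most \<open>d\<close> triples in each of the three positions.\<close>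

lemma well_placed_Diff:
  assumes "well_placed E V m k p" "finite R" "distinct p" "6 * m \<le> length p" "\<And>z. z \<in> V \<Longrightarrow> degree R z \<le> d"
  shows "well_placed (E - R) V m (k - 3 * d) p"
proof -
  have "k - 3 * d \<le> card (triples (E - R) p m off z f)"
    if z: "z \<in> V" and f: "f \<in> V" and off: "off \<in> {0, 3 * m}" for z f off
  proof -
    define L1 where "L1 = {i. i < m \<and> {z, p ! (off + 3 * i)} \<in> R}"
    define L2 where "L2 = {i. i < m \<and> {z, p ! (off + 3 * i + 2)} \<in> R}"
    define L3 where "L3 = {i. i < m \<and> {f, p ! (off + 3 * i + 1)} \<in> R}"
    have "card L1 \<le> d" "card L2 \<le> d" "card L3 \<le> d"
      unfolding L1_def L2_def L3_def using assms(4) off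
      by (intro card_hit_indices_le[OF assms(2,3) _ _ assms(5)]; use z f in \<open>force simp: inj_on_def\<close>)+
    then have "card (L1 \<union> L2 \<union> L3) \<le> 3 * d"
      using card_Un_le[of "L1 \<union> L2" L3] card_Un_le[of L1 L2] by linarith
    moreover have "triples E p m off z f - (L1 \<union> L2 \<union> L3) \<subseteq> triples (E - R) p m off z f"
      by (auto simp: triples_def L1_def L2_def L3_def insert_commute)
    then have "card (triples E p m off z f - (L1 \<union> L2 \<union> L3)) \<le> card (triples (E - R) p m off z f)"
      by (intro card_mono) auto
    moreover have "card (triples E p m off z f) - card (L1 \<union> L2 \<union> L3) \<le> card (triples E p m off z f - (L1 \<union> L2 \<union> L3))"
      by (intro diff_card_le_card_Diff) (auto simp: L1_def L2_def L3_def)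
    moreover have "k \<le> card (triples E p m off z f)"
      using assms(1) z f off by (auto simp: well_placed_def)
    ultimately show ?thesis by linarith
  qed
  then show ?thesis by (simp add: well_placed_def)
qed

text \<open>Relabelling requires a criterion that does not involve the random graph. So good
  placement is shown for \<open>E\<close> itself, and \<open>R\<close> is removed afterwards by
  means of the degree bound.\<close>

lemma prob_well_placed_rainbow_path:
  fixes g n :: nat and V :: "'v set" and Col :: "'c set"
  assumes "finite V" "card V = n" "0 < n" "finite Col" "card Col = n" "0 \<le> p" "p \<le> 1"
    and deg: "\<And>z. z \<in> V \<Longrightarrow> g + 2 + 3 * m \<le> card ({x. {z, x} \<in> E} \<inter> V)"
    and len: "6 * m + 2 * k \<le> n"
  shows "measure_pmf.prob (coloured_perturbed_graph V {} p Col)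
      {(R, c). R \<subseteq> nsets V 2 \<and> (\<exists>P. rainbow_path V Col R c P \<and> n \<le> length P + 2 * k \<and>
          well_placed (E - R) V m (t - 3 * d) P)}
    \<ge> 1 - (8 ^ n * exp (- (p * real k ^ 3 / real n)) + real n * (exp (p * real n) / 2 ^ d) +
         2 * real n ^ 2 * 2 ^ t * (1 - real g ^ 3 / (2 * real n ^ 3)) ^ m)"
    (is "measure_pmf.prob _ ?S \<ge> 1 - (?e1 + ?e2 + ?e3)")
proof -
  define M where "M = Pi_pmf (nsets V 2) None (\<lambda>_. edge_colour_pmf p Col)"
  let ?R = "present_edges V" and ?c = edge_colour
  define A1 where "A1 = {g. \<not> robustly_joined V Col k (?R g) (?c g)}"
  define A2 where "A2 = {g :: 'v set \<Rightarrow> 'c option. \<exists>z\<in>V. d < degree (?R g) z}"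
  define A3 where "A3 = {g. \<exists>P. rainbow_path V Col (?R g) (?c g) P \<and> n - 2 * k \<le> length P \<and> well_placed E V m t P}"
  have e1: "measure_pmf.prob M A1 \<le> ?e1"
    unfolding M_def A1_def by (rule prob_not_robustly_joined[OF assms(1-7)])
  have e2: "measure_pmf.prob M A2 \<le> ?e2"
    unfolding M_def A2_def by (rule prob_large_degree[OF assms(1,2,6,7)])
  have "- A1 \<subseteq> {g. \<exists>P. rainbow_path V Col (?R g) (?c g) P \<and> n - 2 * k \<le> length P}"
  proof
    fix g assume "g \<in> - A1"
    then have "robustly_joined V Col k (?R g) (?c g)" by (simp add: A1_def)
    from rainbow_path_exists[OF assms(1,4) _ this] assms(2,5)
    show "g \<in> {g. \<exists>P. rainbow_path V Col (?R g) (?c g) P \<and> n - 2 * k \<le> length P}"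
      by (auto simp: rainbow_path_def)
  qed
  then have "measure_pmf.prob M (- A1) \<le> measure_pmf.prob M {g. \<exists>P. rainbow_path V Col (?R g) (?c g) P \<and> n - 2 * k \<le> length P}"
    by (rule measure_pmf.finite_measure_mono) simp
  moreover have "measure_pmf.prob M (- A1) = 1 - measure_pmf.prob M A1"
    using measure_pmf.prob_compl[of A1 M] by (simp add: Compl_eq_Diff_UNIV)
  moreover have "measure_pmf.prob M A3 \<ge> measure_pmf.prob M {g. \<exists>P. rainbow_path V Col (?R g) (?c g) P \<and> n - 2 * k \<le> length P} - ?e3"
    unfolding M_def A3_def
  proof (rule prob_rainbow_path_relabelled[OF assms(1,2)])
    fix P :: "'v list" assume P: "distinct P" "set P \<subseteq> V" "n - 2 * k \<le> length P"
    then show "real (card {\<sigma>. \<sigma> permutes V \<and> \<not> well_placed E V m t (map \<sigma> P)}) \<le> ?e3 * fact n"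
      using len by (intro card_not_well_placed_le[OF assms(1-3) deg]) auto
  next
    obtain z where z: "z \<in> V" using assms(2,3) by fastforce
    have "card ({x. {z, x} \<in> E} \<inter> V) \<le> n" using assms(1,2) by (metis card_mono inf_le2)
    then have "g \<le> n" using deg[OF z] by simp
    then have "real g ^ 3 \<le> real n ^ 3" by (intro power_mono) auto
    also have "\<dots> \<le> 2 * real n ^ 3" by simp
    finally show "0 \<le> ?e3"
      using assms(3) by (intro mult_nonneg_nonneg zero_le_power) (simp_all add: field_simps)
  qed
  ultimately have e3: "measure_pmf.prob M A3 \<ge> 1 - ?e1 - ?e3" using e1 by linarith
  have "measure_pmf.prob M A3 \<le> measure_pmf.prob M ((A3 - A2) \<union> A2)"
    by (rule measure_pmf.finite_measure_mono) auto
  also have "\<dots> \<le> measure_pmf.prob M (A3 - A2) + measure_pmf.prob M A2"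
    by (rule measure_Un_le) auto
  finally have "measure_pmf.prob M (A3 - A2) \<ge> 1 - (?e1 + ?e2 + ?e3)" using e2 e3 by linarith
  moreover have "measure_pmf.prob M (A3 - A2) \<le> measure_pmf.prob M ((\<lambda>g. (?R g, ?c g)) -` ?S)"
  proof (rule measure_pmf.finite_measure_mono)
    show "A3 - A2 \<subseteq> (\<lambda>g. (?R g, ?c g)) -` ?S"
    proof
      fix g assume g: "g \<in> A3 - A2"
      then obtain P where P: "rainbow_path V Col (?R g) (?c g) P" "n - 2 * k \<le> length P" "well_placed E V m t P"
        by (auto simp: A3_def)
      have sub: "?R g \<subseteq> nsets V 2" by (auto simp: present_edges_def)
      moreover have "finite (?R g)"
        using sub by (rule finite_subset) (simp add: finite_imp_finite_nsets assms(1))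
      then have "well_placed (E - ?R g) V m (t - 3 * d) P"
        using P g len by (intro well_placed_Diff) (auto simp: A2_def rainbow_path_def not_less)
      ultimately show "g \<in> (\<lambda>g. (?R g, ?c g)) -` ?S" using P by auto
    qed
  qed simp
  ultimately show ?thesis
    unfolding coloured_perturbed_graph_empty[OF assms(1)] M_def by simp
qed

subsection \<open>Inserting vertices into a path\<close>

lemma path_edges_insert:
  assumes "distinct (xs @ x # y # ys)"
  shows "path_edges (xs @ x # u # y # ys) = insert {x, u} (insert {u, y} (path_edges (xs @ x # y # ys) - {{x, y}}))"
proof -
  have "{x, y} \<notin> path_edges (xs @ [x])" "{x, y} \<notin> path_edges (y # ys)"
    using assms path_edges_subset[of "{x, y}" "xs @ [x]"] path_edges_subset[of "{x, y}" "y # ys"] by auto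
  then show ?thesis
    unfolding path_edges_append[of xs x "y # ys"] path_edges_append[of xs x "u # y # ys"] by auto
qed

text \<open>Insertion is adaptive: the vertices, path edges and colours still available depend on
  colours already seen. Demanding a good pair for all large sets at once removes this dependence.
  \<open>j\<close> bounds the path edges used up, and disjoint \<open>D1\<close>, \<open>D2\<close>
  will force two different new colours.\<close>

definition insertable :: "'v set set \<Rightarrow> 'v list \<Rightarrow> nat \<Rightarrow> 'v set \<Rightarrow> 'c set \<Rightarrow> nat \<Rightarrow> nat \<Rightarrow> nat \<Rightarrow> ('v set \<Rightarrow> 'c) \<Rightarrow> bool" where
  "insertable E P m U Col s t j c \<longleftrightarrow> (\<forall>U' I D1 D2. U' \<subseteq> U \<longrightarrow> t \<le> card U' \<longrightarrow> I \<subseteq> {..<m} \<longrightarrow> m \<le> card I + j \<longrightarrow>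
     D1 \<subseteq> Col \<longrightarrow> D2 \<subseteq> Col \<longrightarrow> s \<le> card D1 \<longrightarrow> s \<le> card D2 \<longrightarrow>
     (\<exists>u\<in>U'. \<exists>i\<in>I. {u, P ! (3 * i)} \<in> E \<and> {u, P ! (3 * i + 1)} \<in> E \<and>
        c {u, P ! (3 * i)} \<in> D1 \<and> c {u, P ! (3 * i + 1)} \<in> D2))"

lemma prob_two_edges:
  assumes "finite A" "e1 \<in> A" "e2 \<in> A" "e1 \<noteq> e2" "finite Col" "Col \<noteq> {}" "D1 \<subseteq> Col" "D2 \<subseteq> Col"
  shows "measure_pmf.prob (uniform_colouring Col A) {f. f e1 \<in> D1 \<and> f e2 \<in> D2} =
    card D1 / card Col * (card D2 / card Col)"
proof -
  have one: "measure_pmf.prob (uniform_colouring Col A) {f. f e \<in> Z} = card Z / card Col"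
    if "e \<in> A" "Z \<subseteq> Col" for e Z
  proof -
    have "measure_pmf.prob (map_pmf (\<lambda>f. f e) (uniform_colouring Col A)) Z = measure_pmf.prob (pmf_of_set Col) Z"
      unfolding uniform_colouring_def using assms(1) that(1) by (subst Pi_pmf_component) auto
    then show ?thesis
      using assms that by (simp add: measure_pmf_of_set Int_absorb1 vimage_def)
  qed
  have "measure_pmf.prob (uniform_colouring Col A) {f. f e1 \<in> D1 \<and> f e2 \<in> D2} =
    measure_pmf.prob (uniform_colouring Col A) {f. f e1 \<in> D1} * measure_pmf.prob (uniform_colouring Col A) {f. f e2 \<in> D2}"
    unfolding uniform_colouring_def
    by (rule prob_Pi_pmf_indep[where B = "{e1}"]) (use assms in auto)
  then show ?thesis using one assms by simp
qed

text \<open>Union bound over at most \<open>16 ^ n\<close> choices of the four sets. For fixed sets,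
  at least \<open>t * (k - j)\<close> pairs of a vertex and an index qualify. Their edge pairs are
  disjoint, hence independent, and each succeeds with probability at least
  \<open>(s / n)\<^sup>2\<close>. In the application the exponent is quadratic in
  \<open>n\<close>.\<close>

lemma prob_not_insertable:
  fixes Col :: "'c set" and V :: "'v set" and n :: nat
  assumes "finite V" "card V = n" "0 < n" "finite Col" "card Col = n"
    and P: "distinct P" "set P \<subseteq> V" "3 * m \<le> length P" and U: "U = V - set P"
    and A: "finite A" "\<And>u i. u \<in> U \<Longrightarrow> i < 3 * m \<Longrightarrow> {u, P ! i} \<in> E \<Longrightarrow> {u, P ! i} \<in> A"
    and k: "\<And>u. u \<in> U \<Longrightarrow> k \<le> card (triples E P m 0 u u)"
    and "s \<le> n" "m \<le> n"
  shows "measure_pmf.prob (uniform_colouring Col A) {c. \<not> insertable E P m U Col s t j c}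
    \<le> 16 ^ n * (1 - (real s / real n)\<^sup>2) ^ (t * (k - j))"
proof -
  let ?M = "uniform_colouring Col A"
  define T where "T = {(U', I, D1, D2). U' \<subseteq> U \<and> t \<le> card U' \<and> I \<subseteq> {..<m} \<and> m \<le> card I + j \<and>
     D1 \<subseteq> Col \<and> D2 \<subseteq> Col \<and> s \<le> card D1 \<and> s \<le> card D2}"
  define G where "G = (\<lambda>(U', I, D1 :: 'c set, D2 :: 'c set). SIGMA u:U'. {i \<in> I. {u, P ! (3 * i)} \<in> E \<and> {u, P ! (3 * i + 1)} \<in> E})"
  define Bl where "Bl = (\<lambda>(u, i). {{u, P ! (3 * i)}, {u, P ! (3 * i + 1)}})"
  define Q where "Q = (\<lambda>(U' :: 'v set, I :: nat set, D1, D2) (u, i) (c :: 'v set \<Rightarrow> 'c). \<not> (c {u, P ! (3 * i)} \<in> D1 \<and> c {u, P ! (3 * i + 1)} \<in> D2))"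
  have finU: "finite U" using assms(1) U by simp
  have TP: "T \<subseteq> Pow U \<times> Pow {..<m} \<times> Pow Col \<times> Pow Col" by (auto simp: T_def)
  have finP: "finite (Pow U \<times> Pow {..<m} \<times> Pow Col \<times> Pow Col)" using finU assms by simp
  have finT: "finite T" using TP finP by (rule finite_subset)
  have cU: "card U \<le> n" using U assms(1,2) by (metis card_mono Diff_subset)
  have cT: "real (card T) \<le> 16 ^ n"
  proof -
    have "card T \<le> card (Pow U \<times> Pow {..<m} \<times> Pow Col \<times> Pow Col)" by (rule card_mono[OF finP TP])
    also have "\<dots> = 2 ^ card U * (2 ^ m * (2 ^ n * 2 ^ n))"
      using finU assms by (simp add: card_cartesian_product card_Pow)
    also have "\<dots> \<le> 2 ^ n * (2 ^ n * (2 ^ n * 2 ^ n))"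
      using cU assms by (intro mult_mono power_increasing) auto
    also have "\<dots> = (2 * (2 * (2 * 2))) ^ n" by (simp only: power_mult_distrib)
    finally have "real (card T) \<le> real (16 ^ n)" by (intro of_nat_mono) simp
    then show ?thesis by simp
  qed
  have Col: "Col \<noteq> {}" using assms by auto
  have sub: "{c. \<not> insertable E P m U Col s t j c} \<subseteq> (\<Union>\<tau>\<in>T. {c. \<forall>ui\<in>G \<tau>. Q \<tau> ui c})"
  proof
    fix c assume "c \<in> {c. \<not> insertable E P m U Col s t j c}"
    then obtain U' I D1 D2 where t: "(U', I, D1, D2) \<in> T"
      and no: "\<And>u i. u \<in> U' \<Longrightarrow> i \<in> I \<Longrightarrow> {u, P ! (3 * i)} \<in> E \<Longrightarrow> {u, P ! (3 * i + 1)} \<in> E \<Longrightarrow>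
        \<not> (c {u, P ! (3 * i)} \<in> D1 \<and> c {u, P ! (3 * i + 1)} \<in> D2)"
      unfolding insertable_def T_def by blast
    then have "\<forall>ui\<in>G (U', I, D1, D2). Q (U', I, D1, D2) ui c" by (auto simp: G_def Q_def)
    then show "c \<in> (\<Union>\<tau>\<in>T. {c. \<forall>ui\<in>G \<tau>. Q \<tau> ui c})" using t by blast
  qed
  let ?x = "(real s / real n)\<^sup>2"
  have x: "0 \<le> ?x" "?x \<le> 1"
    using assms by (auto simp: power_le_one)
  have each: "measure_pmf.prob ?M {c. \<forall>ui\<in>G \<tau>. Q \<tau> ui c} \<le> (1 - ?x) ^ (t * (k - j))" if \<tau>T: "\<tau> \<in> T" for \<tau>
  proof -
    obtain U' I D1 D2 where \<tau>: "\<tau> = (U', I, D1, D2)" by (cases \<tau>)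
    have h: "U' \<subseteq> U" "t \<le> card U'" "I \<subseteq> {..<m}" "m \<le> card I + j" "D1 \<subseteq> Col" "D2 \<subseteq> Col" "s \<le> card D1" "s \<le> card D2"
      using \<tau>T unfolding \<tau> T_def by auto
    have fin: "finite U'" "finite I" using h finU by (auto intro: finite_subset)
    have finG: "finite (G \<tau>)" unfolding \<tau> G_def using fin by auto
    have uP: "u \<notin> set P" if "u \<in> U" for u using that U by simp
    have idx: "P ! l \<in> set P" if "l < 3 * m" for l using that P(3) by simp
    have eq: "l = l'" if "{u, P ! l} = {u', P ! l'}" "u \<in> U" "u' \<in> U" "l < 3 * m" "l' < 3 * m" for u u' l l'
    proof -
      have "P ! l = P ! l'" using that uP idx by (metis doubleton_eq_iff)
      then show ?thesis using that P by (simp add: nth_eq_iff_index_eq)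
    qed
    have equ: "u = u'" if "{u, P ! l} = {u', P ! l'}" "u \<in> U" "u' \<in> U" "l < 3 * m" "l' < 3 * m" for u u' l l'
      using that uP idx by (metis doubleton_eq_iff)
    have G: "u \<in> U" "i < m" "{u, P ! (3 * i)} \<in> A" "{u, P ! (3 * i + 1)} \<in> A" "{u, P ! (3 * i)} \<noteq> {u, P ! (3 * i + 1)}"
      if "(u, i) \<in> G \<tau>" for u i
    proof -
      show ui: "u \<in> U" "i < m" using that h unfolding \<tau> G_def by auto
      then show "{u, P ! (3 * i)} \<in> A" "{u, P ! (3 * i + 1)} \<in> A"
        using that A(2)[of u "3 * i"] A(2)[of u "3 * i + 1"] unfolding \<tau> G_def by auto
      show "{u, P ! (3 * i)} \<noteq> {u, P ! (3 * i + 1)}"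
        using eq[of u "3 * i" u "3 * i + 1"] ui by auto
    qed
    have "measure_pmf.prob ?M {c. \<forall>ui\<in>G \<tau>. Q \<tau> ui c} = (\<Prod>ui\<in>G \<tau>. measure_pmf.prob ?M {c. Q \<tau> ui c})"
      unfolding uniform_colouring_def
    proof (rule prob_Pi_pmf_blocks[where B = Bl, OF A(1) finG])
      show "disjoint_family_on Bl (G \<tau>)"
        unfolding disjoint_family_on_def
      proof (intro ballI impI)
        fix ui ui' assume ui: "ui \<in> G \<tau>" "ui' \<in> G \<tau>" "ui \<noteq> ui'"
        obtain u i u' i' where e: "ui = (u, i)" "ui' = (u', i')" by (cases ui, cases ui')
        have m: "u \<in> U" "u' \<in> U" "i < m" "i' < m" using ui G unfolding e by auto
        show "Bl ui \<inter> Bl ui' = {}"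
        proof (rule ccontr)
          assume "Bl ui \<inter> Bl ui' \<noteq> {}"
          then obtain l l' where l: "l \<in> {3 * i, 3 * i + 1}" "l' \<in> {3 * i', 3 * i' + 1}" "{u, P ! l} = {u', P ! l'}"
            unfolding e Bl_def by auto
          then have "l < 3 * m" "l' < 3 * m" using m by auto
          then have "l = l'" "u = u'" using eq[OF l(3) m(1,2)] equ[OF l(3) m(1,2)] by auto
          moreover have "i = i'" using l(1,2) \<open>l = l'\<close> by auto
          ultimately show False using ui(3) e by simp
        qed
      qed
      show "Bl ui \<subseteq> A" if "ui \<in> G \<tau>" for ui using that G by (cases ui) (auto simp: Bl_def)
      show "Q \<tau> ui f = Q \<tau> ui g" if "ui \<in> G \<tau>" "\<forall>x\<in>Bl ui. f x = g x" for ui f g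
        using that by (cases ui) (simp add: \<tau> Q_def Bl_def)
    qed
    also have "\<dots> \<le> (\<Prod>ui\<in>G \<tau>. 1 - ?x)"
    proof (rule prod_mono)
      fix ui assume ui: "ui \<in> G \<tau>"
      obtain u i where e: "ui = (u, i)" by (cases ui)
      let ?F = "{c. c {u, P ! (3 * i)} \<in> D1 \<and> c {u, P ! (3 * i + 1)} \<in> D2}"
      have "{c. Q \<tau> ui c} = - ?F" by (auto simp: e \<tau> Q_def)
      then have "measure_pmf.prob ?M {c. Q \<tau> ui c} = 1 - measure_pmf.prob ?M ?F"
        using measure_pmf.prob_compl[of ?F ?M] by (simp add: Compl_eq_Diff_UNIV)
      also have "measure_pmf.prob ?M ?F = card D1 / card Col * (card D2 / card Col)"
        using G[of u i] ui assms Col h A(1) unfolding e by (intro prob_two_edges) auto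
      also have "1 - card D1 / card Col * (card D2 / card Col) \<le> 1 - ?x"
      proof -
        have "real s / n * (real s / n) \<le> card D1 / n * (card D2 / n)"
          using h by (intro mult_mono divide_right_mono) auto
        then show ?thesis by (simp add: assms(5) power2_eq_square)
      qed
      finally show "0 \<le> measure_pmf.prob ?M {c. Q \<tau> ui c} \<and> measure_pmf.prob ?M {c. Q \<tau> ui c} \<le> 1 - ?x" by simp
    qed
    also have "\<dots> = (1 - ?x) ^ card (G \<tau>)" by simp
    also have "\<dots> \<le> (1 - ?x) ^ (t * (k - j))"
    proof (rule power_decreasing)
      have "k - j \<le> card {i \<in> I. {u, P ! (3 * i)} \<in> E \<and> {u, P ! (3 * i + 1)} \<in> E}" if "u \<in> U'" for u
      proof -
        \<comment> \<open>With \<open>z = f = u\<close>, a triple provides an edge of the path both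
          of whose ends are joined to \<open>u\<close>, namely its first one.\<close>
        have "triples E P m 0 u u - ({..<m} - I) \<subseteq> {i \<in> I. {u, P ! (3 * i)} \<in> E \<and> {u, P ! (3 * i + 1)} \<in> E}"
          by (auto simp: triples_def insert_commute)
        then have "card (triples E P m 0 u u - ({..<m} - I)) \<le> card {i \<in> I. {u, P ! (3 * i)} \<in> E \<and> {u, P ! (3 * i + 1)} \<in> E}"
          using fin by (intro card_mono) auto
        moreover have "card (triples E P m 0 u u) - card ({..<m} - I) \<le> card (triples E P m 0 u u - ({..<m} - I))"
          by (rule diff_card_le_card_Diff) simp
        moreover have "card ({..<m} - I) \<le> j" using h fin by (subst card_Diff_subset) auto
        ultimately show ?thesis using k[of u] that h by (meson diff_le_mono diff_le_mono2 order_trans subsetD)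
      qed
      then have "(\<Sum>u\<in>U'. k - j) \<le> (\<Sum>u\<in>U'. card {i \<in> I. {u, P ! (3 * i)} \<in> E \<and> {u, P ! (3 * i + 1)} \<in> E})"
        by (rule sum_mono)
      also have "\<dots> = card (G \<tau>)"
        unfolding \<tau> G_def prod.case using fin by (subst card_SigmaI) auto
      finally have G_ge: "card U' * (k - j) \<le> card (G \<tau>)" by simp
      have "t * (k - j) \<le> card U' * (k - j)" using h by (intro mult_right_mono) auto
      also note G_ge
      finally show "t * (k - j) \<le> card (G \<tau>)" .
    qed (use x in auto)
    finally show ?thesis .
  qed
  have "measure_pmf.prob ?M {c. \<not> insertable E P m U Col s t j c} \<le> measure_pmf.prob ?M (\<Union>\<tau>\<in>T. {c. \<forall>ui\<in>G \<tau>. Q \<tau> ui c})"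
    by (rule measure_pmf.finite_measure_mono[OF sub]) simp
  also have "\<dots> \<le> (\<Sum>\<tau>\<in>T. measure_pmf.prob ?M {c. \<forall>ui\<in>G \<tau>. Q \<tau> ui c})"
    using finT by (intro measure_pmf.finite_measure_subadditive_finite) auto
  also have "\<dots> \<le> real (card T) * (1 - ?x) ^ (t * (k - j))"
    using sum_mono[OF each] by simp
  also have "\<dots> \<le> 16 ^ n * (1 - ?x) ^ (t * (k - j))"
    using x by (intro mult_right_mono[OF cT]) auto
  finally show ?thesis .
qed

text \<open>Greedy insertion while at least \<open>t\<close> vertices remain. The path has fewer
  edges than vertices, so at least as many colours as vertices are left, and
  \<open>2 * s \<le> t\<close> allows splitting them into two sets of size at least
  \<open>s\<close>. Each insertion breaks a single path edge in the first block, so at most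
  \<open>j\<close> indices are lost and the later positions stay intact.\<close>

lemma insert_remaining_vertices:
  fixes P :: "'v list" and c c' :: "'v set \<Rightarrow> 'c"
  assumes "finite V" "finite Col" "card Col = card V" and P: "rainbow_path V Col R c P" "3 * m < length P"
    and U: "U = V - set P" "card U \<le> j" and ER: "E \<inter> R = {}"
    and ins: "insertable E P m U Col s t j c'" and c': "\<And>e. e \<in> E \<Longrightarrow> c' e \<in> Col" and t: "2 * s \<le> t" "0 < t"
  defines "C \<equiv> \<lambda>e. if e \<in> R then c e else c' e"
  obtains q where "distinct q" "set P \<subseteq> set q" "set q \<subseteq> V" "card (V - set q) < t" "hd q = hd P" "last q = last P"
    "path_edges q \<subseteq> R \<union> {e \<in> E. \<exists>u\<in>U. \<exists>i<3 * m. e = {u, P ! i}}" "inj_on C (path_edges q)" "C ` path_edges q \<subseteq> Col"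
    "\<And>i. 3 * m \<le> i \<Longrightarrow> Suc i < length P \<Longrightarrow> {P ! i, P ! Suc i} \<in> path_edges q"
proof -
  let ?A = "{e \<in> E. \<exists>u\<in>U. \<exists>i<3 * m. e = {u, P ! i}}"
  \<comment> \<open>The indices in \<open>I\<close> have their first edge still on the path. The
    inequality between cardinalities says that an inserted vertex costs at most one index.\<close>
  define Inv where "Inv q I \<longleftrightarrow> distinct q \<and> set P \<subseteq> set q \<and> set q \<subseteq> V \<and> q \<noteq> [] \<and> hd q = hd P \<and> last q = last P \<and>
    path_edges q \<subseteq> R \<union> ?A \<and> inj_on C (path_edges q) \<and> C ` path_edges q \<subseteq> Col \<and> I \<subseteq> {..<m} \<and>
    m + card (V - set q) \<le> card I + card U \<and>
    (\<forall>i\<in>I. {P ! (3 * i), P ! Suc (3 * i)} \<in> path_edges q) \<and>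
    (\<forall>i. 3 * m \<le> i \<longrightarrow> Suc i < length P \<longrightarrow> {P ! i, P ! Suc i} \<in> path_edges q)" for q I
  have Pd: "distinct P" "set P \<subseteq> V" "path_edges P \<subseteq> R" "inj_on c (path_edges P)" "c ` path_edges P \<subseteq> Col"
    using P by (auto simp: rainbow_path_def)
  have consec: "{P ! i, P ! Suc i} \<in> path_edges P" if "Suc i < length P" for i
  proof -
    have "P = take i P @ P ! i # P ! Suc i # drop (Suc (Suc i)) P"
      using that by (metis Cons_nth_drop_Suc Suc_lessD append_take_drop_id)
    then show ?thesis unfolding path_edges_iff by blast
  qed
  \<comment> \<open>After \<open>r\<close> rounds either the aim is reached or \<open>r\<close>
    vertices have been inserted. So \<open>card U\<close> rounds suffice.\<close>
  have "\<exists>q I. Inv q I \<and> (card (V - set q) < t \<or> card (V - set q) + r \<le> card U)" for r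
  proof (induction r)
    case 0
    have "C e = c e" if "e \<in> path_edges P" for e using that Pd by (auto simp: C_def)
    then have "inj_on C (path_edges P)" "C ` path_edges P \<subseteq> Col"
      using Pd by (auto simp: inj_on_def)
    then have "Inv P {..<m}"
      using Pd consec P(2) U(1) unfolding Inv_def by auto
    then show ?case using U(1) by (intro exI[of _ P] exI[of _ "{..<m}"]) simp
  next
    case (Suc r)
    then obtain q I where inv: "Inv q I" and r: "card (V - set q) < t \<or> card (V - set q) + r \<le> card U" by blast
    show ?case
    proof (cases "card (V - set q) < t")
      case True
      then show ?thesis using inv by blast
    next
      case False
      note i = inv[unfolded Inv_def]
      let ?U' = "V - set q"
      have U'U: "?U' \<subseteq> U" using i U by auto
      define D where "D = Col - C ` path_edges q"
      have "card (set q) = length q" using i by (simp add: distinct_card)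
      moreover have "card ?U' = card V - card (set q)" using i by (intro card_Diff_subset) auto
      moreover have "card (set q) \<le> card V" using i assms(1) by (intro card_mono) auto
      moreover have "card D = card Col - card (path_edges q)"
        unfolding D_def using i by (subst card_Diff_subset) (auto simp: card_image)
      ultimately have cD: "card ?U' \<le> card D"
        using card_path_edges[of q] i assms(3) by simp
      then have "s \<le> card D" using False t by linarith
      then obtain D1 where D1: "D1 \<subseteq> D" "card D1 = s" "finite D1"
        by (metis obtain_subset_with_card_n)
      have D2: "s \<le> card (D - D1)" using D1 cD False t by (subst card_Diff_subset) auto
      have I: "m \<le> card I + j" using i U(2) by linarith
      obtain u l where ul: "u \<in> ?U'" "l \<in> I" "{u, P ! (3 * l)} \<in> E" "{u, P ! (3 * l + 1)} \<in> E"
        "c' {u, P ! (3 * l)} \<in> D1" "c' {u, P ! (3 * l + 1)} \<in> D - D1"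
        using ins[unfolded insertable_def, rule_format, of ?U' I D1 "D - D1"] U'U False I i D1 D2
        unfolding D_def by (auto simp: not_less)
      have lm: "l < m" using ul(2) i by auto
      have "{P ! (3 * l), P ! Suc (3 * l)} \<in> path_edges q" using i ul(2) by blast
      then obtain xs x y ys where q: "q = xs @ x # y # ys" and xy: "{P ! (3 * l), P ! Suc (3 * l)} = {x, y}"
        unfolding path_edges_iff by blast
      define q' where "q' = xs @ x # u # y # ys"
      have pe: "path_edges q' = insert {x, u} (insert {u, y} (path_edges q - {{x, y}}))"
        unfolding q'_def q by (rule path_edges_insert) (use i q in simp)
      let ?e1 = "{u, P ! (3 * l)}" and ?e2 = "{u, P ! (3 * l + 1)}"
      have pe': "path_edges q' = insert ?e1 (insert ?e2 (path_edges q - {{x, y}}))"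
        unfolding pe using xy by (auto simp: doubleton_eq_iff insert_commute)
      have C12: "C ?e1 \<in> D1" "C ?e2 \<in> D - D1" using ul ER by (auto simp: C_def)
      have d': "distinct q'" "set q' = insert u (set q)" using i ul(1) unfolding q'_def q by auto
      have U'': "V - set q' = ?U' - {u}" using d'(2) by auto
      have cU'': "card (V - set q') = card ?U' - 1" "card ?U' > 0"
        unfolding U'' using ul(1) assms(1) by (auto simp: card_gt_0_iff)
      have C1: "C ?e1 \<in> D" "C ?e1 \<noteq> C ?e2" "C ?e2 \<in> D" using C12 D1 by auto
      have "inj_on C (path_edges q - {{x, y}})" using i by (auto intro: inj_on_subset)
      moreover have "C ?e2 \<notin> C ` (path_edges q - {{x, y}})" "C ?e1 \<notin> C ` (path_edges q - {{x, y}})"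
        using C1 by (auto simp: D_def)
      ultimately have inj': "inj_on C (path_edges q')"
        unfolding pe' using C1(2) by (auto simp: inj_on_insert)
      have keep: "{P ! a, P ! Suc a} \<in> path_edges q'" if "{P ! a, P ! Suc a} \<in> path_edges q" "a \<noteq> 3 * l" "Suc a < length P" for a
      proof -
        have "{P ! a, P ! Suc a} \<noteq> {x, y}"
        proof
          assume "{P ! a, P ! Suc a} = {x, y}"
          then have e: "{P ! a, P ! Suc a} = {P ! (3 * l), P ! Suc (3 * l)}" using xy by simp
          have "3 * l < length P" "Suc (3 * l) < length P" "a < length P" using lm P(2) that by auto
          then show False using e that nth_eq_iff_index_eq[OF Pd(1)] by (auto simp: doubleton_eq_iff)
        qed
        then show ?thesis using that(1) unfolding pe' by auto
      qed
      have "Inv q' (I - {l})"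
        unfolding Inv_def
      proof (intro conjI)
        show "distinct q'" by (rule d')
        show "set P \<subseteq> set q'" "set q' \<subseteq> V" using d' i ul(1) by auto
        show "q' \<noteq> []" by (simp add: q'_def)
        show "hd q' = hd P" "last q' = last P" using i unfolding q'_def q by (auto simp: hd_append)
        have "?e1 \<in> ?A"
          using ul U'U lm by (intro CollectI conjI bexI[of _ u] exI[of _ "3 * l"]) auto
        moreover have "?e2 \<in> ?A"
          using ul U'U lm by (intro CollectI conjI bexI[of _ u] exI[of _ "3 * l + 1"]) auto
        ultimately show "path_edges q' \<subseteq> R \<union> ?A" unfolding pe' using i by blast
        show "inj_on C (path_edges q')" by (rule inj')
        show "C ` path_edges q' \<subseteq> Col" unfolding pe' using i C1 by (auto simp: D_def)
        show "I - {l} \<subseteq> {..<m}" using i by auto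
        have "finite I" using i by (auto intro: finite_subset)
        then show "m + card (V - set q') \<le> card (I - {l}) + card U"
          using i cU'' ul(2) card_gt_0_iff[of I] by (auto simp: card_Diff_singleton)
        show "\<forall>i\<in>I - {l}. {P ! (3 * i), P ! Suc (3 * i)} \<in> path_edges q'"
        proof
          fix a assume a: "a \<in> I - {l}"
          then have "a < m" using i by auto
          then show "{P ! (3 * a), P ! Suc (3 * a)} \<in> path_edges q'"
            using a i P(2) by (intro keep) auto
        qed
        show "\<forall>i. 3 * m \<le> i \<longrightarrow> Suc i < length P \<longrightarrow> {P ! i, P ! Suc i} \<in> path_edges q'"
          using i lm by (auto intro!: keep)
      qed
      then show ?thesis using r False cU'' by (intro exI[of _ q'] exI[of _ "I - {l}"]) auto
    qed
  qed
  from this[of "card U"] obtain q I where "Inv q I" "card (V - set q) < t" using t(2) by auto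
  then show ?thesis using that unfolding Inv_def by blast
qed

subsection \<open>Completing a rainbow path\<close>

lemma uniform_colouring_union:
  assumes "finite A" "finite B" "A \<inter> B = {}"
  shows "uniform_colouring Col (A \<union> B) =
    bind_pmf (uniform_colouring Col A) (\<lambda>f. map_pmf (\<lambda>g x. if x \<in> A then f x else g x) (uniform_colouring Col B))"
  unfolding uniform_colouring_def Pi_pmf_union[OF assms]
  by (simp add: pair_pmf_def map_bind_pmf map_pmf_def bind_assoc_pmf bind_return_pmf)

lemma set_uniform_colouring:
  assumes "finite A" "finite Col" "Col \<noteq> {}" "c \<in> set_pmf (uniform_colouring Col A)" "e \<in> A"
  shows "c e \<in> Col"
  using assms by (auto simp: uniform_colouring_def set_Pi_pmf PiE_dflt_def)

text \<open>The random edges are revealed first with their colours, including those that also lie in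
  \<open>E0\<close>. The colours on \<open>E0 - R\<close> remain fresh.\<close>

lemma coloured_perturbed_graph_split:
  assumes "finite V" "E0 \<subseteq> nsets V 2"
  shows "coloured_perturbed_graph V E0 p Col =
    bind_pmf (coloured_perturbed_graph V {} p Col)
      (\<lambda>(R, c). map_pmf (\<lambda>c' . (E0 \<union> R, \<lambda>e. if e \<in> R then c e else c' e)) (uniform_colouring Col (E0 - R)))"
proof -
  have fin: "finite (nsets V 2)" using assms(1) by (rule finite_imp_finite_nsets)
  have "uniform_colouring Col (E0 \<union> R) = bind_pmf (uniform_colouring Col R)
      (\<lambda>f. map_pmf (\<lambda>g x. if x \<in> R then f x else g x) (uniform_colouring Col (E0 - R)))"
    if "R \<in> set_pmf (binomial_graph V p)" for R
  proof -
    have "R \<subseteq> nsets V 2" using that by (auto simp: binomial_graph_def)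
    then have "finite R" "finite (E0 - R)" using fin assms(2) finite_subset by blast+
    moreover have "E0 \<union> R = R \<union> (E0 - R)" by auto
    ultimately show ?thesis using uniform_colouring_union[of R "E0 - R" Col] by auto
  qed
  then show ?thesis
    unfolding coloured_perturbed_graph_def
    by (simp add: bind_assoc_pmf bind_map_pmf map_bind_pmf map_pmf_comp comp_def cong: bind_pmf_cong)
qed

text \<open>The fresh dense edges are split by whether they meet the second block. Those that do not
  are coloured first and used for insertion; the second moment argument then runs conditionally on
  their colours.\<close>

lemma prob_complete_rainbow_path:
  fixes V :: "'v set" and Col :: "'c set" and B \<theta> \<rho> :: real
  assumes V: "finite V" "card V = n" "3 \<le> n" and Col: "finite Col" "card Col = n"
    and E0: "E0 \<subseteq> nsets V 2" and R: "R \<subseteq> nsets V 2"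
    and P: "rainbow_path V Col R c P" "n \<le> length P + 2 * k" "well_placed (E0 - R) V m w P"
    and num: "0 < m" "6 * m + 2 * k < n" "2 * s \<le> t" "0 < t" "s \<le> n" "0 < l" "0 < K" "K + l + t \<le> w"
    and B: "1 \<le> B" "exp 1 * real n / real l \<le> B"
    and \<theta>: "0 \<le> \<theta>" "B * (1 + \<theta>) / K \<le> \<theta>"
    and \<rho>: "0 \<le> \<rho>" "(1 + 2 * B\<^sup>2 / K) ^ t * (1 + \<theta> * real (l + t) / K) ^ l * (1 + \<theta>) \<le> 1 + \<rho>"
  shows "measure_pmf.prob (uniform_colouring Col (E0 - R))
      {c'. \<exists>H. hamilton_cycle V (E0 \<union> R) H \<and> rainbow (\<lambda>e. if e \<in> R then c e else c' e) H}
    \<ge> 1 - 16 ^ n * (1 - (real s / real n)\<^sup>2) ^ (t * (w - 2 * k)) - \<rho>"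
proof -
  define E where "E = E0 - R"
  define D where "D = {e \<in> E. \<exists>i. 3 * m \<le> i \<and> i < 6 * m \<and> P ! i \<in> e}"
  define U where "U = V - set P"
  have Pd: "distinct P" "set P \<subseteq> V" "path_edges P \<subseteq> R"
    using P(1) by (auto simp: rainbow_path_def)
  have lenP: "6 * m < length P" using P(2) num by linarith
  have fin: "finite E" "finite D" "finite (E - D)"
    using E0 V(1) finite_subset[OF E0] finite_imp_finite_nsets[OF V(1)] by (auto simp: E_def D_def)
  have Col0: "Col \<noteq> {}" using V Col by auto
  have cU: "card U \<le> 2 * k"
    using P(2) V Pd by (simp add: U_def card_Diff_subset distinct_card)
  have m_n: "m \<le> n" using num by linarith
  \<comment> \<open>An insertion edge joins a vertex off the path to the first block, so it contains
    no position of the second.\<close>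
  have nD: "{u, P ! i} \<notin> D" if "u \<in> U" "i < 3 * m" for u i
  proof
    assume "{u, P ! i} \<in> D"
    then obtain i' where i': "3 * m \<le> i'" "i' < 6 * m" "P ! i' \<in> {u, P ! i}" by (auto simp: D_def)
    have "P ! i' \<in> set P" "u \<notin> set P" using i'(2) lenP that by (auto simp: U_def)
    then have "P ! i' = P ! i" using i' by auto
    then show False using i' that lenP nth_eq_iff_index_eq[OF Pd(1), of i' i] by auto
  qed
  let ?e = "16 ^ n * (1 - (real s / real n)\<^sup>2) ^ (t * (w - 2 * k))"
  have "measure_pmf.prob (uniform_colouring Col (E - D)) {c'. \<not> insertable E P m U Col s t (2 * k) c'} \<le> ?e"
  proof (rule prob_not_insertable[OF V(1,2) _ Col Pd(1,2) _ U_def fin(3)])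
    show "w \<le> card (triples E P m 0 u u)" if "u \<in> U" for u
      using that P(3) by (auto simp: well_placed_def E_def U_def)
    show "{u, P ! i} \<in> E - D" if "u \<in> U" "i < 3 * m" "{u, P ! i} \<in> E" for u i
      using nD that by auto
  qed (use V num lenP m_n in auto)
  moreover have "measure_pmf.prob (uniform_colouring Col (E - D)) {c'. insertable E P m U Col s t (2 * k) c'} =
      1 - measure_pmf.prob (uniform_colouring Col (E - D)) {c'. \<not> insertable E P m U Col s t (2 * k) c'}"
    using measure_pmf.prob_compl[of "{c'. \<not> insertable E P m U Col s t (2 * k) c'}" "uniform_colouring Col (E - D)"]
    by (simp add: Compl_eq_Diff_UNIV[symmetric] Collect_neg_eq[symmetric])
  ultimately have two: "measure_pmf.prob (uniform_colouring Col (E - D)) {c'. insertable E P m U Col s t (2 * k) c'} \<ge> 1 - ?e"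
    by simp
  let ?S = "{c'. \<exists>H. hamilton_cycle V (E0 \<union> R) H \<and> rainbow (\<lambda>e. if e \<in> R then c e else c' e) H}"
  have "measure_pmf.prob (bind_pmf (uniform_colouring Col (E - D))
      (\<lambda>f. map_pmf (\<lambda>g x. if x \<in> E - D then f x else g x) (uniform_colouring Col D))) ?S \<ge> 1 - ?e - \<rho>"
  proof (rule prob_bind_pmf_ge[OF two \<rho>(1)])
    fix f assume ins: "f \<in> {c'. insertable E P m U Col s t (2 * k) c'}" and f: "f \<in> set_pmf (uniform_colouring Col (E - D))"
    \<comment> \<open>\<open>insert_remaining_vertices\<close> expects colours in \<open>Col\<close>
      on all of \<open>E\<close>. On the unrevealed part \<open>D\<close> an arbitrary colour is
      filled in, which touches no insertion edge.\<close>
    define f' where "f' e = (if e \<in> E - D then f e else (SOME x. x \<in> Col))" for e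
    have f': "f' e \<in> Col" for e
      using set_uniform_colouring[OF fin(3) Col(1) Col0 f] Col0 by (auto simp: f'_def some_in_eq)
    have ins': "insertable E P m U Col s t (2 * k) f'"
    proof -
      have "f' {u, P ! i} = f {u, P ! i}" if "u \<in> U" "i < 3 * m" "{u, P ! i} \<in> E" for u i
        using nD that by (auto simp: f'_def)
      note eq = this
      show ?thesis
        unfolding insertable_def
      proof (intro allI impI)
        fix U' I D1 D2 assume h: "U' \<subseteq> U" "t \<le> card U'" "I \<subseteq> {..<m}" "m \<le> card I + 2 * k" "D1 \<subseteq> Col" "D2 \<subseteq> Col" "s \<le> card D1" "s \<le> card D2"
        obtain u i where ui: "u \<in> U'" "i \<in> I" "{u, P ! (3 * i)} \<in> E" "{u, P ! (3 * i + 1)} \<in> E"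
            "f {u, P ! (3 * i)} \<in> D1" "f {u, P ! (3 * i + 1)} \<in> D2"
          using ins h unfolding insertable_def by blast
        moreover have "i < m" "u \<in> U" using ui h by auto
        ultimately show "\<exists>u\<in>U'. \<exists>i\<in>I. {u, P ! (3 * i)} \<in> E \<and> {u, P ! (3 * i + 1)} \<in> E \<and>
           f' {u, P ! (3 * i)} \<in> D1 \<and> f' {u, P ! (3 * i + 1)} \<in> D2"
          by (intro bexI[of _ u] bexI[of _ i]) (auto simp: eq)
      qed
    qed
    define c0 where "c0 e = (if e \<in> R then c e else f' e)" for e
    have c0_eq: "c0 = (\<lambda>e. if e \<in> R then c e else f' e)" by (simp add: c0_def fun_eq_iff)
    obtain q where q: "distinct q" "set P \<subseteq> set q" "set q \<subseteq> V" "card (V - set q) < t" "hd q = hd P" "last q = last P"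
      "path_edges q \<subseteq> R \<union> {e \<in> E. \<exists>u\<in>U. \<exists>i<3 * m. e = {u, P ! i}}" "inj_on c0 (path_edges q)" "c0 ` path_edges q \<subseteq> Col"
      "\<And>i. 3 * m \<le> i \<Longrightarrow> Suc i < length P \<Longrightarrow> {P ! i, P ! Suc i} \<in> path_edges q"
    proof (rule insert_remaining_vertices[OF V(1) Col(1) _ P(1) _ U_def cU _ ins' _ num(3,4)])
      show "card Col = card V" "3 * m < length P" using V Col lenP by auto
      show "E \<inter> R = {}" by (auto simp: E_def)
    qed (use f' that in \<open>auto simp: c0_eq\<close>)
    obtain us where us: "set us = V - set q" "distinct us"
      using finite_distinct_list[of "V - set q"] V(1) by auto
    have lus: "length us + 1 \<le> t" using q(4) us by (metis Suc_eq_plus1 Suc_leI distinct_card)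
    define F where "F = l + length us + 1"
    define a where "a i = P ! (3 * m + 3 * i)" for i
    define b where "b i = P ! (3 * m + 3 * i + 1)" for i
    define d where "d i = P ! (3 * m + 3 * i + 2)" for i
    have idx: "P ! i = P ! i' \<longleftrightarrow> i = i'" if "i < length P" "i' < length P" for i i'
      using nth_eq_iff_index_eq[OF Pd(1)] that by blast
    have bound: "3 * m + 3 * i + 2 < length P" if "i < m" for i using that lenP by linarith
    have "P \<noteq> []" using lenP by auto
    then have hdlast: "hd q = P ! 0" "last q = P ! (length P - 1)"
      using q(5,6) by (auto simp: hd_conv_nth last_conv_nth)
    have DE: "{z, P ! i} \<in> D" if "{z, P ! i} \<in> E" "3 * m \<le> i" "i < 6 * m" for z i
      using that by (auto simp: D_def)
    interpret rotation_walk V q us a b d m F K D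
    proof
      show "q \<noteq> []" using q(2) lenP by auto
      show "distinct (q @ us)" "set q \<union> set us = V" using q us by auto
      show "{a i, b i} \<in> path_edges q" "{b i, d i} \<in> path_edges q" if "i < m" for i
        using q(10)[of "3 * m + 3 * i"] q(10)[of "3 * m + 3 * i + 1"] bound[OF that] by (auto simp: a_def b_def d_def)
      show "inj_on b {..<m}"
      proof (rule inj_onI)
        fix i j assume "i \<in> {..<m}" "j \<in> {..<m}" "b i = b j"
        then show "i = j" using bound[of i] bound[of j] by (simp add: b_def idx)
      qed
      show "a i \<noteq> d i" if "i < m" for i using bound[OF that] by (auto simp: a_def d_def idx)
      show "{a i, d i} \<inter> {a j, d j} = {}" if "i < m" "j < m" "i \<noteq> j" for i j
        using bound[OF that(1)] bound[OF that(2)] that(3) by (auto simp: a_def d_def idx)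
      show "b i \<notin> {a j, d j}" if "i < m" "j < m" for i j
        using bound[OF that(1)] bound[OF that(2)] by (auto simp: a_def b_def d_def idx; presburger)
      \<comment> \<open>Position 0 lies before the second block since \<open>0 < m\<close>, and the
        last position behind it since \<open>6 * m < length P\<close>.\<close>
      show "hd q \<notin> {a i, b i, d i}" "last q \<notin> {a i, b i, d i}" if "i < m" for i
        using idx[of 0 "3 * m + 3 * i"] idx[of 0 "3 * m + 3 * i + 1"] idx[of 0 "3 * m + 3 * i + 2"]
          idx[of "length P - 1" "3 * m + 3 * i"] idx[of "length P - 1" "3 * m + 3 * i + 1"]
          idx[of "length P - 1" "3 * m + 3 * i + 2"] that lenP \<open>P \<noteq> []\<close>
        unfolding hdlast a_def b_def d_def by auto
      show "hd q \<noteq> last q" unfolding hdlast using lenP num(1) by (subst idx) auto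
      show "D \<subseteq> nsets V 2" using E0 by (auto simp: D_def E_def)
      show "0 < K" by (rule num)
      show "K + F \<le> card {i. i < m \<and> {z, a i} \<in> D \<and> {z, d i} \<in> D \<and> {b i, f} \<in> D}" if zf: "z \<in> V" "f \<in> V" for z f
      proof -
        have "K + F \<le> w" using num lus by (simp add: F_def)
        also have "\<dots> \<le> card (triples E P m (3 * m) z f)"
          using P(3) zf by (simp add: well_placed_def E_def)
        also have "\<dots> \<le> card {i. i < m \<and> {z, a i} \<in> D \<and> {z, d i} \<in> D \<and> {b i, f} \<in> D}"
        proof (rule card_mono)
          show "triples E P m (3 * m) z f \<subseteq> {i. i < m \<and> {z, a i} \<in> D \<and> {z, d i} \<in> D \<and> {b i, f} \<in> D}"
          proof
            fix i assume i: "i \<in> triples E P m (3 * m) z f"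
            then have "i < m" by (simp add: triples_def)
            then show "i \<in> {i. i < m \<and> {z, a i} \<in> D \<and> {z, d i} \<in> D \<and> {b i, f} \<in> D}"
              using i DE[of f "3 * m + 3 * i + 1"]
              by (auto simp: triples_def a_def b_def d_def insert_commute intro!: DE)
          qed
        qed simp
        finally show ?thesis .
      qed
    qed
    have "1 - \<rho> \<le> measure_pmf.prob (uniform_colouring Col D)
      {g. \<exists>w. distinct w \<and> set w = V \<and> cycle_edges w \<subseteq> path_edges q \<union> D \<and>
        inj_on (\<lambda>e. if e \<in> D then g e else c0 e) (cycle_edges w)}"
    proof (rule prob_rainbow_hamilton_cycle[OF V(1) Col(1) _ q(8,9) _ F_def refl B(1) _ \<theta>])
      show "card Col = card V" using V Col by simp
      show "path_edges q \<inter> D = {}"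
      proof -
        have "R \<inter> D = {}" by (auto simp: D_def E_def)
        moreover have "{e \<in> E. \<exists>u\<in>U. \<exists>i<3 * m. e = {u, P ! i}} \<inter> D = {}" using nD by auto
        ultimately show ?thesis using q(7) by blast
      qed
      \<comment> \<open>The number of new edges depends on how many vertices remain, so it is
        replaced by its lower bound \<open>l\<close>.\<close>
      have "exp 1 * real n / real (l + 2 * (length us + 1)) \<le> exp 1 * real n / real l"
        using num(6) by (intro divide_left_mono) auto
      then show "exp 1 * real (card V) / real (l + 2 * (length us + 1)) \<le> B" using B(2) V(2) by simp
      have pos: "0 \<le> 2 * B\<^sup>2 / K" "0 \<le> \<theta> * real F / K" using \<theta>(1) by auto
      have "\<theta> * real F / K \<le> \<theta> * real (l + t) / K"
        using lus \<theta>(1) by (intro divide_right_mono mult_left_mono) (auto simp: F_def)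
      then have "(1 + 2 * B\<^sup>2 / K) ^ (length us + 1) * (1 + \<theta> * F / K) ^ l * (1 + \<theta>) \<le>
          (1 + 2 * B\<^sup>2 / K) ^ t * (1 + \<theta> * real (l + t) / K) ^ l * (1 + \<theta>)"
      proof (intro mult_right_mono mult_mono)
        show "(1 + 2 * B\<^sup>2 / K) ^ (length us + 1) \<le> (1 + 2 * B\<^sup>2 / K) ^ t"
          using lus pos(1) by (intro power_increasing) linarith+
        show "(1 + \<theta> * F / K) ^ l \<le> (1 + \<theta> * real (l + t) / K) ^ l"
          if "\<theta> * real F / K \<le> \<theta> * real (l + t) / K"
          using that pos(2) by (intro power_mono) linarith+
        show "0 \<le> (1 + 2 * B\<^sup>2 / K) ^ t"
          using pos(1) by (intro zero_le_power) linarith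
        show "0 \<le> (1 + \<theta> * F / K) ^ l"
          using pos(2) by (intro zero_le_power) linarith
        show "0 \<le> 1 + \<theta>" using \<theta>(1) by linarith
      qed
      then show "(1 + 2 * B\<^sup>2 / K) ^ (length us + 1) * (1 + \<theta> * F / K) ^ l * (1 + \<theta>) \<le> 1 + \<rho>"
        using \<rho>(2) by linarith
    qed
    also have "\<dots> \<le> measure_pmf.prob (map_pmf (\<lambda>g x. if x \<in> E - D then f x else g x) (uniform_colouring Col D)) ?S"
      unfolding measure_map_pmf
    proof (rule measure_pmf.finite_measure_mono)
      show "{g. \<exists>w. distinct w \<and> set w = V \<and> cycle_edges w \<subseteq> path_edges q \<union> D \<and>
        inj_on (\<lambda>e. if e \<in> D then g e else c0 e) (cycle_edges w)} \<subseteq>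
        (\<lambda>g x. if x \<in> E - D then f x else g x) -` ?S"
      proof
        fix g assume "g \<in> {g. \<exists>w. distinct w \<and> set w = V \<and> cycle_edges w \<subseteq> path_edges q \<union> D \<and>
          inj_on (\<lambda>e. if e \<in> D then g e else c0 e) (cycle_edges w)}"
        then obtain w where w: "distinct w" "set w = V" "cycle_edges w \<subseteq> path_edges q \<union> D"
          "inj_on (\<lambda>e. if e \<in> D then g e else c0 e) (cycle_edges w)" by auto
        have "path_edges q \<union> D \<subseteq> R \<union> E" using q(7) by (auto simp: D_def)
        then have sub: "cycle_edges w \<subseteq> R \<union> E" using w(3) by blast
        have "length w \<ge> 3" using w V by (metis distinct_card)
        then have "hamilton_cycle V (E0 \<union> R) (cycle_edges w)"
          using w sub unfolding hamilton_cycle_def by (intro exI[of _ w]) (auto simp: E_def)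
        moreover have "(if e \<in> R then c e else if e \<in> E - D then f e else g e) = (if e \<in> D then g e else c0 e)"
          if "e \<in> cycle_edges w" for e
          using that sub by (auto simp: c0_def f'_def E_def D_def)
        then have "inj_on (\<lambda>e. if e \<in> R then c e else if e \<in> E - D then f e else g e) (cycle_edges w)"
          using w(4) by (simp cong: inj_on_cong)
        ultimately show "g \<in> (\<lambda>g x. if x \<in> E - D then f x else g x) -` ?S"
          unfolding vimage_eq mem_Collect_eq rainbow_def by blast
      qed
    qed simp
    finally show "1 - \<rho> \<le> measure_pmf.prob (map_pmf (\<lambda>g x. if x \<in> E - D then f x else g x) (uniform_colouring Col D)) ?S" .
  qed
  also have "bind_pmf (uniform_colouring Col (E - D))
      (\<lambda>f. map_pmf (\<lambda>g x. if x \<in> E - D then f x else g x) (uniform_colouring Col D)) = uniform_colouring Col E"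
    using uniform_colouring_union[OF fin(3,2), of Col] by (auto simp: D_def Un_absorb2 Int_commute intro: arg_cong)
  finally show ?thesis unfolding E_def .
qed

subsection \<open>Choice of the parameters\<close>

lemma degree_eq_card_neighbours:
  assumes "E \<subseteq> nsets V 2"
  shows "degree E z = card ({x. {z, x} \<in> E} \<inter> V)"
proof -
  have "{e \<in> E. z \<in> e} = (\<lambda>x. {z, x}) ` ({x. {z, x} \<in> E} \<inter> V)"
  proof (intro equalityI subsetI)
    fix e assume e: "e \<in> {e \<in> E. z \<in> e}"
    then have "e \<in> nsets V 2" using assms by auto
    then obtain x y where "e = {x, y}" "x \<in> V" "y \<in> V" by (auto simp: nsets_2_eq)
    moreover have "z = x \<or> z = y" using e \<open>e = {x, y}\<close> by auto
    ultimately have "e = {z, if z = x then y else x}" "(if z = x then y else x) \<in> V" by auto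
    then show "e \<in> (\<lambda>x. {z, x}) ` ({x. {z, x} \<in> E} \<inter> V)"
      using e by (intro image_eqI[of _ _ "if z = x then y else x"]) auto
  qed auto
  moreover have "inj_on (\<lambda>x. {z, x}) ({x. {z, x} \<in> E} \<inter> V)"
    by (auto simp: inj_on_def doubleton_eq_iff)
  ultimately show ?thesis by (simp add: degree_def card_image)
qed

lemma nat_floor_le: "0 \<le> x \<Longrightarrow> real (nat \<lfloor>x\<rfloor>) \<le> x"
  by linarith

lemma nat_floor_ge: "x - 1 \<le> real (nat \<lfloor>x\<rfloor>)"
  by linarith

lemma one_plus_power_le_exp:
  fixes x :: real
  assumes "0 \<le> x"
  shows "(1 + x) ^ j \<le> exp (x * real j)"
proof -
  have "(1 + x) ^ j \<le> exp x ^ j"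
    using assms exp_ge_add_one_self[of x] by (intro power_mono) auto
  then show ?thesis by (simp add: mult.commute flip: exp_of_nat_mult)
qed

text \<open>Each of the three factors receives a third of \<open>\<nu>\<close>. Their exponents are
  at most \<open>144 * \<eta>' / (\<eta>\<^sup>2 * \<kappa>)\<close>,
  \<open>96 * \<eta> / \<kappa>\<^sup>2\<close> and \<open>24 / (\<eta> * \<kappa> * n)\<close>,
  whence 432, 288 and 72. \<open>B\<close> comes from \<open>exp 1 \<le> 3\<close> and
  \<open>l \<ge> \<eta> * n / 2\<close>. The choice of \<open>\<theta>\<close> meets its condition
  once \<open>\<theta> \<le> 1\<close>, which \<open>24 / \<eta> \<le> \<kappa> * n\<close>
  ensures.\<close>

lemma overlap_parameters:
  fixes \<kappa> \<eta> \<eta>' \<nu> :: real and n :: nat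
  assumes \<kappa>: "0 < \<kappa>" "\<kappa> \<le> 1" and \<eta>: "0 < \<eta>" "\<eta> \<le> \<kappa>" "288 * \<eta> \<le> \<nu> * \<kappa>\<^sup>2"
    and \<eta>': "0 < \<eta>'" "\<eta>' \<le> \<eta>" "432 * \<eta>' \<le> \<nu> * (\<eta>\<^sup>2 * \<kappa>)"
    and n: "2 \<le> \<kappa> * n" "2 \<le> \<eta> * n" "24 / \<eta> \<le> \<kappa> * n" "72 / (\<eta> * \<kappa>) \<le> \<nu> * n"
  defines "K \<equiv> nat \<lfloor>\<kappa> * real n\<rfloor>" and "l \<equiv> nat \<lfloor>\<eta> * real n\<rfloor>" and "t \<equiv> nat \<lfloor>\<eta>' * real n\<rfloor>"
    and "B \<equiv> 6 / \<eta>"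
  defines "\<theta> \<equiv> 2 * B / real K"
  shows "0 < K" "0 < l" "1 \<le> B" "exp 1 * real n / real l \<le> B" "0 \<le> \<theta>" "B * (1 + \<theta>) / K \<le> \<theta>"
    "(1 + 2 * B\<^sup>2 / K) ^ t * (1 + \<theta> * real (l + t) / K) ^ l * (1 + \<theta>) \<le> exp \<nu>"
proof -
  have n0: "0 < real n" using n(1) \<kappa> by (cases n) auto
  have Kge: "\<kappa> * n / 2 \<le> real K" unfolding K_def using n(1) nat_floor_ge[of "\<kappa> * n"] by linarith
  have lge: "\<eta> * n / 2 \<le> real l" unfolding l_def using n(2) nat_floor_ge[of "\<eta> * n"] by linarith
  have lle: "real l \<le> \<eta> * n" unfolding l_def using \<eta> by (intro nat_floor_le) auto
  have tle: "real t \<le> \<eta>' * n" unfolding t_def using \<eta>' by (intro nat_floor_le) auto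
  have Kn: "0 < \<kappa> * n / 2" "0 < \<eta> * n / 2" using \<kappa> \<eta> n0 by auto
  then have Kpos: "0 < real K" and lpos: "0 < real l" using Kge lge by linarith+
  then show "0 < K" "0 < l" by auto
  have "\<eta> \<le> 1" using \<eta> \<kappa> by linarith
  then show B1: "1 \<le> B" unfolding B_def using \<eta>(1) by (simp add: field_simps)
  have "exp 1 * real n / real l \<le> 3 * real n / (\<eta> * n / 2)"
    using lge Kn exp_le n0 by (intro frac_le mult_right_mono) auto
  also have "\<dots> = B" using n0 \<eta>(1) by (simp add: B_def field_simps)
  finally show "exp 1 * real n / real l \<le> B" .
  show \<theta>0: "0 \<le> \<theta>" using B1 by (simp add: \<theta>_def)
  have "2 * B \<le> \<kappa> * n / 2" using n(3) by (simp add: B_def)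
  then have "\<theta> \<le> 1" using Kge Kpos by (simp add: \<theta>_def)
  then have "B * (1 + \<theta>) / K \<le> B * 2 / K" using B1 Kpos by (intro divide_right_mono mult_left_mono) auto
  then show "B * (1 + \<theta>) / K \<le> \<theta>" by (simp add: \<theta>_def mult.commute)
  have invK: "1 / real K \<le> 2 / (\<kappa> * n)"
  proof -
    have "1 / real K \<le> 1 / (\<kappa> * n / 2)" using Kge Kn by (intro divide_left_mono) auto
    then show ?thesis by simp
  qed
  have \<theta>le: "\<theta> \<le> 24 / (\<eta> * \<kappa> * n)"
  proof -
    have "\<theta> = 2 * B * (1 / real K)" by (simp add: \<theta>_def)
    also have "\<dots> \<le> 2 * B * (2 / (\<kappa> * n))" using invK B1 by (intro mult_left_mono) auto
    also have "\<dots> = 24 / (\<eta> * \<kappa> * n)" by (simp add: B_def)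
    finally show ?thesis .
  qed
  have s1: "2 * B\<^sup>2 / K * t \<le> \<nu> / 3"
  proof -
    have "2 * B\<^sup>2 / K * t = (2 * B\<^sup>2) * (1 / K) * t" by simp
    also have "\<dots> \<le> (2 * B\<^sup>2) * (2 / (\<kappa> * n)) * (\<eta>' * n)"
      using invK tle \<kappa> n0 by (intro mult_mono) auto
    also have "\<dots> = 144 * \<eta>' / (\<eta>\<^sup>2 * \<kappa>)"
      using n0 by (simp add: B_def power_divide)
    also have "\<dots> \<le> \<nu> / 3" using \<eta>'(3) \<eta>(1) \<kappa>(1) by (simp add: field_simps)
    finally show ?thesis .
  qed
  have s2: "\<theta> * real (l + t) / K * l \<le> \<nu> / 3"
  proof -
    have "\<eta>' * n \<le> \<eta> * n" using \<eta>'(2) by (intro mult_right_mono) auto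
    then have lt: "real (l + t) \<le> 2 * \<eta> * n" using lle tle by simp
    have "\<theta> * real (l + t) / K * l = \<theta> * real (l + t) * (1 / K) * l" by simp
    also have "\<dots> \<le> 24 / (\<eta> * \<kappa> * n) * (2 * \<eta> * n) * (2 / (\<kappa> * n)) * (\<eta> * n)"
      using \<theta>le lt invK lle \<theta>0 \<eta>(1) \<kappa>(1) n0 by (intro mult_mono mult_nonneg_nonneg) auto
    also have "\<dots> = 96 * \<eta> / \<kappa>\<^sup>2" using n0 \<eta>(1) by (simp add: power2_eq_square)
    also have "\<dots> \<le> \<nu> / 3" using \<eta>(3) \<kappa>(1) by (simp add: field_simps)
    finally show ?thesis .
  qed
  have s3: "\<theta> \<le> \<nu> / 3"
  proof -
    have "24 / (\<eta> * \<kappa> * n) \<le> \<nu> / 3" using n(4) n0 \<eta>(1) \<kappa>(1) by (simp add: field_simps)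
    then show ?thesis using \<theta>le by linarith
  qed
  have pos: "0 \<le> 2 * B\<^sup>2 / K" "0 \<le> \<theta> * real (l + t) / K" using \<theta>0 by auto
  have "(1 + 2 * B\<^sup>2 / K) ^ t * (1 + \<theta> * real (l + t) / K) ^ l * (1 + \<theta>) \<le>
      exp (2 * B\<^sup>2 / K * t) * exp (\<theta> * real (l + t) / K * l) * exp \<theta>"
    using pos \<theta>0 exp_ge_add_one_self[of \<theta>]
    by (intro mult_mono one_plus_power_le_exp mult_nonneg_nonneg zero_le_power add_nonneg_nonneg) auto
  also have "\<dots> = exp (2 * B\<^sup>2 / K * t + \<theta> * real (l + t) / K * l + \<theta>)"
    by (simp only: exp_add)
  also have "\<dots> \<le> exp \<nu>"
  proof -
    have "2 * B\<^sup>2 / K * t + \<theta> * real (l + t) / K * l + \<theta> \<le> \<nu>" using s1 s2 s3 by linarith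
    then show ?thesis by simp
  qed
  finally show "(1 + 2 * B\<^sup>2 / K) ^ t * (1 + \<theta> * real (l + t) / K) ^ l * (1 + \<theta>) \<le> exp \<nu>" .
qed

section \<open>Exponential estimates and limits\<close>

lemma power_exp_tendsto_0:
  fixes a A :: real
  assumes "0 < a"
  shows "(\<lambda>n. A * real n ^ j * exp (- (a * real n))) \<longlonglongrightarrow> 0"
proof -
  have "filterlim (\<lambda>n. a * real n) at_top sequentially"
    by (rule filterlim_tendsto_pos_mult_at_top[OF tendsto_const assms filterlim_real_sequentially])
  then have "(\<lambda>n. (a * real n) ^ j / exp (a * real n)) \<longlonglongrightarrow> 0"
    by (rule filterlim_compose[OF tendsto_power_div_exp_0])
  then have "(\<lambda>n. A / a ^ j * ((a * real n) ^ j / exp (a * real n))) \<longlonglongrightarrow> 0"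
    by (rule tendsto_mult_right_zero)
  then show ?thesis
    using assms by (simp add: power_mult_distrib exp_minus field_simps)
qed

lemma two_power_le_exp: "2 ^ j \<le> exp (real j)"
  using one_plus_power_le_exp[of 1 j] by simp

text \<open>Serves the union bounds over \<open>8 ^ n\<close> and \<open>16 ^ n\<close> cases. The
  factor 5 is due to \<open>2 ^ 5 = 32 = 2 * 16\<close> and \<open>2 \<le> exp 1\<close>.\<close>

lemma exp_le_half_power:
  assumes "2 ^ j \<le> (16::real)" "5 * real n \<le> x"
  shows "(2 ^ j) ^ n * exp (- x) \<le> (1/2) ^ n"
proof -
  have "(2 ^ j) ^ n * exp (- x) \<le> 16 ^ n * exp (- (5 * real n))"
    using assms by (intro mult_mono power_mono) auto
  also have "\<dots> \<le> 16 ^ n * (1 / 32 ^ n)"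
  proof (rule mult_left_mono)
    have "(32::real) ^ n = 2 ^ (5 * n)" by (simp add: power_mult)
    also have "\<dots> \<le> exp (real (5 * n))" by (rule two_power_le_exp)
    finally have "1 / exp (5 * real n) \<le> 1 / 32 ^ n" by (intro divide_left_mono) auto
    then show "exp (- (5 * real n)) \<le> 1 / 32 ^ n" by (simp add: exp_minus inverse_eq_divide)
  qed auto
  also have "\<dots> = (16 * (1 / 32)) ^ n" by (simp only: power_mult_distrib power_one_over)
  finally show ?thesis by simp
qed

lemma eventually_const_le_mult:
  fixes a b :: real
  assumes "0 < a"
  shows "\<forall>\<^sub>F n in sequentially. b \<le> a * real n"
proof -
  have "filterlim (\<lambda>n. a * real n) at_top sequentially"
    by (rule filterlim_tendsto_pos_mult_at_top[OF tendsto_const assms filterlim_real_sequentially])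
  then show ?thesis by (simp add: filterlim_at_top)
qed

text \<open>\<open>\<kappa>\<close> and \<open>C\<close> depend on \<open>\<delta>\<close> alone,
  while \<open>\<eta>\<close> and \<open>\<eta>'\<close> may depend on \<open>\<rho>\<close>. The
  unit is \<open>\<kappa> * n\<close>: all \<open>z\<close>, \<open>f\<close> keep at least
  \<open>6 * \<kappa> * n\<close> triples in each block. Rotations need
  \<open>K + l + t \<le> 3 * \<kappa> * n\<close> of them, and insertion can lose at most
  \<open>2 * k \<le> \<kappa> * n / 4\<close>.\<close>

lemma prob_rainbow_hamilton_cycle_ge:
  fixes \<delta> \<kappa> \<eta> \<eta>' \<rho> :: real and n :: nat and V :: "'v set" and Col :: "'c set" and E0 :: "'v set set"
  assumes \<delta>: "0 < \<delta>" "\<delta> < 1 / 2" and \<kappa>: "\<kappa> = \<delta> ^ 4 / 51200" and C: "C = 5 / (\<kappa> / 16) ^ 3"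
    and V: "finite V" "card V = n" and Col: "finite Col" "card Col = n"
    and E0: "E0 \<subseteq> nsets V 2" and deg: "\<And>z. z \<in> V \<Longrightarrow> \<delta> * real n \<le> real (degree E0 z)"
    and \<rho>: "0 < \<rho>"
    and \<eta>: "0 < \<eta>" "\<eta> \<le> \<kappa>" "288 * \<eta> \<le> ln (1 + \<rho>) * \<kappa>\<^sup>2"
    and \<eta>': "0 < \<eta>'" "\<eta>' \<le> \<eta>" "432 * \<eta>' \<le> ln (1 + \<rho>) * (\<eta>\<^sup>2 * \<kappa>)"
    and n: "48 \<le> \<kappa> * n" "8 \<le> \<eta>' * n" "24 / \<eta> \<le> \<kappa> * n" "72 / (\<eta> * \<kappa>) \<le> ln (1 + \<rho>) * n" "C \<le> 1 * real n"
      "5 \<le> \<eta>' ^ 3 * \<kappa> / 128 * real n"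
  shows "measure_pmf.prob (coloured_perturbed_graph V E0 (C / real n) Col)
      {(E, c). \<exists>H. hamilton_cycle V E H \<and> rainbow c H}
    \<ge> 1 - ((1/2) ^ n + exp (C + 1) * real n ^ 1 * exp (- (\<kappa> / 6 * real n)) +
        2 * real n ^ 2 * exp (- (\<kappa> * real n))) - ((1/2) ^ n + \<rho>)"
proof -
  \<comment> \<open>This is \<open>(\<delta> / 4) ^ 3 / 2\<close>, the rate in
    \<open>card_few_triples_le\<close> for \<open>g \<ge> \<delta> * n / 4\<close>. With
    \<open>\<kappa> = \<gamma> * \<delta> / 400\<close> and \<open>m \<ge> \<delta> * n / 25\<close>
    it yields \<open>8 * \<kappa> * n \<le> \<gamma> * m / 2\<close>.\<close>
  define \<gamma> where "\<gamma> = \<delta> ^ 3 / 128"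
  \<comment> \<open>\<open>m\<close> and \<open>g\<close> are chosen so that
    \<open>g + 2 + 3 * m\<close> stays below the minimum degree.\<close>
  define m where "m = nat \<lfloor>\<delta> * n / 24\<rfloor>"
  define g where "g = nat \<lfloor>\<delta> * n / 2\<rfloor>"
  \<comment> \<open>With half of \<open>\<gamma> * m\<close> as the threshold, the factor
    \<open>2 ^ k0\<close> takes away at most half of the exponent.\<close>
  define k0 where "k0 = nat \<lfloor>\<gamma> * m / 2\<rfloor>"
  \<comment> \<open>Removing the random edges then costs at most
    \<open>3 * d \<le> \<kappa> * n\<close> triples.\<close>
  define d where "d = nat \<lfloor>\<kappa> * n / 3\<rfloor>"
  define k where "k = nat \<lfloor>\<kappa> * n / 8\<rfloor>"
  define w where "w = k0 - 3 * d"
  define K where "K = nat \<lfloor>\<kappa> * real n\<rfloor>"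
  define l where "l = nat \<lfloor>\<eta> * real n\<rfloor>"
  define t where "t = nat \<lfloor>\<eta>' * real n\<rfloor>"
  define s where "s = nat \<lfloor>\<eta>' * real n / 4\<rfloor>"
  define B where "B = 6 / \<eta>"
  define \<theta> where "\<theta> = 2 * B / real K"
  have \<gamma>0: "0 < \<gamma>" using \<delta> by (simp add: \<gamma>_def)
  have \<kappa>\<gamma>: "\<kappa> = \<gamma> * \<delta> / 400" by (simp add: \<kappa> \<gamma>_def power4_eq_xxxx power3_eq_cube)
  have \<kappa>0: "0 < \<kappa>" using \<delta> by (simp add: \<kappa>)
  have "\<delta> ^ 3 \<le> 1" using \<delta> by (intro power_le_one) auto
  then have \<gamma>1: "\<gamma> \<le> 1 / 128" by (simp add: \<gamma>_def)
  have "\<gamma> * \<delta> \<le> 1 * \<delta>" using \<gamma>1 \<delta> by (intro mult_right_mono) auto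
  then have \<kappa>\<delta>: "\<kappa> \<le> \<delta> / 400" by (simp add: \<kappa>\<gamma>)
  have \<kappa>1: "\<kappa> \<le> 1 / 800" using \<kappa>\<delta> \<delta> by simp
  have n0: "0 < n" using n(1) by (cases n) auto
  have \<kappa>n: "400 * (\<kappa> * n) \<le> \<delta> * n"
    using mult_right_mono[OF \<kappa>\<delta>, of "real n"] by simp
  have \<delta>n: "19200 \<le> \<delta> * n" using \<kappa>n n(1) by linarith
  have \<delta>n2: "\<delta> * n \<le> n / 2" using mult_right_mono[of \<delta> "1/2" "real n"] \<delta> by simp
  have m: "real m \<le> \<delta> * n / 24" "\<delta> * n / 25 \<le> real m"
    unfolding m_def using \<delta>n nat_floor_le[of "\<delta> * n / 24"] nat_floor_ge[of "\<delta> * n / 24"] by linarith+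
  have g: "real g \<le> \<delta> * n / 2" "\<delta> * n / 4 \<le> real g"
    unfolding g_def using \<delta>n nat_floor_le[of "\<delta> * n / 2"] nat_floor_ge[of "\<delta> * n / 2"] by linarith+
  have gm: "8 * \<kappa> * n \<le> \<gamma> * m / 2"
    using mult_left_mono[OF m(2), of \<gamma>] \<gamma>0 by (simp add: \<kappa>\<gamma>)
  have k0: "real k0 \<le> \<gamma> * m / 2" "7 * \<kappa> * n \<le> real k0"
    unfolding k0_def using gm n(1) nat_floor_le[of "\<gamma> * m / 2"] nat_floor_ge[of "\<gamma> * m / 2"] by linarith+
  have d: "real d \<le> \<kappa> * n / 3" "\<kappa> * n / 3 - 1 \<le> real d"
    unfolding d_def using n(1) nat_floor_le[of "\<kappa> * n / 3"] nat_floor_ge[of "\<kappa> * n / 3"] by linarith+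
  have k: "real k \<le> \<kappa> * n / 8" "\<kappa> * n / 16 \<le> real k"
    unfolding k_def using n(1) nat_floor_le[of "\<kappa> * n / 8"] nat_floor_ge[of "\<kappa> * n / 8"] by linarith+
  have w: "6 * \<kappa> * n \<le> real w"
    unfolding w_def using k0 d by linarith
  have K: "real K \<le> \<kappa> * n" unfolding K_def using n(1) by (intro nat_floor_le) auto
  have "\<eta> * n \<le> \<kappa> * n" "\<eta>' * n \<le> \<eta> * n" using \<eta>(2) \<eta>'(2) by (auto intro!: mult_right_mono)
  then have \<eta>n: "\<eta> * n \<le> \<kappa> * n" "\<eta>' * n \<le> \<kappa> * n" "8 \<le> \<eta> * n" using n(2) by linarith+
  have l: "real l \<le> \<kappa> * n" unfolding l_def using \<eta>n nat_floor_le[of "\<eta> * n"] by linarith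
  have t: "real t \<le> \<eta>' * n" "\<eta>' * n / 2 \<le> real t"
    unfolding t_def using n(2) nat_floor_le[of "\<eta>' * n"] nat_floor_ge[of "\<eta>' * n"] by linarith+
  have s: "real s \<le> \<eta>' * n / 4" "\<eta>' * n / 8 \<le> real s"
    unfolding s_def using n(2) nat_floor_le[of "\<eta>' * n / 4"] nat_floor_ge[of "\<eta>' * n / 4"] by linarith+
  have par: "0 < K" "0 < l" "1 \<le> B" "exp 1 * real n / real l \<le> B" "0 \<le> \<theta>" "B * (1 + \<theta>) / K \<le> \<theta>"
    "(1 + 2 * B\<^sup>2 / K) ^ t * (1 + \<theta> * real (l + t) / K) ^ l * (1 + \<theta>) \<le> exp (ln (1 + \<rho>))"
    unfolding K_def l_def t_def B_def \<theta>_def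
    using overlap_parameters[OF \<kappa>0 _ \<eta> \<eta>' _ _ n(3,4)] \<kappa>1 n(1) \<eta>n(3) by auto
  have C0: "0 < C" using \<kappa>0 by (simp add: C)
  have p: "0 \<le> C / n" "C / n \<le> 1" using C0 n(5) n0 by auto
  have ln2n: "\<delta> * n \<le> real n / 2" by (rule \<delta>n2)
  have \<kappa>nn: "\<kappa> * n \<le> real n / 800" using mult_right_mono[OF \<kappa>1, of "real n"] by simp
  have one: "measure_pmf.prob (coloured_perturbed_graph V {} (C / n) Col)
      {(R, c). R \<subseteq> nsets V 2 \<and> (\<exists>P. rainbow_path V Col R c P \<and> n \<le> length P + 2 * k \<and>
          well_placed (E0 - R) V m (k0 - 3 * d) P)}
    \<ge> 1 - (8 ^ n * exp (- (C / n * real k ^ 3 / real n)) + real n * (exp (C / n * real n) / 2 ^ d) +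
         2 * real n ^ 2 * 2 ^ k0 * (1 - real g ^ 3 / (2 * real n ^ 3)) ^ m)"
  proof (rule prob_well_placed_rainbow_path[OF V n0 Col p])
    fix z assume z: "z \<in> V"
    have "real (g + 2 + 3 * m) \<le> \<delta> * n" using g m \<delta>n by simp
    also have "\<dots> \<le> real (degree E0 z)" by (rule deg[OF z])
    also have "degree E0 z = card ({x. {z, x} \<in> E0} \<inter> V)" by (rule degree_eq_card_neighbours[OF E0])
    finally show "g + 2 + 3 * m \<le> card ({x. {z, x} \<in> E0} \<inter> V)" by linarith
  next
    have "6 * real m + 2 * real k \<le> real n" using m k \<delta>n2 \<kappa>nn by linarith
    then show "6 * m + 2 * k \<le> n" by linarith
  qed
  \<comment> \<open>This dictates \<open>C\<close>: as \<open>k \<ge> \<kappa> * n / 16\<close>, the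
    exponent is at least \<open>5 * n\<close>.\<close>
  have e1: "8 ^ n * exp (- (C / n * real k ^ 3 / real n)) \<le> (1/2) ^ n"
  proof -
    have "(\<kappa> * n / 16) ^ 3 \<le> real k ^ 3" using k \<kappa>0 by (intro power_mono) auto
    then have "C / n * (\<kappa> * n / 16) ^ 3 / n \<le> C / n * real k ^ 3 / n"
      using C0 by (intro divide_right_mono mult_left_mono) auto
    moreover have "C / n * (\<kappa> * n / 16) ^ 3 / n = 5 * n"
      using \<kappa>0 n0 by (simp add: C power3_eq_cube field_simps)
    ultimately have "5 * real n \<le> C / n * real k ^ 3 / n" by simp
    from exp_le_half_power[OF _ this, of 3] show ?thesis by simp
  qed
  \<comment> \<open>The decay comes from \<open>exp (1 / 2) \<le> 2\<close>, and the extra 1 in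
    \<open>exp (C + 1)\<close> absorbs the rounding of \<open>d\<close>.\<close>
  have e2: "real n * (exp (C / n * real n) / 2 ^ d) \<le> exp (C + 1) * real n ^ 1 * exp (- (\<kappa> / 6 * real n))"
  proof -
    have "exp (real d / 2) \<le> 2 ^ d"
    proof -
      have "exp (1 / 2) \<le> (2::real)"
      proof -
        have "(exp (1 / 2 :: real))\<^sup>2 = exp 1" by (simp flip: exp_double)
        also have "\<dots> \<le> 2\<^sup>2" using exp_le by simp
        finally show ?thesis by (rule power2_le_imp_le) simp
      qed
      then have "exp (1 / 2) ^ d \<le> (2::real) ^ d" by (rule power_mono) simp
      then show ?thesis by (simp flip: exp_of_nat_mult)
    qed
    then have "exp C / 2 ^ d \<le> exp C / exp (real d / 2)" by (intro divide_left_mono) auto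
    also have "\<dots> = exp (C - real d / 2)" by (simp add: exp_diff)
    also have "\<dots> \<le> exp (C + 1 - \<kappa> / 6 * n)" using d by simp
    finally have "exp C / 2 ^ d \<le> exp (C + 1) * exp (- (\<kappa> / 6 * n))" by (simp flip: exp_add)
    then have "real n * (exp C / 2 ^ d) \<le> real n * (exp (C + 1) * exp (- (\<kappa> / 6 * n)))"
      by (rule mult_left_mono) simp
    then show ?thesis using n0 by (simp add: mult_ac)
  qed
  have e3: "2 * real n ^ 2 * 2 ^ k0 * (1 - real g ^ 3 / (2 * real n ^ 3)) ^ m \<le> 2 * real n ^ 2 * exp (- (\<kappa> * real n))"
  proof -
    let ?x = "real g ^ 3 / (2 * real n ^ 3)"
    have "(\<delta> * n / 4) ^ 3 \<le> real g ^ 3" using g \<delta> by (intro power_mono) auto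
    then have "(\<delta> * n / 4) ^ 3 / (2 * real n ^ 3) \<le> ?x" by (intro divide_right_mono) auto
    moreover have "(\<delta> * n / 4) ^ 3 / (2 * real n ^ 3) = \<gamma>"
      using n0 by (simp add: \<gamma>_def power_mult_distrib power_divide)
    ultimately have x\<gamma>: "\<gamma> \<le> ?x" by simp
    have "real g \<le> n" using g \<delta>n2 \<delta>n by linarith
    then have "real g ^ 3 \<le> real n ^ 3" by (intro power_mono) auto
    also have "\<dots> \<le> 2 * real n ^ 3" by simp
    finally have x1: "?x \<le> 1" using n0 by (simp add: field_simps)
    have "(1 - ?x) ^ m \<le> exp (- (?x * m))" by (rule one_minus_power_le_exp[OF x1])
    also have "\<dots> \<le> exp (- (\<gamma> * m))" using mult_right_mono[OF x\<gamma>, of "real m"] by simp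
    finally have 1: "(1 - ?x) ^ m \<le> exp (- (\<gamma> * m))" .
    have "(2::real) ^ k0 \<le> exp (real k0)" by (rule two_power_le_exp)
    also have "\<dots> \<le> exp (\<gamma> * m / 2)" using k0 by simp
    finally have "2 ^ k0 * (1 - ?x) ^ m \<le> exp (\<gamma> * m / 2) * exp (- (\<gamma> * m))"
      using 1 x1 by (intro mult_mono) auto
    also have "\<dots> = exp (- (\<gamma> * m / 2))" by (simp flip: exp_add)
    also have "\<dots> \<le> exp (- (\<kappa> * n))"
    proof -
      have "0 \<le> \<kappa> * n" using n(1) by linarith
      then show ?thesis using gm by simp
    qed
    finally have "2 * real n ^ 2 * (2 ^ k0 * (1 - ?x) ^ m) \<le> 2 * real n ^ 2 * exp (- (\<kappa> * n))"
      by (rule mult_left_mono) simp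
    then show ?thesis by (simp add: mult.assoc)
  qed
  have e4: "16 ^ n * (1 - (real s / real n)\<^sup>2) ^ (t * (w - 2 * k)) \<le> (1/2) ^ n"
  proof -
    let ?x = "(real s / real n)\<^sup>2"
    have "real s \<le> n" using s \<eta>n \<kappa>nn by linarith
    then have "?x \<le> 1" using n0 by (simp add: power_le_one)
    then have "(1 - ?x) ^ (t * (w - 2 * k)) \<le> exp (- (?x * real (t * (w - 2 * k))))"
      by (rule one_minus_power_le_exp)
    moreover have "5 * real n \<le> ?x * real (t * (w - 2 * k))"
    proof -
      \<comment> \<open>128 is \<open>8 * 8 * 2\<close>, from \<open>s \<ge> \<eta>' * n / 8\<close>
        squared and \<open>t \<ge> \<eta>' * n / 2\<close>.\<close>
      have "5 * real n \<le> \<eta>' ^ 3 * \<kappa> / 128 * real n * real n"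
        using n(6) by (intro mult_right_mono) auto
      also have "\<dots> = (\<eta>' / 8)\<^sup>2 * (\<eta>' * n / 2 * (\<kappa> * n))"
        by (simp add: power2_eq_square power3_eq_cube)
      also have "\<dots> \<le> ?x * (real t * real (w - 2 * k))"
      proof (intro mult_mono power_mono)
        show "\<eta>' / 8 \<le> real s / real n" using s n0 by (simp add: field_simps)
        show "\<eta>' * n / 2 \<le> real t" by (rule t)
        show "\<kappa> * n \<le> real (w - 2 * k)" using w k n(1) by linarith
      qed (use \<eta>' \<kappa>0 in auto)
      finally show ?thesis by simp
    qed
    ultimately have "16 ^ n * (1 - ?x) ^ (t * (w - 2 * k)) \<le> 16 ^ n * exp (- (?x * real (t * (w - 2 * k))))"
      by (intro mult_left_mono) auto
    also have "\<dots> \<le> (1/2) ^ n"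
      using exp_le_half_power[of 4 n "?x * real (t * (w - 2 * k))"] \<open>5 * real n \<le> ?x * real (t * (w - 2 * k))\<close>
      by simp
    finally show ?thesis .
  qed
  let ?T = "{(E, c). \<exists>H. hamilton_cycle V E H \<and> rainbow c H}"
  have "measure_pmf.prob (bind_pmf (coloured_perturbed_graph V {} (C / n) Col)
      (\<lambda>(R, c). map_pmf (\<lambda>c'. (E0 \<union> R, \<lambda>e. if e \<in> R then c e else c' e)) (uniform_colouring Col (E0 - R)))) ?T
    \<ge> 1 - ((1/2) ^ n + exp (C + 1) * real n ^ 1 * exp (- (\<kappa> / 6 * real n)) +
        2 * real n ^ 2 * exp (- (\<kappa> * real n))) - ((1/2) ^ n + \<rho>)"
  proof (rule prob_bind_pmf_ge)
    show "1 - ((1/2) ^ n + exp (C + 1) * real n ^ 1 * exp (- (\<kappa> / 6 * real n)) +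
        2 * real n ^ 2 * exp (- (\<kappa> * real n))) \<le> measure_pmf.prob (coloured_perturbed_graph V {} (C / n) Col)
      {(R, c). R \<subseteq> nsets V 2 \<and> (\<exists>P. rainbow_path V Col R c P \<and> n \<le> length P + 2 * k \<and>
          well_placed (E0 - R) V m w P)}"
      using one e1 e2 e3 unfolding w_def by linarith
    show "0 \<le> (1/2) ^ n + \<rho>" using \<rho> by simp
  next
    fix Rc assume "Rc \<in> {(R, c). R \<subseteq> nsets V 2 \<and> (\<exists>P. rainbow_path V Col R c P \<and> n \<le> length P + 2 * k \<and>
          well_placed (E0 - R) V m w P)}"
    then obtain R c P where Rc: "Rc = (R, c)" "R \<subseteq> nsets V 2"
      and P: "rainbow_path V Col R c P" "n \<le> length P + 2 * k" "well_placed (E0 - R) V m w P" by auto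
    have "1 - 16 ^ n * (1 - (real s / real n)\<^sup>2) ^ (t * (w - 2 * k)) - \<rho> \<le>
      measure_pmf.prob (uniform_colouring Col (E0 - R))
      {c'. \<exists>H. hamilton_cycle V (E0 \<union> R) H \<and> rainbow (\<lambda>e. if e \<in> R then c e else c' e) H}"
    proof (rule prob_complete_rainbow_path[OF V _ Col E0 Rc(2) P _ _ _ _ _ par(2,1) _ par(3-6)])
      show "3 \<le> n" using n(1) \<kappa>nn by linarith
      show "0 < m" using m \<delta>n by linarith
      have "0 < real n" using n0 by simp
      then have "6 * real m + 2 * real k < real n" using m k \<delta>n2 \<kappa>nn by linarith
      then show "6 * m + 2 * k < n" by linarith
      have "real (2 * s) \<le> real t" using s t by simp
      then show "2 * s \<le> t" by linarith
      show "0 < t" using t n(2) by linarith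
      have "real s \<le> n" using s \<eta>n \<kappa>nn by linarith
      then show "s \<le> n" by linarith
      have "real (K + l + t) \<le> real w" using K l t w \<eta>n n(1) by simp
      then show "K + l + t \<le> w" by linarith
      show "0 \<le> \<rho>" using \<rho> by simp
      show "(1 + 2 * B\<^sup>2 / K) ^ t * (1 + \<theta> * real (l + t) / K) ^ l * (1 + \<theta>) \<le> 1 + \<rho>"
        using par(7) \<rho> by simp
    qed
    then show "1 - ((1/2) ^ n + \<rho>) \<le> measure_pmf.prob (case Rc of (R, c) \<Rightarrow>
        map_pmf (\<lambda>c'. (E0 \<union> R, \<lambda>e. if e \<in> R then c e else c' e)) (uniform_colouring Col (E0 - R))) ?T"
      using e4 by (simp add: Rc vimage_def)
  qed
  then show ?thesis unfolding coloured_perturbed_graph_split[OF V(1) E0, symmetric] .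
qed

theorem theorem1p1:
  fixes \<delta> :: real
  assumes "0 < \<delta>" and "\<delta> < 1 / 2"
  shows "\<exists>C::real. C > 0 \<and>
    (\<forall>G0 :: nat \<Rightarrow> nat set set.
      (\<forall>n. simple_graph {1..n} (G0 n)) \<and>
      (\<forall>\<^sub>F n in sequentially. real (min_degree {1..n} (G0 n)) \<ge> \<delta> * real n) \<longrightarrow>
      (\<lambda>n. measure_pmf.prob (coloured_perturbed_graph {1..n} (G0 n) (C / real n) {1..n})
             {(E, c). \<exists>H. hamilton_cycle {1..n} E H \<and> rainbow c H}) \<longlonglongrightarrow> 1)"
proof -
  define \<kappa> where "\<kappa> = \<delta> ^ 4 / 51200"
  define C where "C = 5 / (\<kappa> / 16) ^ 3"
  have \<kappa>: "0 < \<kappa>" using assms by (simp add: \<kappa>_def)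
  then have C: "0 < C" by (simp add: C_def)
  show ?thesis
  proof (intro exI[of _ C] conjI allI impI C)
    fix G0 :: "nat \<Rightarrow> nat set set"
    assume G0: "(\<forall>n. simple_graph {1..n} (G0 n)) \<and>
      (\<forall>\<^sub>F n in sequentially. real (min_degree {1..n} (G0 n)) \<ge> \<delta> * real n)"
    let ?p = "\<lambda>n. measure_pmf.prob (coloured_perturbed_graph {1..n} (G0 n) (C / real n) {1..n})
             {(E, c). \<exists>H. hamilton_cycle {1..n} E H \<and> rainbow c H}"
    let ?err = "\<lambda>n. (1/2) ^ n + exp (C + 1) * real n ^ 1 * exp (- (\<kappa> / 6 * real n)) +
        2 * real n ^ 2 * exp (- (\<kappa> * real n)) + (1/2) ^ n"
    have err: "?err \<longlonglongrightarrow> 0"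
    proof -
      have "(\<lambda>n. (1/2) ^ n :: real) \<longlonglongrightarrow> 0" by (rule LIMSEQ_realpow_zero) auto
      moreover have "(\<lambda>n. exp (C + 1) * real n ^ 1 * exp (- (\<kappa> / 6 * real n))) \<longlonglongrightarrow> 0"
        using \<kappa> by (intro power_exp_tendsto_0) simp
      moreover have "(\<lambda>n. 2 * real n ^ 2 * exp (- (\<kappa> * real n))) \<longlonglongrightarrow> 0"
        using \<kappa> by (rule power_exp_tendsto_0)
      ultimately have "?err \<longlonglongrightarrow> 0 + 0 + 0 + 0" by (intro tendsto_add)
      then show ?thesis by simp
    qed
    show "?p \<longlonglongrightarrow> 1"
    proof (rule order_tendstoI)
      fix a :: real assume "1 < a"
      moreover have "?p n \<le> 1" for n by simp
      ultimately show "\<forall>\<^sub>F n in sequentially. ?p n < a"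
        by (intro always_eventually allI) (rule le_less_trans)
    next
      fix a :: real assume "a < 1"
      \<comment> \<open>Half of \<open>1 - a\<close> is spent on the second moment and the other
        half on the vanishing error terms. \<open>C\<close> has been fixed before.\<close>
      define \<rho> where "\<rho> = (1 - a) / 2"
      have \<rho>: "0 < \<rho>" using \<open>a < 1\<close> by (simp add: \<rho>_def)
      \<comment> \<open>Makes \<open>exp \<nu> = 1 + \<rho>\<close>, the bound on the overlap moment
        required by the second moment method.\<close>
      define \<nu> where "\<nu> = ln (1 + \<rho>)"
      have \<nu>: "0 < \<nu>" using \<rho> by (simp add: \<nu>_def)
      define \<eta> where "\<eta> = min \<kappa> (\<nu> * \<kappa>\<^sup>2 / 288)"
      have \<eta>: "0 < \<eta>" "\<eta> \<le> \<kappa>" "288 * \<eta> \<le> \<nu> * \<kappa>\<^sup>2"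
        using \<kappa> \<nu> by (auto simp: \<eta>_def min_def)
      \<comment> \<open>Chosen after \<open>\<eta>\<close> and small compared with its square, since
        each appending step costs \<open>B\<^sup>2 / K\<close> with \<open>B\<close> of order
        \<open>1 / \<eta>\<close>.\<close>
      define \<eta>' where "\<eta>' = min \<eta> (\<nu> * (\<eta>\<^sup>2 * \<kappa>) / 432)"
      have \<eta>': "0 < \<eta>'" "\<eta>' \<le> \<eta>" "432 * \<eta>' \<le> \<nu> * (\<eta>\<^sup>2 * \<kappa>)"
        using \<kappa> \<nu> \<eta> by (auto simp: \<eta>'_def min_def)
      have "0 < \<eta>' ^ 3 * \<kappa> / 128" using \<eta>' \<kappa> by simp
      note large = eventually_const_le_mult[OF \<kappa>] eventually_const_le_mult[OF \<eta>'(1)]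
        eventually_const_le_mult[OF \<nu>] eventually_const_le_mult[of 1] eventually_const_le_mult[OF this]
      have "\<forall>\<^sub>F n in sequentially. ?err n < \<rho>" using err \<rho> by (rule order_tendstoD)
      moreover note conjunct2[OF G0] large(1)[of 48] large(2)[of 8] large(1)[of "24 / \<eta>"]
        large(3)[of "72 / (\<eta> * \<kappa>)"] large(4)[OF zero_less_one, of C] large(5)[of 5]
      ultimately show "\<forall>\<^sub>F n in sequentially. a < ?p n"
      proof eventually_elim
        case (elim n)
        have G: "G0 n \<subseteq> nsets {1..n} 2" using G0 by (auto simp: simple_graph_def)
        have deg: "\<delta> * real n \<le> real (degree (G0 n) z)" if "z \<in> {1..n}" for z
        proof -
          have "min_degree {1..n} (G0 n) \<le> degree (G0 n) z"
            using that unfolding min_degree_def by (intro Min_le) auto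
          then show ?thesis using elim(2) by linarith
        qed
        have "?p n \<ge> 1 - ((1/2) ^ n + exp (C + 1) * real n ^ 1 * exp (- (\<kappa> / 6 * real n)) +
            2 * real n ^ 2 * exp (- (\<kappa> * real n))) - ((1/2) ^ n + \<rho>)"
          using elim \<eta> \<eta>' deg unfolding \<nu>_def
          by (intro prob_rainbow_hamilton_cycle_ge[OF assms \<kappa>_def C_def _ _ _ _ G _ \<rho>]) auto
        then have "?p n \<ge> 1 - ?err n - \<rho>" by linarith
        moreover have "a = 1 - 2 * \<rho>" by (simp add: \<rho>_def field_simps)
        ultimately show ?case using elim(1) by linarith
      qed
    qed
  qed
qed

end
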